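(* Let $\mathfrak g=\mathfrak{gl}(m,n)$, $\lambda\in\mathfrak h^*$, and let $\gamma\in B(\lambda)$ be a positive isotropic root. Then $\gamma$ is independent at $\lambda$ if and only if $\gamma$ is $\lambda$-minimal.
   Context: The ground field $\mathtt k$ is algebraically closed of characteristic $0$. $\mathfrak{gl}(m,n)$ has the diagonal Cartan subalgebra $\mathfrak h$, coordinate functions $\epsilon_1,\dots,\epsilon_m,\delta_1,\dots,\delta_n$, form $(\epsilon_i,\epsilon_j)=\delta_{ij}$, $(\delta_i,\delta_j)=-\delta_{ij}$, $(\epsilon_i,\delta_j)=0$, and the distinguished Borel subalgebra (upper triangular matrices) with positive even roots $\epsilon_i-\epsilon_j$, $\delta_i-\delta_j$ ($i<j$) and positive odd (isotropic) roots $\epsilon_i-\delta_j$; $\mathfrak n^\pm$ are the strictly upper/lower triangular matrices; $\rho=\frac12\sum_{\rm even}\alpha-\frac12\sum_{\rm odd}\alpha$ over positive roots. $M(\lambda)$ is the Verma module with highest weight vector $v_\lambda$ of weight $\lambda$. For a positive odd root $\gamma$, let $h_\gamma\in\mathfrak h$ correspond to $\gamma$ under the form. A Šapovalov element $\theta_\gamma$ is an element $\sum_\pi e_{-\pi}H_\pi\in U(\mathfrak n^-\oplus\mathfrak h)$ of weight $-\gamma$, with $H_\pi\in U(\mathfrak h)$, $\pi$ running over partitions of $\gamma$ into positive roots and $e_{-\pi}$ the corresponding ordered product of negative root vectors, such that the coefficient of the partition into simple roots is $1$ and $e_\alpha\theta_\gamma\in U(\mathfrak g)(h_\gamma+\rho(h_\gamma))+U(\mathfrak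 g)\mathfrak n^+$ for all positive roots $\alpha$. The vector $\theta_\gamma v_\lambda\in M(\lambda)$ is uniquely determined when $(\lambda+\rho,\gamma)=0$. $B(\lambda)$ is the set of positive odd roots $\gamma$ with $(\lambda+\rho,\gamma)=0$. On $B(\lambda)$ put $\gamma'\le\gamma$ if $\gamma-\gamma'$ is a (possibly empty) sum of positive even roots, and $\gamma'\downarrow\gamma$ if $\gamma'\le\gamma$ and $(\gamma,\gamma')\ne0$. The root $\gamma\in B(\lambda)$ is $\lambda$-minimal if $\gamma'\downarrow\gamma$ with $\gamma'\in B(\lambda)$ implies $\gamma'=\gamma$. The root $\gamma\in B(\lambda)$ is independent at $\lambda$ if $$\theta_\gamma v_\lambda\notin\sum_{\gamma'\in B(\lambda)\setminus\{\gamma\}}U(\mathfrak g)\theta_{\gamma'}v_\lambda .$$ *)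

theory Defs
  imports "HOL-Analysis.Analysis" "HOL-Library.Poly_Mapping" "HOL-Library.Multiset"
    "HOL-Library.Set_Algebras" "HOL-Computational_Algebra.Polynomial"
begin

section \<open>The Lie superalgebra gl(m,n)\<close>

text \<open>The finite linear orders 'm and 'n play the role of {1..m} and {1..n}. Rows and columns
  are indexed by 'm + 'n, where all of 'm (even indices) precedes all of 'n (odd indices).\<close>

type_synonym ('k, 'm, 'n) gl = "'k ^ ('m + 'n) ^ ('m + 'n)"

primrec odd_index :: "'m + 'n \<Rightarrow> bool" where
  "odd_index (Inl i) = False"
| "odd_index (Inr j) = True"

fun idx_less :: "'m::linorder + 'n::linorder \<Rightarrow> 'm + 'n \<Rightarrow> bool" where
  "idx_less (Inl i) (Inl j) = (i < j)"
| "idx_less (Inl i) (Inr j) = True"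
| "idx_less (Inr i) (Inl j) = False"
| "idx_less (Inr i) (Inr j) = (i < j)"

text \<open>A parity is a natural number, of which only the class modulo 2 matters: \<open>homogeneous p x\<close>
  says that x lies in the homogeneous component of gl(m,n) of degree p mod 2.\<close>

definition homogeneous :: "nat \<Rightarrow> ('k::field, 'm::finite, 'n::finite) gl \<Rightarrow> bool" where
  "homogeneous p x \<longleftrightarrow>
     (\<forall>a b. x $ a $ b \<noteq> 0 \<longrightarrow> ((odd_index a \<noteq> odd_index b) \<longleftrightarrow> odd p))"

definition mat_scale :: "'k::field \<Rightarrow> ('k, 'm::finite, 'n::finite) gl \<Rightarrow> ('k, 'm, 'n) gl" where
  "mat_scale c x = (\<chi> a b. c * x $ a $ b)"

text \<open>The supercommutator of elements that are homogeneous of parity p and q.\<close>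

definition superbracket ::
  "nat \<Rightarrow> nat \<Rightarrow> ('k::field, 'm::finite, 'n::finite) gl \<Rightarrow> ('k, 'm, 'n) gl \<Rightarrow> ('k, 'm, 'n) gl" where
  "superbracket p q x y = x ** y - mat_scale ((-1) ^ (p * q)) (y ** x)"

definition cartan :: "('k::field, 'm::finite, 'n::finite) gl set" where
  "cartan = {x. \<forall>a b. a \<noteq> b \<longrightarrow> x $ a $ b = 0}"

definition n_plus :: "('k::field, 'm::{finite,linorder}, 'n::{finite,linorder}) gl set" where
  "n_plus = {x. \<forall>a b. \<not> idx_less a b \<longrightarrow> x $ a $ b = 0}"

definition b_minus :: "('k::field, 'm::{finite,linorder}, 'n::{finite,linorder}) gl set" where
  "b_minus = {x. \<forall>a b. idx_less a b \<longrightarrow> x $ a $ b = 0}"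


section \<open>The universal enveloping algebra\<close>

text \<open>Words under concatenation are the free monoid, written additively so that convolution of
  finitely supported functions on words is the multiplication of the free associative algebra.\<close>

datatype 'x freemon = Wd (letters: "'x list")

instantiation freemon :: (type) monoid_add
begin

definition zero_freemon :: "'a freemon" where "0 = Wd []"
definition plus_freemon :: "'a freemon \<Rightarrow> 'a freemon \<Rightarrow> 'a freemon" where
  "u + v = Wd (letters u @ letters v)"

instance
  by standard (simp_all add: zero_freemon_def plus_freemon_def)

end

lemma freemon_add_eq_0: "u + v = (0 :: 'x freemon) \<longleftrightarrow> u = 0 \<and> v = 0"
  by (cases u; cases v) (auto simp: zero_freemon_def plus_freemon_def)

definition fa_gen :: "'x \<Rightarrow> 'x freemon \<Rightarrow>\<^sub>0 'k::field" where
  "fa_gen x = Poly_Mapping.single (Wd [x]) 1"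

definition fa_scalar :: "'k::field \<Rightarrow> 'x freemon \<Rightarrow>\<^sub>0 'k" where
  "fa_scalar c = Poly_Mapping.single 0 c"

inductive_set two_sided_ideal :: "'r::ring_1 set \<Rightarrow> 'r set" for S where
  zero: "0 \<in> two_sided_ideal S"
| step: "s \<in> S \<Longrightarrow> x \<in> two_sided_ideal S \<Longrightarrow> a * s * b + x \<in> two_sided_ideal S"

text \<open>Modulo the first two families of relations, the free algebra on the set gl(m,n) is the
  tensor algebra of the vector space gl(m,n).\<close>

definition ug_relations ::
  "(('k::field, 'm::finite, 'n::finite) gl freemon \<Rightarrow>\<^sub>0 'k) set" where
  "ug_relations =
     {fa_gen (x + y) - fa_gen x - fa_gen y | x y. True}
   \<union> {fa_gen (mat_scale c x) - fa_scalar c * fa_gen x | c x. True}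
   \<union> {fa_gen x * fa_gen y - fa_scalar ((-1) ^ (p * q)) * fa_gen y * fa_gen x
        - fa_gen (superbracket p q x y) | p q x y. homogeneous p x \<and> homogeneous q y}"

lemma two_sided_ideal_add:
  "x \<in> two_sided_ideal S \<Longrightarrow> y \<in> two_sided_ideal S \<Longrightarrow> x + y \<in> two_sided_ideal S"
  by (induction rule: two_sided_ideal.induct)
    (auto simp: add.assoc intro: two_sided_ideal.intros)

lemma two_sided_ideal_mult:
  "x \<in> two_sided_ideal S \<Longrightarrow> a * x * b \<in> two_sided_ideal S"
proof (induction rule: two_sided_ideal.induct)
  case zero
  then show ?case by (simp add: two_sided_ideal.zero)
next
  case (step s x c d)
  have "(a * c) * s * (d * b) + a * x * b \<in> two_sided_ideal S"
    using step by (intro two_sided_ideal.step) auto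
  then show ?case by (simp add: algebra_simps)
qed

lemma two_sided_ideal_multl: "x \<in> two_sided_ideal S \<Longrightarrow> a * x \<in> two_sided_ideal S"
  using two_sided_ideal_mult[of x S a 1] by simp

lemma two_sided_ideal_multr: "x \<in> two_sided_ideal S \<Longrightarrow> x * b \<in> two_sided_ideal S"
  using two_sided_ideal_mult[of x S 1 b] by simp

lemma two_sided_ideal_uminus: "x \<in> two_sided_ideal S \<Longrightarrow> - x \<in> two_sided_ideal S"
  using two_sided_ideal_multl[of x S "-1"] by simp

lemma two_sided_ideal_trans:
  "x - y \<in> two_sided_ideal S \<Longrightarrow> y - z \<in> two_sided_ideal S \<Longrightarrow> x - z \<in> two_sided_ideal S"
  using two_sided_ideal_add[of "x - y" S "y - z"] by simp

definition ug_cong ::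
  "(('k::field, 'm::finite, 'n::finite) gl freemon \<Rightarrow>\<^sub>0 'k) \<Rightarrow> (('k, 'm, 'n) gl freemon \<Rightarrow>\<^sub>0 'k) \<Rightarrow> bool" where
  "ug_cong x y \<longleftrightarrow> x - y \<in> two_sided_ideal ug_relations"

lemma ug_cong_equivp: "equivp ug_cong"
proof (rule equivpI)
  show "reflp ug_cong"
    by (auto simp: reflp_def ug_cong_def intro: two_sided_ideal.zero)
  show "symp ug_cong"
    unfolding symp_def ug_cong_def by (metis minus_diff_eq two_sided_ideal_uminus)
  show "transp ug_cong"
    unfolding transp_def ug_cong_def by (blast intro: two_sided_ideal_trans)
qed

quotient_type (overloaded) ('k, 'm, 'n) Ugl =
  "('k::field, 'm::finite, 'n::finite) gl freemon \<Rightarrow>\<^sub>0 'k" / ug_cong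
  by (rule ug_cong_equivp)

text \<open>The augmentation of the free algebra kills the relations; hence U(gl(m,n)) is nonzero.\<close>

lemma lookup_mult_0:
  fixes f g :: "'x freemon \<Rightarrow>\<^sub>0 'k::field"
  shows "Poly_Mapping.lookup (f * g) 0 = Poly_Mapping.lookup f 0 * Poly_Mapping.lookup g 0"
proof -
  have "Sum_any (\<lambda>q. Poly_Mapping.lookup g q when 0 = l + q) = (Poly_Mapping.lookup g 0 when l = 0)" for l
  proof (cases "l = 0")
    case False
    then have "\<And>q. 0 \<noteq> l + q"
      using freemon_add_eq_0 by metis
    with False show ?thesis by simp
  qed simp
  then show ?thesis
    by (simp add: lookup_mult mult_when)
qed

lemma fa_gen_lookup_0: "Poly_Mapping.lookup (fa_gen x) 0 = 0"
  by (simp add: fa_gen_def lookup_single zero_freemon_def)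

lemma ug_relations_lookup_0: "s \<in> ug_relations \<Longrightarrow> Poly_Mapping.lookup s 0 = 0"
  by (auto simp: ug_relations_def lookup_minus lookup_mult_0 fa_gen_lookup_0)

lemma ug_ideal_lookup_0: "x \<in> two_sided_ideal ug_relations \<Longrightarrow> Poly_Mapping.lookup x 0 = 0"
  by (induction rule: two_sided_ideal.induct)
    (auto simp: lookup_add lookup_mult_0 ug_relations_lookup_0)

instantiation Ugl :: (field, finite, finite) ring_1
begin

lift_definition zero_Ugl :: "('a, 'b, 'c) Ugl" is 0 .
lift_definition one_Ugl :: "('a, 'b, 'c) Ugl" is 1 .

lift_definition plus_Ugl :: "('a, 'b, 'c) Ugl \<Rightarrow> ('a, 'b, 'c) Ugl \<Rightarrow> ('a, 'b, 'c) Ugl" is "(+)"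
  unfolding ug_cong_def by (metis add_diff_add two_sided_ideal_add)

lift_definition uminus_Ugl :: "('a, 'b, 'c) Ugl \<Rightarrow> ('a, 'b, 'c) Ugl" is uminus
  unfolding ug_cong_def by (metis minus_diff_minus two_sided_ideal_uminus)

lift_definition minus_Ugl :: "('a, 'b, 'c) Ugl \<Rightarrow> ('a, 'b, 'c) Ugl \<Rightarrow> ('a, 'b, 'c) Ugl" is "(-)"
proof -
  fix x x' y y' :: "('a, 'b, 'c) gl freemon \<Rightarrow>\<^sub>0 'a"
  assume "ug_cong x x'" "ug_cong y y'"
  then have "(x - x') + - (y - y') \<in> two_sided_ideal ug_relations"
    unfolding ug_cong_def by (intro two_sided_ideal_add two_sided_ideal_uminus)
  then show "ug_cong (x - y) (x' - y')"
    by (simp add: ug_cong_def algebra_simps)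
qed

lift_definition times_Ugl :: "('a, 'b, 'c) Ugl \<Rightarrow> ('a, 'b, 'c) Ugl \<Rightarrow> ('a, 'b, 'c) Ugl" is "(*)"
proof -
  fix x x' y y' :: "('a, 'b, 'c) gl freemon \<Rightarrow>\<^sub>0 'a"
  assume "ug_cong x x'" "ug_cong y y'"
  then have "(x - x') * y + x' * (y - y') \<in> two_sided_ideal ug_relations"
    unfolding ug_cong_def
    by (intro two_sided_ideal_add two_sided_ideal_multl two_sided_ideal_multr)
  then show "ug_cong (x * y) (x' * y')"
    by (simp add: ug_cong_def algebra_simps)
qed

instance
proof
  fix a b c :: "('a, 'b, 'c) Ugl"
  have cong: "ug_cong x y" if "x = y" for x y :: "('a, 'b, 'c) gl freemon \<Rightarrow>\<^sub>0 'a"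
    using that equivp_reflp[OF ug_cong_equivp] by blast
  show "a + b + c = a + (b + c)" by transfer (rule cong, simp add: algebra_simps)
  show "a + b = b + a" by transfer (rule cong, simp add: algebra_simps)
  show "0 + a = a" by transfer (rule cong, simp)
  show "- a + a = 0" by transfer (rule cong, simp)
  show "a - b = a + - b" by transfer (rule cong, simp)
  show "a * b * c = a * (b * c)" by transfer (rule cong, simp add: algebra_simps)
  show "(a + b) * c = a * c + b * c" by transfer (rule cong, simp add: algebra_simps)
  show "a * (b + c) = a * b + a * c" by transfer (rule cong, simp add: algebra_simps)
  show "1 * a = a" by transfer (rule cong, simp)
  show "a * 1 = a" by transfer (rule cong, simp)
  show "(0 :: ('a, 'b, 'c) Ugl) \<noteq> 1"
  proof transfer
    show "\<not> ug_cong (0 :: ('a, 'b, 'c) gl freemon \<Rightarrow>\<^sub>0 'a) 1"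
      using ug_ideal_lookup_0[where x = "0 - 1 :: ('a, 'b, 'c) gl freemon \<Rightarrow>\<^sub>0 'a"]
      by (auto simp: ug_cong_def lookup_minus)
  qed
qed

end

lift_definition ug_incl :: "('k::field, 'm::finite, 'n::finite) gl \<Rightarrow> ('k, 'm, 'n) Ugl" is fa_gen .

lift_definition ug_scalar :: "'k::field \<Rightarrow> ('k, 'm::finite, 'n::finite) Ugl" is fa_scalar .

definition is_subalgebra :: "('k::field, 'm::finite, 'n::finite) Ugl set \<Rightarrow> bool" where
  "is_subalgebra A \<longleftrightarrow> range ug_scalar \<subseteq> A \<and> (\<forall>x\<in>A. \<forall>y\<in>A. x + y \<in> A \<and> x * y \<in> A)"

text \<open>For a subalgebra s of gl(m,n), the enveloping algebra U(s) as the subalgebra of U(gl(m,n))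
  generated by s.\<close>

definition U_sub :: "('k::field, 'm::finite, 'n::finite) gl set \<Rightarrow> ('k, 'm, 'n) Ugl set" where
  "U_sub s = is_subalgebra hull (ug_incl ` s)"

inductive_set left_ideal :: "'r::ring_1 set \<Rightarrow> 'r set" for S where
  zero: "0 \<in> left_ideal S"
| step: "s \<in> S \<Longrightarrow> x \<in> left_ideal S \<Longrightarrow> a * s + x \<in> left_ideal S"


section \<open>Weights and roots\<close>

text \<open>A weight is represented by its coordinate vector with respect to the basis of coordinate
  functions \<open>eps i\<close>, \<open>del j\<close> of the dual of the Cartan subalgebra; \<open>wt_eval\<close> evaluates it.\<close>

type_synonym ('k, 'm, 'n) wt = "'k ^ ('m + 'n)"

definition eps :: "'m \<Rightarrow> ('k::field, 'm::finite, 'n::finite) wt" where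
  "eps i = axis (Inl i) 1"

definition del :: "'n \<Rightarrow> ('k::field, 'm::finite, 'n::finite) wt" where
  "del j = axis (Inr j) 1"

definition wt_eval :: "('k::field, 'm::finite, 'n::finite) wt \<Rightarrow> ('k, 'm, 'n) gl \<Rightarrow> 'k" where
  "wt_eval \<mu> h = (\<Sum>a\<in>UNIV. \<mu> $ a * h $ a $ a)"

definition wt_form :: "('k::field, 'm::finite, 'n::finite) wt \<Rightarrow> ('k, 'm, 'n) wt \<Rightarrow> 'k" where
  "wt_form \<mu> \<nu> = (\<Sum>i\<in>UNIV. \<mu> $ Inl i * \<nu> $ Inl i) - (\<Sum>j\<in>UNIV. \<mu> $ Inr j * \<nu> $ Inr j)"

definition even_pos_roots :: "('k::field, 'm::{finite,linorder}, 'n::{finite,linorder}) wt set" where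
  "even_pos_roots = {eps i - eps j | i j. i < j} \<union> {del i - del j | i j. i < j}"

definition odd_pos_roots :: "('k::field, 'm::{finite,linorder}, 'n::{finite,linorder}) wt set" where
  "odd_pos_roots = {eps i - del j | i j. True}"

definition pos_roots :: "('k::field, 'm::{finite,linorder}, 'n::{finite,linorder}) wt set" where
  "pos_roots = even_pos_roots \<union> odd_pos_roots"

definition simple_roots :: "('k::field, 'm::{finite,linorder}, 'n::{finite,linorder}) wt set" where
  "simple_roots = {\<alpha> \<in> pos_roots. \<not> (\<exists>\<beta>\<in>pos_roots. \<exists>\<gamma>\<in>pos_roots. \<alpha> = \<beta> + \<gamma>)}"

definition rho :: "('k::field, 'm::{finite,linorder}, 'n::{finite,linorder}) wt" where
  "rho = (1 / 2) *s (\<Sum>\<alpha>\<in>even_pos_roots. \<alpha>) - (1 / 2) *s (\<Sum>\<alpha>\<in>odd_pos_roots. \<alpha>)"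

text \<open>For a root \<open>\<alpha>\<close> there is exactly one matrix position of weight \<open>\<alpha>\<close>, so \<open>root_vec \<alpha>\<close> is
  a matrix unit.\<close>

definition root_vec :: "('k::field, 'm::finite, 'n::finite) wt \<Rightarrow> ('k, 'm, 'n) gl" where
  "root_vec \<alpha> = (\<chi> a b. if a \<noteq> b \<and> \<alpha> = axis a 1 - axis b 1 then 1 else 0)"

definition h_of :: "('k::field, 'm::finite, 'n::finite) wt \<Rightarrow> ('k, 'm, 'n) gl" where
  "h_of \<gamma> = (\<chi> a b. if a = b then (if odd_index a then - \<gamma> $ a else \<gamma> $ a) else 0)"

lemma h_of_in_cartan: "h_of \<gamma> \<in> cartan"
  by (simp add: h_of_def cartan_def)

lemma wt_eval_h_of: "wt_eval \<mu> (h_of \<gamma>) = wt_form \<mu> \<gamma>"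
proof -
  have "(\<Sum>a\<in>UNIV. f a) = (\<Sum>i\<in>UNIV. f (Inl i)) + (\<Sum>j\<in>UNIV. f (Inr j))"
    for f :: "'b + 'c \<Rightarrow> 'a"
    using sum.Plus[of UNIV UNIV f] by simp
  then show ?thesis
    by (simp add: wt_eval_def wt_form_def h_of_def sum_negf)
qed

text \<open>Only the zero functional on the Cartan subalgebra has zero coordinate vector.\<close>

lemma wt_eq_iff_eval:
  "\<mu> = \<nu> \<longleftrightarrow> (\<forall>h\<in>cartan. wt_eval \<mu> h = wt_eval \<nu> h)"
proof (intro iffI)
  assume *: "\<forall>h\<in>cartan. wt_eval \<mu> h = wt_eval \<nu> h"
  show "\<mu> = \<nu>"
  proof (rule vec_eq_iff[THEN iffD2], rule allI)
    fix c
    let ?h = "(\<chi> a b. if a = c \<and> b = c then 1 else 0) :: ('a, 'b, 'c) gl"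
    have "wt_eval \<kappa> ?h = \<kappa> $ c" for \<kappa> :: "('a, 'b, 'c) wt"
      by (simp add: wt_eval_def if_distrib[where f = "(*) _"] cong: if_cong)
    moreover have "?h \<in> cartan"
      by (auto simp: cartan_def)
    ultimately show "\<mu> $ c = \<nu> $ c"
      using * by metis
  qed
qed simp


section \<open>Shapovalov elements\<close>

definition root_partitions ::
  "('k::field, 'm::{finite,linorder}, 'n::{finite,linorder}) wt \<Rightarrow> ('k, 'm, 'n) wt multiset set" where
  "root_partitions \<gamma> = {\<pi>. set_mset \<pi> \<subseteq> pos_roots \<and> \<Sum>\<^sub># \<pi> = \<gamma>}"

text \<open>The list rs enumerates the positive roots in the order used for ordered products.\<close>

definition e_minus ::
  "('k::field, 'm::{finite,linorder}, 'n::{finite,linorder}) wt list \<Rightarrow> ('k, 'm, 'n) wt multiset \<Rightarrow>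
     ('k, 'm, 'n) Ugl" where
  "e_minus rs \<pi> = prod_list (map (\<lambda>\<alpha>. ug_incl (root_vec (- \<alpha>)) ^ count \<pi> \<alpha>) rs)"

definition shapovalov ::
  "('k::field, 'm::{finite,linorder}, 'n::{finite,linorder}) wt list \<Rightarrow> ('k, 'm, 'n) wt \<Rightarrow>
     ('k, 'm, 'n) Ugl \<Rightarrow> bool" where
  "shapovalov rs \<gamma> \<theta> \<longleftrightarrow>
     \<theta> \<in> U_sub b_minus \<and>
     (\<forall>h\<in>cartan. ug_incl h * \<theta> - \<theta> * ug_incl h = ug_scalar (wt_eval (- \<gamma>) h) * \<theta>) \<and>
     (\<exists>H. (\<forall>\<pi>\<in>root_partitions \<gamma>. H \<pi> \<in> U_sub cartan) \<and>
          (\<forall>\<pi>\<in>root_partitions \<gamma>. set_mset \<pi> \<subseteq> simple_roots \<longrightarrow> H \<pi> = 1) \<and>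
          \<theta> = (\<Sum>\<pi>\<in>root_partitions \<gamma>. e_minus rs \<pi> * H \<pi>)) \<and>
     (\<forall>\<alpha>\<in>pos_roots. \<exists>u. \<exists>w\<in>left_ideal (ug_incl ` n_plus).
        ug_incl (root_vec \<alpha>) * \<theta> =
          u * (ug_incl (h_of \<gamma>) + ug_scalar (wt_eval rho (h_of \<gamma>))) + w)"

text \<open>In characteristic 0 the sum over the partitions is finite.\<close>

lemma finite_pos_roots:
  "finite (pos_roots :: ('k::field, 'm::{finite,linorder}, 'n::{finite,linorder}) wt set)"
proof -
  have "pos_roots \<subseteq> range (\<lambda>(a, b). axis a 1 - axis b 1 :: ('k, 'm, 'n) wt)"
    by (auto simp: pos_roots_def even_pos_roots_def odd_pos_roots_def eps_def del_def image_iff)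
  then show ?thesis
    by (rule finite_subset) simp
qed

lemma finite_root_partitions:
  fixes \<gamma> :: "('k::field_char_0, 'm::{finite,linorder}, 'n::{finite,linorder}) wt"
  shows "finite (root_partitions \<gamma>)"
proof -
  define rk :: "'m + 'n \<Rightarrow> nat" where "rk a = card {b. idx_less a b}" for a
  define ht :: "('k, 'm, 'n) wt \<Rightarrow> 'k" where "ht w = (\<Sum>a\<in>UNIV. of_nat (rk a) * w $ a)" for w
  have trans: "idx_less a b \<Longrightarrow> idx_less b c \<Longrightarrow> idx_less a c" for a b c :: "'m + 'n"
    by (cases a; cases b; cases c) auto
  have irrefl: "\<not> idx_less a a" for a :: "'m + 'n"
    by (cases a) auto
  have rk_less: "rk b < rk a" if "idx_less a b" for a b
    unfolding rk_def
  proof (rule psubset_card_mono)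
    show "{c. idx_less b c} \<subset> {c. idx_less a c}"
      using that irrefl[of b] trans by blast
  qed simp
  have ht_add: "ht (x + y) = ht x + ht y" for x y
    by (simp add: ht_def algebra_simps sum.distrib)
  have ht_axis: "ht (axis a 1 - axis b 1) = of_nat (rk a) - of_nat (rk b)" for a b
  proof -
    have "(\<Sum>c\<in>UNIV. of_nat (rk c) * axis d (1::'k) $ c) = of_nat (rk d)" for d
      by (simp add: axis_def if_distrib[where f = "(*) _"] cong: if_cong)
    then show ?thesis
      by (simp add: ht_def right_diff_distrib sum_subtractf)
  qed
  have ht_pos: "\<exists>k\<ge>1. ht \<alpha> = of_nat k" if \<alpha>: "\<alpha> \<in> pos_roots" for \<alpha>
  proof -
    obtain a b :: "'m + 'n" where ab: "idx_less a b" "\<alpha> = axis a 1 - axis b 1"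
      using \<alpha> that unfolding pos_roots_def even_pos_roots_def odd_pos_roots_def eps_def del_def
      by force
    have "ht \<alpha> = of_nat (rk a - rk b)"
      using rk_less[OF ab(1)] by (simp add: ab(2) ht_axis of_nat_diff)
    then show ?thesis
      using rk_less[OF ab(1)] by (intro exI[of _ "rk a - rk b"]) auto
  qed
  have size: "set_mset \<pi> \<subseteq> pos_roots \<Longrightarrow> \<exists>k\<ge>size \<pi>. ht (\<Sum>\<^sub># \<pi>) = of_nat k" for \<pi>
  proof (induction \<pi>)
    case empty
    have "ht 0 = of_nat 0" by (simp add: ht_def)
    then show ?case by (metis le_refl size_empty sum_mset.empty)
  next
    case (add \<alpha> \<pi>)
    then obtain k l where "k \<ge> size \<pi>" "ht (\<Sum>\<^sub># \<pi>) = of_nat k" "l \<ge> 1" "ht \<alpha> = of_nat l"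
      using ht_pos[of \<alpha>] by auto
    then show ?case
      by (intro exI[of _ "l + k"]) (auto simp: ht_add)
  qed
  show ?thesis
  proof (cases "root_partitions \<gamma> = {}")
    case False
    then obtain K where K: "ht \<gamma> = of_nat K"
      using size by (auto simp: root_partitions_def)
    have "root_partitions \<gamma> \<subseteq> (\<Union>n\<le>K. multisets_of_size pos_roots n)"
    proof
      fix \<pi> assume "\<pi> \<in> root_partitions \<gamma>"
      then have \<pi>: "set_mset \<pi> \<subseteq> pos_roots" "\<Sum>\<^sub># \<pi> = \<gamma>"
        by (auto simp: root_partitions_def)
      then have "size \<pi> \<le> K"
        using size[OF \<pi>(1)] K by auto
      with \<pi> show "\<pi> \<in> (\<Union>n\<le>K. multisets_of_size pos_roots n)"
        by (auto simp: multisets_of_size_def)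
    qed
    then show ?thesis
      by (rule finite_subset) (simp add: finite_multisets_of_size finite_pos_roots)
  qed simp
qed


section \<open>Verma modules\<close>

definition verma_ideal ::
  "('k::field, 'm::{finite,linorder}, 'n::{finite,linorder}) wt \<Rightarrow> ('k, 'm, 'n) Ugl set" where
  "verma_ideal \<mu> =
     left_ideal (ug_incl ` n_plus \<union> {ug_incl h - ug_scalar (wt_eval \<mu> h) | h. h \<in> cartan})"

text \<open>The Verma module with highest weight \<open>\<mu>\<close> (no shift by rho) is the quotient of U(gl(m,n)) by
  the left ideal \<open>verma_ideal \<mu>\<close>. Its elements are the cosets, and the sum of two
  elements is the elementwise sum of sets.\<close>

definition verma ::
  "('k::field, 'm::{finite,linorder}, 'n::{finite,linorder}) wt \<Rightarrow> ('k, 'm, 'n) Ugl set set" where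
  "verma \<mu> = range (\<lambda>u. u +o verma_ideal \<mu>)"

definition verma_vec ::
  "('k::field, 'm::{finite,linorder}, 'n::{finite,linorder}) wt \<Rightarrow> ('k, 'm, 'n) Ugl set" where
  "verma_vec \<mu> = 1 +o verma_ideal \<mu>"

definition verma_act ::
  "('k::field, 'm::{finite,linorder}, 'n::{finite,linorder}) wt \<Rightarrow> ('k, 'm, 'n) Ugl \<Rightarrow>
     ('k, 'm, 'n) Ugl set \<Rightarrow> ('k, 'm, 'n) Ugl set" where
  "verma_act \<mu> u X = (u *o X) + verma_ideal \<mu>"

text \<open>The submodule generated by a set X of vectors of the Verma module, i.e. the sum of the
  submodules U(gl(m,n)) x with x in X. The coset \<open>verma_ideal \<mu>\<close> is the zero vector.\<close>

inductive_set verma_submodule ::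
  "('k::field, 'm::{finite,linorder}, 'n::{finite,linorder}) wt \<Rightarrow> ('k, 'm, 'n) Ugl set set \<Rightarrow>
     ('k, 'm, 'n) Ugl set set" for \<mu> X where
  zero: "verma_ideal \<mu> \<in> verma_submodule \<mu> X"
| step: "x \<in> X \<Longrightarrow> y \<in> verma_submodule \<mu> X \<Longrightarrow> verma_act \<mu> u x + y \<in> verma_submodule \<mu> X"

lemma left_ideal_add: "x \<in> left_ideal S \<Longrightarrow> y \<in> left_ideal S \<Longrightarrow> x + y \<in> left_ideal S"
  by (induction rule: left_ideal.induct) (auto simp: add.assoc intro: left_ideal.intros)

lemma left_ideal_mult: "x \<in> left_ideal S \<Longrightarrow> a * x \<in> left_ideal S"
  by (induction rule: left_ideal.induct)
    (auto simp: distrib_left mult.assoc[symmetric] intro: left_ideal.intros)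

lemma left_ideal_plus_self: "left_ideal S + left_ideal S = left_ideal S"
proof
  show "left_ideal S \<subseteq> left_ideal S + left_ideal S"
    using left_ideal.zero set_zero_plus2 by blast
qed (auto simp: set_plus_def intro: left_ideal_add)

lemma verma_plus_coset:
  "(u +o verma_ideal \<mu>) + (v +o verma_ideal \<mu>) = (u + v) +o verma_ideal \<mu>"
  by (simp add: set_plus_rearrange verma_ideal_def left_ideal_plus_self)

lemma verma_act_coset: "verma_act \<mu> u (v +o verma_ideal \<mu>) = (u * v) +o verma_ideal \<mu>"
proof -
  have *: "(u *o verma_ideal \<mu>) + verma_ideal \<mu> = verma_ideal \<mu>"
  proof
    show "(u *o verma_ideal \<mu>) + verma_ideal \<mu> \<subseteq> verma_ideal \<mu>"
      by (auto simp: set_plus_def elt_set_times_def verma_ideal_def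
          intro: left_ideal_add left_ideal_mult)
    have "u * 0 + x \<in> (u *o verma_ideal \<mu>) + verma_ideal \<mu>" if "x \<in> verma_ideal \<mu>" for x
      using that by (intro set_plus_intro)
        (auto simp: elt_set_times_def verma_ideal_def intro!: bexI[of _ 0] left_ideal.zero)
    then show "verma_ideal \<mu> \<subseteq> (u *o verma_ideal \<mu>) + verma_ideal \<mu>"
      by auto
  qed
  show ?thesis
    by (simp add: verma_act_def set_times_plus_distrib set_plus_rearrange3 *)
qed


section \<open>Independence and minimality\<close>

definition B_set ::
  "('k::field, 'm::{finite,linorder}, 'n::{finite,linorder}) wt \<Rightarrow> ('k, 'm, 'n) wt set" where
  "B_set \<mu> = {\<gamma> \<in> odd_pos_roots. wt_form (\<mu> + rho) \<gamma> = 0}"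

definition root_le ::
  "('k::field, 'm::{finite,linorder}, 'n::{finite,linorder}) wt \<Rightarrow> ('k, 'm, 'n) wt \<Rightarrow> bool" where
  "root_le \<gamma>' \<gamma> \<longleftrightarrow> (\<exists>\<pi>. set_mset \<pi> \<subseteq> even_pos_roots \<and> \<gamma> - \<gamma>' = \<Sum>\<^sub># \<pi>)"

definition root_down ::
  "('k::field, 'm::{finite,linorder}, 'n::{finite,linorder}) wt \<Rightarrow> ('k, 'm, 'n) wt \<Rightarrow> bool" where
  "root_down \<gamma>' \<gamma> \<longleftrightarrow> root_le \<gamma>' \<gamma> \<and> wt_form \<gamma> \<gamma>' \<noteq> 0"

definition weight_minimal ::
  "('k::field, 'm::{finite,linorder}, 'n::{finite,linorder}) wt \<Rightarrow> ('k, 'm, 'n) wt \<Rightarrow> bool" where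
  "weight_minimal \<mu> \<gamma> \<longleftrightarrow> \<gamma> \<in> B_set \<mu> \<and> (\<forall>\<gamma>'\<in>B_set \<mu>. root_down \<gamma>' \<gamma> \<longrightarrow> \<gamma>' = \<gamma>)"

text \<open>Here \<open>\<theta>\<close> is a choice of a Shapovalov element for every positive odd root.\<close>

definition independent_at ::
  "(('k::field, 'm::{finite,linorder}, 'n::{finite,linorder}) wt \<Rightarrow> ('k, 'm, 'n) Ugl) \<Rightarrow>
     ('k, 'm, 'n) wt \<Rightarrow> ('k, 'm, 'n) wt \<Rightarrow> bool" where
  "independent_at \<theta> \<mu> \<gamma> \<longleftrightarrow> \<gamma> \<in> B_set \<mu> \<and>
     verma_act \<mu> (\<theta> \<gamma>) (verma_vec \<mu>) \<notin>
       verma_submodule \<mu> ((\<lambda>\<gamma>'. verma_act \<mu> (\<theta> \<gamma>') (verma_vec \<mu>)) ` (B_set \<mu> - {\<gamma>}))"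

end

theory Submission
  imports Defs "HOL-Library.Function_Algebras"
begin

text \<open>Index rows and columns by 0, ..., N - 1, the first M being even; E i j are the matrix units, v is
  the highest weight vector. The PBW theorem is replaced by a concrete module with a highest weight
  vector of weight lam: distributions on N x N supermatrices supported on the upper triangular
  ones and transforming by a character of the upper triangular group. There, if the f i do not involve
  column a, then the sum of the E i a (f i) over i > a vanishes only if all f i do.

  Moving the lowering operators with source a to the left, every u in U(n-) of weight -(a - b) becomes
  the sum of the E i a (u i) with u i of weight -(i - b). By freeness, if E r (r+1) kills u v for a < r < b,
  then u (r+1) v = - E r (r+1) (u r) v, and E r (r+1) kills the other u i v; by induction u is determined
  by the coefficient of the product of the simple root vectors.

  If \<open>\<gamma>\<close> is not minimal because of \<open>\<gamma>'\<close>, then \<open>\<beta> = \<gamma> - \<gamma>'\<close> is an even root whose coroot pairs to 1 with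
  \<open>lam + rho - \<gamma>'\<close>, and an even lowering operator applied to \<open>\<theta> \<gamma>'\<close> v is a singular vector of weight
  \<open>lam - \<gamma>\<close> with leading coefficient 1, hence equals \<open>\<theta> \<gamma>\<close> v. If \<open>\<gamma> = a - b\<close> is minimal, the component of
  \<open>\<theta> \<gamma>\<close> v at the first odd index M is a product of nonzero differences of coordinates of lam + rho times
  a nonzero vector, while for the other \<open>\<gamma>'\<close> in B the part of weight \<open>lam - \<gamma>\<close> of the submodule generated
  by \<open>\<theta> \<gamma>'\<close> v has components at even indices only.\<close>

section \<open>Functions with scalar multiplication\<close>

text \<open>No isomorphism between the concrete module and the Verma module is needed. Independence
  is a negative statement, so it suffices that the ideal defining the Verma module annihilates the
  vacuum: a relation in the Verma module would persist among the distributions. Dependence is a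
  positive statement; an equality of distributions is proved first and then lifted to an equality in
  the enveloping algebra. The lifting uses faithfulness on the vacuum only in the weights -(a - b).
  In such a weight every nontrivial word has exactly one letter with source a, so freeness over the
  lowering operators of one column, applied repeatedly, replaces an ordered basis of U(n-).
  Distributions are chosen because derivatives act freely on a delta distribution: the lowering
  operator with indices i > a contains the derivative in the variable (i, a) below the diagonal,
  multiplied by the injective variable (i, i). The powers of the diagonal variables supply an
  arbitrary highest weight.\<close>

definition vscale :: "'k::comm_ring_1 \<Rightarrow> ('s \<Rightarrow> 'k) \<Rightarrow> 's \<Rightarrow> 'k" (infixr "\<star>" 75) where
  "c \<star> f = (\<lambda>s. c * f s)"

lemma vscale_apply [simp]: "(c \<star> f) s = c * f s"
  by (simp add: vscale_def)

lemma vscale_add: "c \<star> (f + g) = c \<star> f + c \<star> g"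
  by (simp add: fun_eq_iff algebra_simps)

lemma vscale_diff: "c \<star> (f - g) = c \<star> f - c \<star> g"
  by (simp add: fun_eq_iff algebra_simps)

lemma add_vscale: "(c + d) \<star> f = c \<star> f + d \<star> f"
  by (simp add: fun_eq_iff algebra_simps)

lemma vscale_vscale [simp]: "c \<star> (d \<star> f) = (c * d) \<star> f"
  by (simp add: fun_eq_iff algebra_simps)

lemma vscale_one [simp]: "1 \<star> f = f"
  by (simp add: fun_eq_iff)

lemma vscale_zero [simp]: "c \<star> 0 = 0" "0 \<star> f = 0"
  by (simp_all add: fun_eq_iff)

lemma vscale_minus_one [simp]: "(- 1) \<star> f = - f"
  by (simp add: fun_eq_iff)

lemma vscale_diff_left: "c \<star> f - d \<star> f = (c - d) \<star> f"
  by (simp add: fun_eq_iff algebra_simps)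

lemma vscale_uminus_left: "(- c) \<star> f = - (c \<star> f)"
  by (simp add: fun_eq_iff)

lemma sum_fun_apply: "(\<Sum>i\<in>A. f i) x = (\<Sum>i\<in>A. f i x)"
  by (induction A rule: infinite_finite_induct) simp_all

lemma vscale_sum: "c \<star> (\<Sum>i\<in>A. f i) = (\<Sum>i\<in>A. c \<star> f i)"
  by (simp add: fun_eq_iff sum_fun_apply sum_distrib_left)

lemma sum_vscale: "(\<Sum>i\<in>A. c i) \<star> f = (\<Sum>i\<in>A. c i \<star> f)"
  by (simp add: fun_eq_iff sum_fun_apply sum_distrib_right)

lemma vscale_if: "c \<star> (if P then f else g) = (if P then c \<star> f else c \<star> g)"
  by simp

lemma vscale_eq_0_iff: "c \<star> f = 0 \<longleftrightarrow> c = 0 \<or> f = 0" for c :: "'k::field"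
  by (auto simp: fun_eq_iff)

definition lin :: "(('s \<Rightarrow> 'k::comm_ring_1) \<Rightarrow> ('r \<Rightarrow> 'k)) \<Rightarrow> bool" where
  "lin T \<longleftrightarrow> (\<forall>f g. T (f + g) = T f + T g) \<and> (\<forall>c f. T (c \<star> f) = c \<star> T f)"

lemma lin_add: "lin T \<Longrightarrow> T (f + g) = T f + T g"
  and lin_vscale: "lin T \<Longrightarrow> T (c \<star> f) = c \<star> T f"
  by (auto simp: lin_def)

lemma lin_0: "lin T \<Longrightarrow> T 0 = 0"
  using lin_vscale[of T 0 0] by simp

lemma lin_uminus: "lin T \<Longrightarrow> T (- f) = - T f"
  using lin_vscale[of T "-1" f] by simp

lemma lin_diff: "lin T \<Longrightarrow> T (f - g) = T f - T g"
  using lin_add[of T f "- g"] lin_uminus[of T g] by simp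

lemma lin_sum: "lin T \<Longrightarrow> T (\<Sum>i\<in>A. f i) = (\<Sum>i\<in>A. T (f i))"
  by (induction A rule: infinite_finite_induct) (simp_all add: lin_0[of T] lin_add[of T])

lemma lin_comp: "lin S \<Longrightarrow> lin T \<Longrightarrow> lin (\<lambda>f. S (T f))"
  by (simp add: lin_def)

lemma lin_sumI: "(\<And>i. i \<in> A \<Longrightarrow> lin (T i)) \<Longrightarrow> lin (\<lambda>f. \<Sum>i\<in>A. T i f)"
  by (simp add: lin_def sum.distrib vscale_sum)

lemma lin_vscaleI: "lin T \<Longrightarrow> lin (\<lambda>f. c \<star> T f)"
  by (simp add: lin_def vscale_add mult.commute)

section \<open>Supermatrix variables\<close>

type_synonym state = "nat \<times> nat \<Rightarrow> int"

text \<open>A state gives the exponents of the variables \<open>(k, j)\<close>. A variable below the diagonal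
  carries derivatives of the delta distribution, so there differentiation creates and multiplication
  annihilates. The exponents of the diagonal variables are shifted by \<open>t\<close>. For odd variables only the
  parity of the exponent matters; their operators anticommute by the Jordan-Wigner sign
  \<open>jw_sign\<close>.\<close>

locale fock =
  fixes m N :: nat and t :: "nat \<Rightarrow> 'k::field_char_0"
begin

definition fer :: "nat \<times> nat \<Rightarrow> bool" where
  "fer q \<longleftrightarrow> (fst q < m) \<noteq> (snd q < m)"

definition eps2 :: "nat \<times> nat \<Rightarrow> nat \<times> nat \<Rightarrow> 'k" where
  "eps2 q r = (if fer q \<and> fer r then - 1 else 1)"

definition lower :: "nat \<times> nat \<Rightarrow> bool" where
  "lower q \<longleftrightarrow> snd q < fst q"

definition before :: "nat \<times> nat \<Rightarrow> (nat \<times> nat) set" where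
  "before q = {r \<in> {..<N} \<times> {..<N}. fer r \<and> prod_encode r < prod_encode q}"

definition jw_sign :: "nat \<times> nat \<Rightarrow> state \<Rightarrow> 'k" where
  "jw_sign q s = (if fer q \<and> odd (\<Sum>r\<in>before q. s r) then - 1 else 1)"

text \<open>An operator on coefficient functions that reads the argument at exponent
  \<open>s q + d\<close> moves basis vectors by \<open>- d\<close>. Hence \<kappa> is evaluated at
  the exponent that is reached.\<close>

definition shift :: "nat \<times> nat \<Rightarrow> int \<Rightarrow> (int \<Rightarrow> 'k) \<Rightarrow> (state \<Rightarrow> 'k) \<Rightarrow> state \<Rightarrow> 'k" where
  "shift q d \<kappa> f = (\<lambda>s. \<kappa> (s q) * jw_sign q s * f (s(q := s q + d)))"

definition dir :: "nat \<times> nat \<Rightarrow> int" where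
  "dir q = (if lower q then 1 else - 1)"

text \<open>Below the diagonal this is the rule that x times the e-th derivative of delta is - e
  times the (e-1)-st derivative, with e = \<open>x + 1\<close> because \<open>x\<close> is the
  exponent reached.\<close>

definition coefX :: "nat \<times> nat \<Rightarrow> int \<Rightarrow> 'k" where
  "coefX q x =
     (if fer q then of_bool (lower q \<longleftrightarrow> even x) else if lower q then - of_int (x + 1) else 1)"

definition coefD :: "nat \<times> nat \<Rightarrow> int \<Rightarrow> 'k" where
  "coefD q x =
     (if fer q then of_bool (lower q \<longleftrightarrow> odd x) else if lower q then 1
      else of_int (x + 1) + (if fst q = snd q then t (fst q) else 0))"

text \<open>\<open>X q\<close> is multiplication by the variable \<open>q\<close> and \<open>D q\<close> differentiation with respect to it.\<close>

definition X :: "nat \<times> nat \<Rightarrow> (state \<Rightarrow> 'k) \<Rightarrow> state \<Rightarrow> 'k" where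
  "X q = shift q (dir q) (coefX q)"

definition D :: "nat \<times> nat \<Rightarrow> (state \<Rightarrow> 'k) \<Rightarrow> state \<Rightarrow> 'k" where
  "D q = shift q (- dir q) (coefD q)"

text \<open>The polarization operator: infinitesimal right translation of supermatrices by the
  matrix unit (i, j). It touches the columns i and j only.\<close>

definition Eop :: "nat \<Rightarrow> nat \<Rightarrow> (state \<Rightarrow> 'k) \<Rightarrow> state \<Rightarrow> 'k" where
  "Eop i j f = (\<Sum>k<N. X (k, i) (D (k, j) f))"

section \<open>Commutation relations between variables and derivatives\<close>

lemma finite_before: "finite (before q)"
  by (simp add: before_def)

lemma not_before_self: "q \<notin> before q"
  by (simp add: before_def)

lemma jw_sign_upd_self: "jw_sign q (s(q := x)) = jw_sign q s"
proof -
  have "(\<Sum>r\<in>before q. (s(q := x)) r) = (\<Sum>r\<in>before q. s r)"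
    by (rule sum.cong) (auto simp: not_before_self)
  then show ?thesis by (simp add: jw_sign_def)
qed

lemma jw_sign_upd:
  assumes "odd d"
  shows "jw_sign r (s(q := s q + d)) = (if q \<in> before r \<and> fer r then - jw_sign r s else jw_sign r s)"
proof (cases "q \<in> before r")
  case True
  have "(\<Sum>u\<in>before r. (s(q := s q + d)) u) = (s q + d) + (\<Sum>u\<in>before r - {q}. (s(q := s q + d)) u)"
    using sum.remove[OF finite_before True, of "s(q := s q + d)"] by simp
  also have "(\<Sum>u\<in>before r - {q}. (s(q := s q + d)) u) = (\<Sum>u\<in>before r - {q}. s u)"
    by (rule sum.cong) auto
  also have "(s q + d) + \<dots> = (\<Sum>u\<in>before r. s u) + d"
    using sum.remove[OF finite_before True, of s] by simp
  finally show ?thesis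
    using assms True by (auto simp: jw_sign_def)
next
  case False
  then have "(\<Sum>u\<in>before r. (s(q := s q + d)) u) = (\<Sum>u\<in>before r. s u)"
    by (intro sum.cong) auto
  with False show ?thesis by (simp add: jw_sign_def)
qed

lemma before_total:
  assumes "q \<in> {..<N} \<times> {..<N}" "r \<in> {..<N} \<times> {..<N}" "fer q" "fer r" "q \<noteq> r"
  shows "q \<in> before r \<longleftrightarrow> r \<notin> before q"
proof -
  have "prod_encode q \<noteq> prod_encode r"
    using assms(5) by simp
  then have "prod_encode q < prod_encode r \<longleftrightarrow> \<not> prod_encode r < prod_encode q"
    by linarith
  then show ?thesis
    using assms(1-4) by (simp add: before_def)
qed

lemma before_fer: "q \<in> before r \<Longrightarrow> fer q"
  by (simp add: before_def)

text \<open>If q and r are both odd, exactly one of them precedes the other, and an odd change of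
  the exponent of the earlier one flips the sign of the later one. Otherwise neither sign
  changes.\<close>

lemma shift_commute:
  assumes "q \<in> {..<N} \<times> {..<N}" "r \<in> {..<N} \<times> {..<N}" "q \<noteq> r" "odd d" "odd e"
  shows "shift q d \<kappa> (shift r e \<kappa>' f) = eps2 q r \<star> shift r e \<kappa>' (shift q d \<kappa> f)"
proof
  fix s
  have upd: "s(q := s q + d, r := s r + e) = s(r := s r + e, q := s q + d)"
    using assms(3) by (auto simp: fun_eq_iff)
  have "jw_sign q s * jw_sign r (s(q := s q + d)) =
      eps2 q r * (jw_sign r s * jw_sign q (s(r := s r + e)))"
    using before_total[OF assms(1,2) _ _ assms(3)]
    by (auto simp: jw_sign_upd assms(4,5) eps2_def dest: before_fer)
  then have "\<kappa> (s q) * \<kappa>' (s r) * f (s(q := s q + d, r := s r + e)) *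
       (jw_sign q s * jw_sign r (s(q := s q + d))) =
     \<kappa> (s q) * \<kappa>' (s r) * f (s(q := s q + d, r := s r + e)) *
       (eps2 q r * (jw_sign r s * jw_sign q (s(r := s r + e))))"
    by simp
  then show "shift q d \<kappa> (shift r e \<kappa>' f) s = (eps2 q r \<star> shift r e \<kappa>' (shift q d \<kappa> f)) s"
    using assms(3) by (simp add: shift_def upd fun_upd_other mult_ac)
qed

lemma odd_dir: "odd (dir q)"
  by (simp add: dir_def)

lemma jw_sign_sq: "jw_sign q s * jw_sign q s = 1"
  by (simp add: jw_sign_def)

lemma shift_shift_self:
  "shift q d \<kappa> (shift q e \<kappa>' f) s = \<kappa> (s q) * \<kappa>' (s q + d) * f (s(q := s q + d + e))"
proof -
  have "shift q d \<kappa> (shift q e \<kappa>' f) s =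
     (jw_sign q s * jw_sign q s) * (\<kappa> (s q) * \<kappa>' (s q + d) * f (s(q := s q + d + e)))"
    by (simp add: shift_def jw_sign_upd_self mult_ac)
  then show ?thesis by (simp add: jw_sign_sq)
qed

context
  fixes q r
  assumes q: "q \<in> {..<N} \<times> {..<N}" and r: "r \<in> {..<N} \<times> {..<N}"
begin

lemma XX_commute: "X q (X r f) = eps2 q r \<star> X r (X q f)"
proof (cases "q = r")
  case True
  have "X q (X q f) = 0" if "fer q"
  proof
    fix s show "X q (X q f) s = 0 s"
      using that by (auto simp: X_def shift_shift_self coefX_def odd_dir)
  qed
  with True show ?thesis by (auto simp: eps2_def)
next
  case False
  then show ?thesis
    unfolding X_def using q r by (intro shift_commute) (auto simp: odd_dir)
qed

lemma DD_commute: "D q (D r f) = eps2 q r \<star> D r (D q f)"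
proof (cases "q = r")
  case True
  have "D q (D q f) = 0" if "fer q"
  proof
    fix s show "D q (D q f) s = 0 s"
      using that by (auto simp: D_def shift_shift_self coefD_def odd_dir)
  qed
  with True show ?thesis by (auto simp: eps2_def)
next
  case False
  then show ?thesis
    unfolding D_def using q r by (intro shift_commute) (auto simp: odd_dir)
qed

lemma DX_commute: "D q (X r f) = eps2 q r \<star> X r (D q f) + (if q = r then f else 0)"
proof (cases "q = r")
  case True
  have "D q (X q f) s = (eps2 q q \<star> X q (D q f) + f) s" for s
  proof -
    \<comment> \<open>One scalar identity gives both the Weyl relation for even and the Clifford
      relation for odd variables.\<close>
    have "coefD q (s q) * coefX q (s q - dir q) =
        eps2 q q * (coefX q (s q) * coefD q (s q + dir q)) + 1"
      by (auto simp: coefD_def coefX_def eps2_def dir_def)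
    then have "(coefD q (s q) * coefX q (s q - dir q)) * f s =
        (eps2 q q * (coefX q (s q) * coefD q (s q + dir q)) + 1) * f s"
      by simp
    then show ?thesis
      by (simp add: D_def X_def shift_shift_self algebra_simps)
  qed
  with True show ?thesis by (simp add: fun_eq_iff)
next
  case False
  then show ?thesis
    unfolding D_def X_def using q r shift_commute[of q r "- dir q" "dir r"] by (simp add: odd_dir)
qed

end

lemma lin_shift: "lin (shift q d \<kappa>)"
  by (simp add: lin_def shift_def fun_eq_iff algebra_simps)

lemma lin_X: "lin (X q)" and lin_D: "lin (D q)"
  by (simp_all add: X_def D_def lin_shift)

lemma lin_Eop: "lin (Eop i j)"
  unfolding Eop_def by (intro lin_sumI lin_comp[OF lin_X] lin_D)

lemma eps2_sym: "eps2 q r = eps2 r q"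
  by (simp add: eps2_def)

lemma eps2_sq [simp]: "eps2 q r * eps2 q r = 1"
  by (simp add: eps2_def)

section \<open>The relations of gl(m,n) for the polarization operators\<close>

lemma XDXD_commute:
  assumes "a < N" "b < N" "i < N" "j < N" "k < N" "l < N"
  shows "X (a, i) (D (a, j) (X (b, k) (D (b, l) f))) =
    eps2 (i, j) (k, l) \<star> X (b, k) (D (b, l) (X (a, i) (D (a, j) f)))
    + (if a = b \<and> j = k then X (a, i) (D (b, l) f) else 0)
    - (if a = b \<and> i = l then eps2 (i, j) (k, l) \<star> X (b, k) (D (a, j) f) else 0)"
proof -
  let ?e1 = "eps2 (a, j) (b, k)" and ?e2 = "eps2 (a, i) (b, k)"
  let ?e3 = "eps2 (a, j) (b, l)" and ?e4 = "eps2 (a, i) (b, l)"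
  \<comment> \<open>In the product of the four signs the parities of the rows a and b cancel, so the
    sign does not depend on the summand.\<close>
  have signs: "?e1 * ?e2 * ?e3 * ?e4 = eps2 (i, j) (k, l)"
    by (simp add: eps2_def fer_def)
  have XD: "X (a, i) (D (b, l) g) =
      ?e4 \<star> (D (b, l) (X (a, i) g) - (if a = b \<and> i = l then g else 0))" for g
    using DX_commute[of "(b, l)" "(a, i)" g] assms
    by (simp add: eps2_sym[of "(b, l)"] eq_commute)
  have "X (a, i) (D (a, j) (X (b, k) (D (b, l) f))) =
     X (a, i) (?e1 \<star> X (b, k) (D (a, j) (D (b, l) f)))
      + (if a = b \<and> j = k then X (a, i) (D (b, l) f) else 0)"
    using assms by (simp add: DX_commute lin_add[OF lin_X] lin_0[OF lin_X])
  also have "X (a, i) (?e1 \<star> X (b, k) (D (a, j) (D (b, l) f))) =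
     (?e1 * ?e2 * ?e3) \<star> X (b, k) (X (a, i) (D (b, l) (D (a, j) f)))"
    using assms
    by (simp add: lin_vscale[OF lin_X] XX_commute[of "(a, i)" "(b, k)"] DD_commute[of "(a, j)" "(b, l)"]
        mult_ac)
  also have "X (a, i) (D (b, l) (D (a, j) f)) =
      ?e4 \<star> (D (b, l) (X (a, i) (D (a, j) f)) - (if a = b \<and> i = l then D (a, j) f else 0))"
    by (rule XD)
  also have "(?e1 * ?e2 * ?e3) \<star> X (b, k) \<dots> =
     (?e1 * ?e2 * ?e3 * ?e4) \<star> X (b, k) (D (b, l) (X (a, i) (D (a, j) f)))
      - (if a = b \<and> i = l then (?e1 * ?e2 * ?e3 * ?e4) \<star> X (b, k) (D (a, j) f) else 0)"
    by (simp add: lin_vscale[OF lin_X] lin_diff[OF lin_X] lin_0[OF lin_X] vscale_diff)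
  finally show ?thesis
    by (simp only: signs diff_add_eq)
qed

lemma Eop_commute:
  assumes "i < N" "j < N" "k < N" "l < N"
  shows "Eop i j (Eop k l f) = eps2 (i, j) (k, l) \<star> Eop k l (Eop i j f)
     + (if j = k then Eop i l f else 0) - (if i = l then eps2 (i, j) (k, l) \<star> Eop k j f else 0)"
proof -
  let ?e = "eps2 (i, j) (k, l)"
  have "Eop i j (Eop k l f) = (\<Sum>a<N. \<Sum>b<N. X (a, i) (D (a, j) (X (b, k) (D (b, l) f))))"
    by (simp add: Eop_def lin_sum[OF lin_X] lin_sum[OF lin_D])
  also have "\<dots> = (\<Sum>a<N. \<Sum>b<N. ?e \<star> X (b, k) (D (b, l) (X (a, i) (D (a, j) f)))
    + (if a = b \<and> j = k then X (a, i) (D (b, l) f) else 0)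
    - (if a = b \<and> i = l then ?e \<star> X (b, k) (D (a, j) f) else 0))"
    using assms by (intro sum.cong refl XDXD_commute) auto
  also have "\<dots> = (\<Sum>a<N. \<Sum>b<N. ?e \<star> X (b, k) (D (b, l) (X (a, i) (D (a, j) f))))
    + (\<Sum>a<N. \<Sum>b<N. if a = b \<and> j = k then X (a, i) (D (b, l) f) else 0)
    - (\<Sum>a<N. \<Sum>b<N. if a = b \<and> i = l then ?e \<star> X (b, k) (D (a, j) f) else 0)"
    by (simp add: sum.distrib sum_subtractf)
  also have "(\<Sum>a<N. \<Sum>b<N. ?e \<star> X (b, k) (D (b, l) (X (a, i) (D (a, j) f)))) = ?e \<star> Eop k l (Eop i j f)"
    unfolding Eop_def lin_sum[OF lin_X] lin_sum[OF lin_D] vscale_sum by (rule sum.swap)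
  also have "(\<Sum>a<N. \<Sum>b<N. if a = b \<and> j = k then X (a, i) (D (b, l) f) else 0) =
     (if j = k then Eop i l f else 0)"
    by (simp add: Eop_def)
  also have "(\<Sum>a<N. \<Sum>b<N. if a = b \<and> i = l then ?e \<star> X (b, k) (D (a, j) f) else 0) =
     (if i = l then ?e \<star> Eop k j f else 0)"
    by (simp add: Eop_def vscale_sum)
  finally show ?thesis .
qed

section \<open>The vacuum and freeness over the lowering operators of a column\<close>

text \<open>The product of the delta distributions in the variables below the diagonal and the
  powers with exponent \<open>t j\<close> of the diagonal variables.\<close>

definition vac :: "state \<Rightarrow> 'k" where
  "vac s = of_bool (s = (\<lambda>_. 0))"

text \<open>Each even variable below the diagonal in column j contributes -1, as x times the
  derivative of delta is - delta; an odd one contributes 1.\<close>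

definition vac_wt :: "nat \<Rightarrow> 'k" where
  "vac_wt j = t j + (\<Sum>k\<in>{j<..<N}. if fer (k, j) then 1 else - 1)"

definition low_deg :: "state \<Rightarrow> int" where
  "low_deg s = (\<Sum>q\<in>{q \<in> {..<N} \<times> {..<N}. lower q}. s q)"

text \<open>States range over all integer exponents and functions may have infinite support; the
  bound provides the top degree from which the freeness argument descends.\<close>

definition bounded :: "(state \<Rightarrow> 'k) \<Rightarrow> bool" where
  "bounded f \<longleftrightarrow> (\<exists>K. \<forall>s. f s \<noteq> 0 \<longrightarrow> low_deg s \<le> K)"

definition col_vac :: "nat \<Rightarrow> (state \<Rightarrow> 'k) \<Rightarrow> bool" where
  "col_vac a f \<longleftrightarrow> (\<forall>s. f s \<noteq> 0 \<longrightarrow> (\<forall>k<N. s (k, a) = 0))"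

text \<open>The degree in the variables of column j, a derivative of delta counting -1. It is the
  weight relative to the vacuum as an integer, and being visible in the support it makes the
  projection \<open>deg_part\<close> to a weight space immediate.\<close>

definition col_deg :: "nat \<Rightarrow> state \<Rightarrow> int" where
  "col_deg j s = (\<Sum>k<N. - dir (k, j) * s (k, j))"

definition in_deg :: "(nat \<Rightarrow> int) \<Rightarrow> (state \<Rightarrow> 'k) \<Rightarrow> bool" where
  "in_deg \<delta> f \<longleftrightarrow> (\<forall>s. f s \<noteq> 0 \<longrightarrow> (\<forall>j<N. col_deg j s = \<delta> j))"

definition deg_part :: "(nat \<Rightarrow> int) \<Rightarrow> (state \<Rightarrow> 'k) \<Rightarrow> state \<Rightarrow> 'k" where
  "deg_part \<delta> f = (\<lambda>s. if \<forall>j<N. col_deg j s = \<delta> j then f s else 0)"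

section \<open>Supports and degrees under the operators\<close>

lemma shift_neq_0D: "shift q d \<kappa> f s \<noteq> 0 \<Longrightarrow> f (s(q := s q + d)) \<noteq> 0"
  by (auto simp: shift_def)

lemma jw_sign_neq_0 [simp]: "jw_sign q s \<noteq> 0"
  by (simp add: jw_sign_def)

lemma low_deg_upd:
  assumes "q \<in> {..<N} \<times> {..<N}"
  shows "low_deg (s(q := s q + d)) = low_deg s + (if lower q then d else 0)"
proof (cases "lower q")
  case True
  let ?A = "{q \<in> {..<N} \<times> {..<N}. lower q}"
  have A: "finite ?A" "q \<in> ?A" using assms True by auto
  have "low_deg (s(q := s q + d)) = (s q + d) + (\<Sum>u\<in>?A - {q}. (s(q := s q + d)) u)"
    using sum.remove[OF A, of "s(q := s q + d)"] by (simp add: low_deg_def)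
  also have "(\<Sum>u\<in>?A - {q}. (s(q := s q + d)) u) = (\<Sum>u\<in>?A - {q}. s u)"
    by (rule sum.cong) auto
  also have "(s q + d) + \<dots> = low_deg s + d"
    using sum.remove[OF A, of s] by (simp add: low_deg_def)
  finally show ?thesis using True by (simp only: if_True simp_thms)
next
  case False
  then have "low_deg (s(q := s q + d)) = low_deg s"
    unfolding low_deg_def by (intro sum.cong) auto
  with False show ?thesis by simp
qed

lemma col_deg_upd:
  assumes "k < N"
  shows "col_deg j (s((k, i) := s (k, i) + d)) = col_deg j s - (if i = j then dir (k, i) * d else 0)"
proof (cases "i = j")
  case True
  let ?s' = "s((k, i) := s (k, i) + d)"
  have A: "finite {..<N}" "k \<in> {..<N}" using assms by auto
  have "col_deg j ?s' = - dir (k, j) * (s (k, j) + d) + (\<Sum>l\<in>{..<N} - {k}. - dir (l, j) * ?s' (l, j))"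
    using sum.remove[OF A, of "\<lambda>l. - dir (l, j) * ?s' (l, j)"] True by (simp add: col_deg_def)
  also have "(\<Sum>l\<in>{..<N} - {k}. - dir (l, j) * ?s' (l, j)) = (\<Sum>l\<in>{..<N} - {k}. - dir (l, j) * s (l, j))"
    by (rule sum.cong) auto
  also have "- dir (k, j) * (s (k, j) + d) + \<dots> = col_deg j s - dir (k, j) * d"
    using sum.remove[OF A, of "\<lambda>l. - dir (l, j) * s (l, j)"] by (simp add: col_deg_def algebra_simps)
  finally show ?thesis using True by (simp only: if_True simp_thms)
next
  case False
  then show ?thesis by (simp add: col_deg_def)
qed

lemma bounded_0: "bounded 0" and bounded_add: "bounded f \<Longrightarrow> bounded g \<Longrightarrow> bounded (f + g)"
  and bounded_vscale: "bounded f \<Longrightarrow> bounded (c \<star> f)"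
proof -
  show "bounded 0" by (simp add: bounded_def)
  show "bounded (f + g)" if "bounded f" "bounded g"
  proof -
    obtain K L where "\<And>s. f s \<noteq> 0 \<Longrightarrow> low_deg s \<le> K" "\<And>s. g s \<noteq> 0 \<Longrightarrow> low_deg s \<le> L"
      using \<open>bounded f\<close> \<open>bounded g\<close> by (auto simp: bounded_def)
    then have "(f + g) s \<noteq> 0 \<Longrightarrow> low_deg s \<le> max K L" for s
      by (cases "f s = 0") (force simp: le_max_iff_disj)+
    then show ?thesis by (auto simp: bounded_def)
  qed
  show "bounded (c \<star> f)" if "bounded f"
    using that by (auto simp: bounded_def)
qed

lemma bounded_sum: "(\<And>i. i \<in> A \<Longrightarrow> bounded (f i)) \<Longrightarrow> bounded (\<Sum>i\<in>A. f i)"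
  by (induction A rule: infinite_finite_induct) (simp_all add: bounded_0 bounded_add)

lemma bounded_shift:
  assumes "q \<in> {..<N} \<times> {..<N}" "bounded f"
  shows "bounded (shift q d \<kappa> f)"
proof -
  obtain K where K: "\<And>s. f s \<noteq> 0 \<Longrightarrow> low_deg s \<le> K"
    using assms(2) by (auto simp: bounded_def)
  have "low_deg s \<le> K + \<bar>d\<bar>" if "shift q d \<kappa> f s \<noteq> 0" for s
    using K[OF shift_neq_0D[OF that]] low_deg_upd[OF assms(1), of s d] by (simp split: if_splits)
  then show ?thesis by (auto simp: bounded_def)
qed

lemma bounded_Eop: "i < N \<Longrightarrow> j < N \<Longrightarrow> bounded f \<Longrightarrow> bounded (Eop i j f)"
  unfolding Eop_def X_def D_def by (intro bounded_sum bounded_shift) auto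

lemma col_vac_0: "col_vac a 0" and col_vac_add: "col_vac a f \<Longrightarrow> col_vac a g \<Longrightarrow> col_vac a (f + g)"
  and col_vac_vscale: "col_vac a f \<Longrightarrow> col_vac a (c \<star> f)"
  unfolding col_vac_def by (simp, metis add.right_neutral plus_fun_apply, simp)

lemma col_vac_sum: "(\<And>i. i \<in> A \<Longrightarrow> col_vac a (f i)) \<Longrightarrow> col_vac a (\<Sum>i\<in>A. f i)"
  by (induction A rule: infinite_finite_induct) (simp_all add: col_vac_0 col_vac_add)

lemma col_vac_shift:
  assumes "snd q \<noteq> a" "col_vac a f"
  shows "col_vac a (shift q d \<kappa> f)"
  unfolding col_vac_def
proof (intro allI impI)
  fix s k assume "shift q d \<kappa> f s \<noteq> 0" "k < N"
  then have "(s(q := s q + d)) (k, a) = 0"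
    using assms(2) shift_neq_0D unfolding col_vac_def by blast
  then show "s (k, a) = 0"
    using assms(1) by (cases "q = (k, a)") auto
qed

lemma col_vac_Eop: "i \<noteq> a \<Longrightarrow> j \<noteq> a \<Longrightarrow> col_vac a f \<Longrightarrow> col_vac a (Eop i j f)"
  unfolding Eop_def X_def D_def by (intro col_vac_sum col_vac_shift) auto

lemma in_deg_sum: "(\<And>i. i \<in> A \<Longrightarrow> in_deg \<delta> (f i)) \<Longrightarrow> in_deg \<delta> (\<Sum>i\<in>A. f i)"
proof (induction A rule: infinite_finite_induct)
  case (insert x A)
  then have "in_deg \<delta> (f x)" "in_deg \<delta> (\<Sum>i\<in>A. f i)" by auto
  then have "in_deg \<delta> (f x + (\<Sum>i\<in>A. f i))"
    unfolding in_deg_def by (metis add.right_neutral plus_fun_apply)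
  with insert(1,2) show ?case by (simp only: sum.insert simp_thms)
qed (simp_all add: in_deg_def)

lemma in_deg_vscale: "in_deg \<delta> f \<Longrightarrow> in_deg \<delta> (c \<star> f)"
  by (auto simp: in_deg_def)

lemma in_deg_add: "in_deg \<delta> f \<Longrightarrow> in_deg \<delta> g \<Longrightarrow> in_deg \<delta> (f + g)"
  unfolding in_deg_def by (metis add.right_neutral plus_fun_apply)

lemma in_deg_shift:
  assumes "k < N" "in_deg \<delta> f"
  shows "in_deg (\<lambda>j. \<delta> j + (if i = j then dir (k, i) * d else 0)) (shift (k, i) d \<kappa> f)"
  unfolding in_deg_def
proof (intro allI impI)
  fix s j assume "shift (k, i) d \<kappa> f s \<noteq> 0" "j < N"
  then have "col_deg j (s((k, i) := s (k, i) + d)) = \<delta> j"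
    using assms(2) shift_neq_0D[of "(k, i)" d \<kappa> f s] unfolding in_deg_def by blast
  then show "col_deg j s = \<delta> j + (if i = j then dir (k, i) * d else 0)"
    using col_deg_upd[OF assms(1), of j s i d] by simp
qed

lemma dir_sq: "dir q * dir q = 1"
  by (simp add: dir_def)

lemma in_deg_Eop:
  assumes "in_deg \<delta> f"
  shows "in_deg (\<lambda>l. \<delta> l + (if i = l then 1 else 0) - (if j = l then 1 else 0)) (Eop i j f)"
  unfolding Eop_def
proof (intro in_deg_sum)
  fix k assume "k \<in> {..<N}"
  then have k: "k < N" by simp
  have "in_deg (\<lambda>l. \<delta> l + (if j = l then dir (k, j) * - dir (k, j) else 0)) (D (k, j) f)"
    unfolding D_def by (rule in_deg_shift[OF k assms])
  then have "in_deg (\<lambda>l. \<delta> l + (if j = l then dir (k, j) * - dir (k, j) else 0)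
     + (if i = l then dir (k, i) * dir (k, i) else 0)) (X (k, i) (D (k, j) f))"
    unfolding X_def by (rule in_deg_shift[OF k])
  moreover have "(\<lambda>l. \<delta> l + (if j = l then dir (k, j) * - dir (k, j) else 0)
     + (if i = l then dir (k, i) * dir (k, i) else 0)) = (\<lambda>l. \<delta> l + (if i = l then 1 else 0) - (if j = l then 1 else 0))"
    by (auto simp: dir_sq)
  ultimately show "in_deg (\<lambda>l. \<delta> l + (if i = l then 1 else 0) - (if j = l then 1 else 0)) (X (k, i) (D (k, j) f))"
    by simp
qed

lemma lin_deg_part: "lin (deg_part \<delta>)"
  by (auto simp: lin_def deg_part_def fun_eq_iff)

lemma deg_part_in_deg: "in_deg \<delta> f \<Longrightarrow> deg_part \<delta> f = f"
  by (auto simp: in_deg_def deg_part_def fun_eq_iff)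

lemma deg_part_in_other_deg: "in_deg \<delta>' f \<Longrightarrow> j < N \<Longrightarrow> \<delta> j \<noteq> \<delta>' j \<Longrightarrow> deg_part \<delta> f = 0"
  by (auto simp: in_deg_def deg_part_def fun_eq_iff)

section \<open>The vacuum as a highest weight vector\<close>

lemma bounded_vac: "bounded vac"
  by (auto simp: bounded_def vac_def)

lemma col_vac_vac: "col_vac a vac"
  by (auto simp: col_vac_def vac_def)

lemma in_deg_vac: "in_deg (\<lambda>_. 0) vac"
  by (auto simp: in_deg_def vac_def col_deg_def)

lemma vac_neq_0: "vac \<noteq> 0"
proof
  assume "vac = 0"
  then have "vac (\<lambda>_. 0) = 0" by simp
  then show False by (simp add: vac_def)
qed

lemma vac_neq_0D: "vac s \<noteq> 0 \<Longrightarrow> s = (\<lambda>_. 0)"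
  by (simp only: vac_def of_bool_eq_0_iff simp_thms)

lemma shift_vac: "shift q d \<kappa> vac s \<noteq> 0 \<Longrightarrow> s q = - d \<and> \<kappa> (- d) \<noteq> 0"
proof -
  assume *: "shift q d \<kappa> vac s \<noteq> 0"
  then have "(s(q := s q + d)) q = 0"
    using vac_neq_0D[OF shift_neq_0D[OF *]] by (simp only:)
  then have "s q = - d" by simp
  with * show ?thesis by (auto simp: shift_def)
qed

lemma X_vac: "lower q \<Longrightarrow> X q vac = 0"
  by (rule ext, rule ccontr) (auto simp: X_def dir_def coefX_def dest!: shift_vac split: if_splits)

lemma D_vac: "\<not> lower q \<Longrightarrow> fst q \<noteq> snd q \<Longrightarrow> D q vac = 0"
  by (rule ext, rule ccontr) (auto simp: D_def dir_def coefD_def dest!: shift_vac split: if_splits)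

lemma XD_commute_other:
  assumes "k < N" "i < N" "j < N" "i \<noteq> j"
  shows "X (k, i) (D (k, j) f) = eps2 (k, i) (k, j) \<star> D (k, j) (X (k, i) f)"
  using DX_commute[of "(k, j)" "(k, i)" f] assms by (simp add: eps2_sym[of "(k, j)"])

text \<open>In each row k, either (k, i) lies below the diagonal and the variable kills the delta
  factor, or (k, j) lies above it and the vacuum is constant in that variable.\<close>

lemma Eop_upper_vac:
  assumes "i < j" "j < N"
  shows "Eop i j vac = 0"
proof -
  have "X (k, i) (D (k, j) vac) = 0" if "k < N" for k
  proof (cases "i < k")
    case True
    then show ?thesis
      using XD_commute_other[of k i j vac] that assms X_vac[of "(k, i)"]
      by (simp add: lower_def lin_0[OF lin_D])
  next
    case False
    then show ?thesis
      using assms D_vac[of "(k, j)"] by (simp add: lower_def lin_0[OF lin_X])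
  qed
  then show ?thesis by (simp add: Eop_def)
qed

lemma Eop_diag_vac:
  assumes "j < N"
  shows "Eop j j vac = vac_wt j \<star> vac"
proof -
  define w where "w k = (if k < j then 0 else if k = j then t j else if fer (k, j) then 1 else - 1)" for k
  have "X (k, j) (D (k, j) vac) = w k \<star> vac" for k
  proof
    fix s
    show "X (k, j) (D (k, j) vac) s = (w k \<star> vac) s"
      by (auto simp: X_def D_def shift_shift_self w_def vac_def coefX_def coefD_def dir_def lower_def fer_def)
  qed
  then have "Eop j j vac = (\<Sum>k<N. w k) \<star> vac"
    by (simp add: Eop_def sum_vscale)
  also have "(\<Sum>k<N. w k) = (\<Sum>k\<in>{j} \<union> {j<..<N}. w k)"
    using assms by (intro sum.mono_neutral_right) (auto simp: w_def)
  also have "\<dots> = vac_wt j"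
    by (subst sum.union_disjoint) (auto simp: w_def vac_wt_def intro!: sum.cong)
  finally show ?thesis .
qed

text \<open>Collecting by rows, the sum becomes that of \<open>D (k, a) (G k)\<close> with
  \<open>G k\<close> free of column a. For l > a the derivative \<open>D (l, a)\<close> creates
  exponent 1 at (l, a), and no other summand reaches it; reading the coefficients there isolates
  \<open>G l\<close>.\<close>

lemma Eop_lower_free_aux:
  assumes "a < N" and vac: "\<And>i. i \<in> {a<..<N} \<Longrightarrow> col_vac a (f i)"
    and eq: "(\<Sum>i\<in>{a<..<N}. Eop i a (f i)) = 0" and l: "l \<in> {a<..<N}"
  shows "(\<Sum>i\<in>{a<..<N}. eps2 (l, i) (l, a) \<star> X (l, i) (f i)) = 0"
proof
  define G where "G k = (\<Sum>i\<in>{a<..<N}. eps2 (k, i) (k, a) \<star> X (k, i) (f i))" for k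
  have G_vac: "col_vac a (G k)" for k
    unfolding G_def X_def
    by (intro col_vac_sum col_vac_vscale col_vac_shift) (auto intro: vac)
  have "(\<Sum>k<N. D (k, a) (G k)) = (\<Sum>k<N. \<Sum>i\<in>{a<..<N}. X (k, i) (D (k, a) (f i)))"
    using assms(1)
    by (intro sum.cong refl)
      (simp add: G_def lin_sum[OF lin_D] lin_vscale[OF lin_D] XD_commute_other)
  also have "\<dots> = (\<Sum>i\<in>{a<..<N}. Eop i a (f i))"
    unfolding Eop_def by (rule sum.swap)
  finally have DG: "(\<Sum>k<N. D (k, a) (G k)) = 0"
    using eq by simp
  fix s
  have "G l s = 0"
  proof (rule ccontr)
    assume nz: "G l s \<noteq> 0"
    with G_vac have col: "\<And>k. k < N \<Longrightarrow> s (k, a) = 0"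
      by (auto simp: col_vac_def)
    let ?s = "s((l, a) := 1)"
    have "D (k, a) (G k) ?s = 0" if "k < N" "k \<noteq> l" for k
    proof (rule ccontr)
      assume "D (k, a) (G k) ?s \<noteq> 0"
      then have "G k (?s((k, a) := ?s (k, a) + - dir (k, a))) \<noteq> 0"
        unfolding D_def by (rule shift_neq_0D)
      then have "(?s((k, a) := ?s (k, a) + - dir (k, a))) (l, a) = 0"
        using G_vac[of k] l unfolding col_vac_def by (metis greaterThanLessThan_iff)
      with that show False by simp
    qed
    then have "(\<Sum>k<N. D (k, a) (G k) ?s) = (\<Sum>k\<in>{l}. D (k, a) (G k) ?s)"
      using l by (intro sum.mono_neutral_right) auto
    then have "D (l, a) (G l) ?s = 0"
      using fun_cong[OF DG, of ?s] by (simp add: sum_fun_apply)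
    moreover have "?s((l, a) := 0) = s"
      using col[of l] l by (auto simp: fun_eq_iff)
    ultimately show False
      using l nz by (simp add: D_def shift_def dir_def lower_def coefD_def split: if_splits)
  qed
  then show "(\<Sum>i\<in>{a<..<N}. eps2 (l, i) (l, a) \<star> X (l, i) (f i)) s = 0 s"
    by (simp add: G_def)
qed

text \<open>Multiplication by a variable below the diagonal lowers \<open>low_deg\<close>, so in top degree
  the system of \<open>Eop_lower_free_aux\<close> is triangular with the invertible \<open>X (l, l)\<close> on the diagonal.\<close>

lemma Eop_lower_free:
  assumes "a < N" and vac: "\<And>i. i \<in> {a<..<N} \<Longrightarrow> col_vac a (f i)"
    and bnd: "\<And>i. i \<in> {a<..<N} \<Longrightarrow> bounded (f i)"
    and eq: "(\<Sum>i\<in>{a<..<N}. Eop i a (f i)) = 0" and i: "i \<in> {a<..<N}"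
  shows "f i = 0"
proof -
  have "\<forall>i. \<exists>K. i \<in> {a<..<N} \<longrightarrow> (\<forall>s. f i s \<noteq> 0 \<longrightarrow> low_deg s \<le> K)"
    using bnd by (auto simp: bounded_def)
  then obtain K where K: "\<And>i s. i \<in> {a<..<N} \<Longrightarrow> f i s \<noteq> 0 \<Longrightarrow> low_deg s \<le> K i"
    by metis
  define L where "L = (\<Sum>i\<in>{a<..<N}. \<bar>K i\<bar>)"
  have L: "low_deg s \<le> L" if "i \<in> {a<..<N}" "f i s \<noteq> 0" for i s
  proof -
    have "\<bar>K i\<bar> \<le> L"
      unfolding L_def using that(1) by (intro member_le_sum) auto
    with K[OF that] show ?thesis by linarith
  qed
  have "\<forall>i s. i \<in> {a<..<N} \<longrightarrow> low_deg s > L - int n \<longrightarrow> f i s = 0" for n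
  proof (induction n)
    case 0
    then show ?case using L by force
  next
    case (Suc n)
    have "f l s = 0" if "l \<in> {a<..<N}" "low_deg s = L - int n" for l s
      using that
    \<comment> \<open>The largest index l comes first: summands with i > l vanish by this induction,
      and those with i < l by the outer one, because there the variable shifts the argument to a
      higher \<open>low_deg\<close>.\<close>
    proof (induction "N - l" arbitrary: l s rule: less_induct)
      case less
      \<comment> \<open>\<open>X (l, l)\<close> undoes this shift, so that the equation at
        \<open>?s\<close> speaks of \<open>f l s\<close>.\<close>
      let ?s = "s((l, l) := s (l, l) + 1)"
      have deg: "low_deg ?s = L - int n"
        using less.prems low_deg_upd[of "(l, l)" s 1] by (simp add: lower_def)
      have zero: "X (l, i) (f i) ?s = 0" if "i \<in> {a<..<N}" "i \<noteq> l" for i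
      proof (rule ccontr)
        assume "X (l, i) (f i) ?s \<noteq> 0"
        then have nz: "f i (?s((l, i) := ?s (l, i) + dir (l, i))) \<noteq> 0" (is "f i ?s' \<noteq> 0")
          unfolding X_def by (rule shift_neq_0D)
        have deg': "low_deg ?s' = L - int n + (if lower (l, i) then dir (l, i) else 0)"
          using less.prems that deg by (subst low_deg_upd) auto
        show False
        proof (cases "i < l")
          case True
          then have "low_deg ?s' > L - int n"
            using deg' by (simp add: lower_def dir_def)
          with Suc.IH nz that show False by blast
        next
          case False
          with that deg' have "low_deg ?s' = L - int n" "N - i < N - l"
            using less.prems by (auto simp: lower_def)
          then show False using less.hyps[of i ?s'] that nz by blast
        qed
      qed
      have "0 = (\<Sum>i\<in>{a<..<N}. (eps2 (l, i) (l, a) \<star> X (l, i) (f i)) ?s)"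
        using fun_cong[OF Eop_lower_free_aux[OF assms(1) vac eq less.prems(1)], of ?s]
        by (simp add: sum_fun_apply)
      also have "\<dots> = (\<Sum>i\<in>{l}. (eps2 (l, i) (l, a) \<star> X (l, i) (f i)) ?s)"
        using less.prems(1) zero by (intro sum.mono_neutral_right) auto
      finally have "X (l, l) (f l) ?s = 0"
        by (simp add: eps2_def split: if_splits)
      then show "f l s = 0"
        by (simp add: X_def shift_def coefX_def fer_def lower_def dir_def)
    qed
    moreover have "low_deg s > L - int n \<or> low_deg s = L - int n" if "low_deg s > L - int (Suc n)" for s
      using that by auto
    ultimately show ?case using Suc.IH by blast
  qed
  note * = this
  show ?thesis
  proof
    fix s
    have "low_deg s > L - int (nat (L - low_deg s + 1))" by linarith
    then show "f i s = 0 s" using *[of "nat (L - low_deg s + 1)"] i by simp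
  qed
qed

end

section \<open>The enveloping algebra in terms of matrix units\<close>

definition ix :: "nat \<Rightarrow> 'm::{finite,linorder} + 'n::{finite,linorder}" where
  "ix i = (if i < CARD('m) then Inl (sorted_list_of_set UNIV ! i)
           else Inr (sorted_list_of_set UNIV ! (i - CARD('m))))"

lemma sorted_nth_less_iff:
  assumes "i < CARD('a::{finite,linorder})" "j < CARD('a)"
  shows "(sorted_list_of_set UNIV ! i :: 'a) < sorted_list_of_set UNIV ! j \<longleftrightarrow> i < j"
  using assms
  by (metis sorted_list_of_set.length_sorted_key_list_of_set
      sorted_list_of_set.strict_sorted_key_list_of_set linorder_neqE_nat order_less_asym
      sorted_wrt_nth_less order_less_irrefl)

lemma sorted_nth_surj: "\<exists>i<CARD('a). x = (sorted_list_of_set UNIV ! i :: 'a::{finite,linorder})"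
  by (metis UNIV_I finite in_set_conv_nth sorted_list_of_set.length_sorted_key_list_of_set
      sorted_list_of_set.set_sorted_key_list_of_set)

lemma idx_less_ix:
  assumes "i < CARD('m::{finite,linorder}) + CARD('n::{finite,linorder})" "j < CARD('m) + CARD('n)"
  shows "idx_less (ix i :: 'm + 'n) (ix j) \<longleftrightarrow> i < j"
  using assms by (auto simp: ix_def sorted_nth_less_iff)

lemma odd_index_ix: "odd_index (ix i :: 'm::{finite,linorder} + 'n::{finite,linorder}) \<longleftrightarrow> \<not> i < CARD('m)"
  by (simp add: ix_def)

lemma idx_less_irrefl: "\<not> idx_less a a"
  by (cases a) auto

lemma ix_eq_iff:
  assumes "i < CARD('m::{finite,linorder}) + CARD('n::{finite,linorder})" "j < CARD('m) + CARD('n)"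
  shows "(ix i :: 'm + 'n) = ix j \<longleftrightarrow> i = j"
  using assms idx_less_ix[of i j, where 'm = 'm and 'n = 'n] idx_less_ix[of j i, where 'm = 'm and 'n = 'n]
    idx_less_irrefl by (metis linorder_neqE_nat)

lemma ix_surj:
  fixes a :: "'m::{finite,linorder} + 'n::{finite,linorder}"
  obtains i where "i < CARD('m) + CARD('n)" "a = ix i"
proof (cases a)
  case (Inl x)
  obtain i where "i < CARD('m)" "x = sorted_list_of_set UNIV ! i"
    using sorted_nth_surj by blast
  then show ?thesis using Inl by (intro that[of i]) (auto simp: ix_def)
next
  case (Inr x)
  obtain i where "i < CARD('n)" "x = sorted_list_of_set UNIV ! i"
    using sorted_nth_surj by blast
  then show ?thesis using Inr by (intro that[of "CARD('m) + i"]) (auto simp: ix_def)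
qed

lemma Inl_ix:
  obtains i where "i < CARD('m::{finite,linorder})" "(Inl x :: 'm + 'n::{finite,linorder}) = ix i"
  by (metis add.commute ix_surj odd_index.simps(1) odd_index_ix)

lemma Inr_ix:
  obtains i where "CARD('m) \<le> i" "i < CARD('m::{finite,linorder}) + CARD('n)"
    "(Inr x :: 'm + 'n::{finite,linorder}) = ix i"
  by (metis ix_surj leI odd_index.simps(2) odd_index_ix)

lemma bij_betw_ix:
  "bij_betw ix {..<CARD('m) + CARD('n)} (UNIV :: ('m::{finite,linorder} + 'n::{finite,linorder}) set)"
  unfolding bij_betw_def
proof
  show "inj_on (ix :: nat \<Rightarrow> 'm + 'n) {..<CARD('m) + CARD('n)}"
    by (rule inj_onI) (metis ix_eq_iff lessThan_iff)
  have "a \<in> ix ` {..<CARD('m) + CARD('n)}" for a :: "'m + 'n"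
    by (rule ix_surj[of a]) auto
  then show "ix ` {..<CARD('m) + CARD('n)} = (UNIV :: ('m + 'n) set)"
    by auto
qed

lemma sum_ix:
  fixes g :: "'m::{finite,linorder} + 'n::{finite,linorder} \<Rightarrow> 'a::comm_monoid_add"
  shows "(\<Sum>a\<in>UNIV. g a) = (\<Sum>i<CARD('m) + CARD('n). g (ix i))"
  using sum.reindex_bij_betw[OF bij_betw_ix, of g] by simp

definition munit :: "'m + 'n \<Rightarrow> 'm + 'n \<Rightarrow> ('k::field, 'm::finite, 'n::finite) gl" where
  "munit a b = (\<chi> p q. of_bool (p = a \<and> q = b))"

lemma munit_nth [simp]: "munit a b $ p $ q = of_bool (p = a \<and> q = b)"
  by (simp add: munit_def)

definition Eu :: "nat \<Rightarrow> nat \<Rightarrow> ('k::field, 'm::{finite,linorder}, 'n::{finite,linorder}) Ugl" where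
  "Eu i j = ug_incl (munit (ix i) (ix j))"

section \<open>Scalars and defining relations in the enveloping algebra\<close>

lemma poly_mapping_sum_single:
  fixes p :: "'a \<Rightarrow>\<^sub>0 'b::comm_monoid_add"
  shows "p = (\<Sum>k\<in>Poly_Mapping.keys p. Poly_Mapping.single k (Poly_Mapping.lookup p k))"
proof (rule poly_mapping_eqI)
  fix k
  have "(\<Sum>l\<in>Poly_Mapping.keys p. Poly_Mapping.lookup p l when l = k) =
      (\<Sum>l\<in>Poly_Mapping.keys p. if l = k then Poly_Mapping.lookup p k else 0)"
    by (intro sum.cong) (auto simp: when_def)
  then show "Poly_Mapping.lookup p k = Poly_Mapping.lookup
      (\<Sum>k\<in>Poly_Mapping.keys p. Poly_Mapping.single k (Poly_Mapping.lookup p k)) k"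
    by (auto simp: lookup_sum lookup_single in_keys_iff)
qed

lemma poly_mapping_single_induct [case_names zero single add]:
  fixes p :: "'a \<Rightarrow>\<^sub>0 'b::comm_monoid_add"
  assumes "P 0" "\<And>k c. P (Poly_Mapping.single k c)" "\<And>p q. P p \<Longrightarrow> P q \<Longrightarrow> P (p + q)"
  shows "P p"
proof -
  have "P (\<Sum>k\<in>A. Poly_Mapping.single k (Poly_Mapping.lookup p k))" for A
    by (induction A rule: infinite_finite_induct) (auto intro: assms)
  then show ?thesis
    using poly_mapping_sum_single[of p] by metis
qed

lemma fa_scalar_central: "fa_scalar c * p = p * fa_scalar c"
  by (induction p rule: poly_mapping_single_induct)
    (simp_all add: fa_scalar_def mult_single mult.commute algebra_simps)

lemma ug_scalar_central: "ug_scalar c * u = u * ug_scalar c"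
  by transfer (simp add: fa_scalar_central ug_cong_def two_sided_ideal.zero)

lemma ug_scalar_1 [simp]: "ug_scalar 1 = 1"
  by transfer (simp add: fa_scalar_def ug_cong_def two_sided_ideal.zero)

lemma ug_scalar_0 [simp]: "ug_scalar 0 = 0"
  by transfer (simp add: fa_scalar_def ug_cong_def two_sided_ideal.zero)

lemma ug_scalar_add: "ug_scalar (c + d) = ug_scalar c + ug_scalar d"
  by transfer (simp add: fa_scalar_def single_add ug_cong_def two_sided_ideal.zero)

lemma ug_scalar_mult: "ug_scalar (c * d) = ug_scalar c * ug_scalar d"
  by transfer (simp add: fa_scalar_def mult_single ug_cong_def two_sided_ideal.zero)

lemma ug_scalar_uminus: "ug_scalar (- c) = - ug_scalar c"
  using ug_scalar_add[of c "- c"] by (simp add: eq_neg_iff_add_eq_0 add.commute)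

lemma ug_scalar_diff: "ug_scalar (c - d) = ug_scalar c - ug_scalar d"
  using ug_scalar_add[of c "- d"] by (simp add: ug_scalar_uminus)

lemma ideal_base: "s \<in> S \<Longrightarrow> s \<in> two_sided_ideal S"
  using two_sided_ideal.step[of s S 0 1 1, OF _ two_sided_ideal.zero] by simp

lemma ug_incl_add: "ug_incl (x + y) = ug_incl x + ug_incl y"
  by transfer (auto simp: ug_cong_def diff_diff_eq[symmetric] ug_relations_def intro!: ideal_base)

lemma ug_incl_scale: "ug_incl (mat_scale c x) = ug_scalar c * ug_incl x"
  by transfer (auto simp: ug_cong_def ug_relations_def intro!: ideal_base)

lemma ug_incl_commute:
  assumes "homogeneous p x" "homogeneous q y"
  shows "ug_incl x * ug_incl y = ug_scalar ((-1) ^ (p * q)) * ug_incl y * ug_incl x + ug_incl (superbracket p q x y)"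
  using assms
proof (transfer fixing: p q)
  fix x y :: "('a, 'b, 'c) gl"
  assume "homogeneous p x" "homogeneous q y"
  then have "fa_gen x * fa_gen y - fa_scalar ((-1) ^ (p * q)) * fa_gen y * fa_gen x
        - fa_gen (superbracket p q x y) \<in> ug_relations"
    unfolding ug_relations_def by blast
  then show "ug_cong (fa_gen x * fa_gen y)
     (fa_scalar ((- 1) ^ (p * q)) * fa_gen y * fa_gen x + fa_gen (superbracket p q x y))"
    unfolding ug_cong_def diff_diff_eq[symmetric] by (rule ideal_base)
qed

lemma ug_incl_0 [simp]: "ug_incl 0 = 0"
  using ug_incl_add[of 0 0] by simp

lemma ug_incl_uminus: "ug_incl (- x) = - ug_incl x"
  using ug_incl_add[of x "- x"] by (simp add: eq_neg_iff_add_eq_0 add.commute)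

lemma ug_incl_diff: "ug_incl (x - y) = ug_incl x - ug_incl y"
  using ug_incl_add[of x "- y"] by (simp add: ug_incl_uminus)

lemma mat_scale_nth [simp]: "mat_scale c x $ a $ b = c * x $ a $ b"
  by (simp add: mat_scale_def)

lemma munit_mult:
  "munit a b ** munit c d = (if b = c then munit a d else (0 :: ('k::field, 'm::finite, 'n::finite) gl))"
proof -
  have "(\<Sum>k\<in>UNIV. of_bool (i = a \<and> k = b) * of_bool (k = c \<and> l = d)) =
      (\<Sum>k\<in>UNIV. if k = b then of_bool (i = a \<and> b = c \<and> l = d) else (0 :: 'k))" for i l
    by (intro sum.cong) auto
  then show ?thesis
    by (simp add: vec_eq_iff matrix_matrix_mult_def del: sum_mult_of_bool_eq sum_of_bool_mult_eq)
qed

section \<open>The action of the enveloping algebra\<close>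

lemma ab_group_diff_eqI: "x = s + a - b \<Longrightarrow> x - s = a - b" for x :: "'a::ab_group_add"
  by simp

locale verma_fock =
  fixes lam :: "('k::field_char_0, 'm::{finite,linorder}, 'n::{finite,linorder}) wt"
    and M N :: nat
  assumes M_def: "M = CARD('m)" and N_def: "N = CARD('m) + CARD('n)"
begin

lemmas ix_eq = ix_eq_iff[where 'm = 'm and 'n = 'n, folded N_def]
lemmas ix_less = idx_less_ix[where 'm = 'm and 'n = 'n, folded N_def]
lemmas ix_odd = odd_index_ix[where 'm = 'm and 'n = 'n, folded M_def]
lemmas ix_sum = sum_ix[where 'm = 'm and 'n = 'n, folded N_def]

text \<open>Chosen so that the vacuum has weight \<open>lam\<close>.\<close>

definition diag_exp :: "nat \<Rightarrow> 'k" where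
  "diag_exp j = lam $ ix j - (\<Sum>k\<in>{j<..<N}. if fock.fer M (k, j) then 1 else - 1)"

sublocale fock M N diag_exp .

lemma vac_wt_eq: "vac_wt j = lam $ ix j"
  by (simp add: vac_wt_def diag_exp_def)

abbreviation E :: "nat \<Rightarrow> nat \<Rightarrow> ('k, 'm, 'n) Ugl" where "E \<equiv> Eu"

lemma homogeneous_munit:
  "homogeneous (of_bool (fer (i, j))) (munit (ix i) (ix j) :: ('k, 'm, 'n) gl)"
  by (auto simp: homogeneous_def fer_def ix_odd)

lemma eps2_power: "eps2 q r = (-1) ^ (of_bool (fer q) * of_bool (fer r))"
  by (simp add: eps2_def)

lemma mat_scale_0 [simp]: "mat_scale c 0 = (0 :: ('k, 'm, 'n) gl)"
  by (simp add: vec_eq_iff)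

lemma E_commute:
  assumes "i < N" "j < N" "k < N" "l < N"
  shows "E i j * E k l = ug_scalar (eps2 (i, j) (k, l)) * (E k l * E i j)
     + (if j = k then E i l else 0) - (if i = l then ug_scalar (eps2 (i, j) (k, l)) * E k j else 0)"
  using ug_incl_commute[OF homogeneous_munit[of i j] homogeneous_munit[of k l]] assms
  by (simp add: Eu_def eps2_power[symmetric] superbracket_def munit_mult ix_eq eq_commute[of l]
      ug_incl_diff ug_incl_scale mult.assoc)

section \<open>The representation on distributions\<close>

definition mat_op :: "('k, 'm, 'n) gl \<Rightarrow> (state \<Rightarrow> 'k) \<Rightarrow> state \<Rightarrow> 'k" where
  "mat_op x f = (\<Sum>i<N. \<Sum>j<N. x $ ix i $ ix j \<star> Eop i j f)"

definition word_op :: "('k, 'm, 'n) gl freemon \<Rightarrow> (state \<Rightarrow> 'k) \<Rightarrow> state \<Rightarrow> 'k" where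
  "word_op w f = foldr mat_op (letters w) f"

definition free_op :: "(('k, 'm, 'n) gl freemon \<Rightarrow>\<^sub>0 'k) \<Rightarrow> (state \<Rightarrow> 'k) \<Rightarrow> state \<Rightarrow> 'k" where
  "free_op p f = (\<Sum>w\<in>Poly_Mapping.keys p. Poly_Mapping.lookup p w \<star> word_op w f)"

definition act :: "('k, 'm, 'n) Ugl \<Rightarrow> (state \<Rightarrow> 'k) \<Rightarrow> state \<Rightarrow> 'k" where
  "act u = free_op (rep_Ugl u)"

lemma lin_mat_op: "lin (mat_op x)"
  unfolding mat_op_def by (intro lin_sumI lin_vscaleI lin_Eop)

lemma mat_op_add: "mat_op (x + y) f = mat_op x f + mat_op y f"
  by (simp add: mat_op_def add_vscale sum.distrib)

lemma mat_op_scale: "mat_op (mat_scale c x) f = c \<star> mat_op x f"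
  by (simp add: mat_op_def vscale_sum)

text \<open>On nonzero entries of homogeneous matrices the sign between matrix units is the constant
  \<open>(-1) ^ (p * q)\<close>, so the relation is the bilinear extension of
  \<open>Eop_commute\<close>.\<close>

lemma mat_op_superbracket:
  assumes "homogeneous p x" "homogeneous q y"
  shows "mat_op (superbracket p q x y) f = mat_op x (mat_op y f) - (-1) ^ (p * q) \<star> mat_op y (mat_op x f)"
proof -
  let ?x = "\<lambda>i j. x $ ix i $ ix j" and ?y = "\<lambda>i j. y $ ix i $ ix j"
  have sign: "?x i j * ?y k l * eps2 (i, j) (k, l) = (-1) ^ (p * q) * (?x i j * ?y k l)" for i j k l
  proof (cases "?x i j = 0 \<or> ?y k l = 0")
    case False
    then have "fer (i, j) \<longleftrightarrow> odd p" "fer (k, l) \<longleftrightarrow> odd q"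
      using assms unfolding homogeneous_def fer_def by (metis fst_conv snd_conv ix_odd)+
    then show ?thesis by (auto simp: eps2_def)
  qed auto
  let ?s = "(-1) ^ (p * q) :: 'k"
  have xy: "mat_op u (mat_op v f) =
      (\<Sum>i<N. \<Sum>j<N. \<Sum>k<N. \<Sum>l<N. (u $ ix i $ ix j * v $ ix k $ ix l) \<star> Eop i j (Eop k l f))"
    for u v :: "('k, 'm, 'n) gl"
    by (simp add: mat_op_def lin_sum[OF lin_Eop] lin_vscale[OF lin_Eop] vscale_sum)
  have "mat_op x (mat_op y f) = (\<Sum>i<N. \<Sum>j<N. \<Sum>k<N. \<Sum>l<N.
      ?s \<star> ((?x i j * ?y k l) \<star> Eop k l (Eop i j f))
      + (if j = k then (?x i j * ?y k l) \<star> Eop i l f else 0)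
      - (if i = l then (?s * (?x i j * ?y k l)) \<star> Eop k j f else 0))"
    unfolding xy
  proof (intro sum.cong refl)
    fix i j k l assume "i \<in> {..<N}" "j \<in> {..<N}" "k \<in> {..<N}" "l \<in> {..<N}"
    then have "Eop i j (Eop k l f) = eps2 (i, j) (k, l) \<star> Eop k l (Eop i j f)
       + (if j = k then Eop i l f else 0) - (if i = l then eps2 (i, j) (k, l) \<star> Eop k j f else 0)"
      by (intro Eop_commute) auto
    then have "(?x i j * ?y k l) \<star> Eop i j (Eop k l f) =
       (?x i j * ?y k l * eps2 (i, j) (k, l)) \<star> Eop k l (Eop i j f)
       + (if j = k then (?x i j * ?y k l) \<star> Eop i l f else 0)
       - (if i = l then (?x i j * ?y k l * eps2 (i, j) (k, l)) \<star> Eop k j f else 0)"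
      by (simp only: vscale_add vscale_diff vscale_if vscale_vscale vscale_zero)
    then show "(?x i j * ?y k l) \<star> Eop i j (Eop k l f) =
       ?s \<star> ((?x i j * ?y k l) \<star> Eop k l (Eop i j f))
       + (if j = k then (?x i j * ?y k l) \<star> Eop i l f else 0)
       - (if i = l then (?s * (?x i j * ?y k l)) \<star> Eop k j f else 0)"
      by (simp only: sign vscale_vscale)
  qed
  also have "\<dots> = ?s \<star> (\<Sum>i<N. \<Sum>j<N. \<Sum>k<N. \<Sum>l<N. (?x i j * ?y k l) \<star> Eop k l (Eop i j f))
     + (\<Sum>i<N. \<Sum>j<N. \<Sum>k<N. \<Sum>l<N. (if j = k then (?x i j * ?y k l) \<star> Eop i l f else 0))
     - (\<Sum>i<N. \<Sum>j<N. \<Sum>k<N. \<Sum>l<N. (if i = l then (?s * (?x i j * ?y k l)) \<star> Eop k j f else 0))"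
    by (simp only: sum.distrib sum_subtractf vscale_sum)
  also have "(\<Sum>i<N. \<Sum>j<N. \<Sum>k<N. \<Sum>l<N. (?x i j * ?y k l) \<star> Eop k l (Eop i j f)) = mat_op y (mat_op x f)"
  proof -
    have "(\<Sum>i<N. \<Sum>j<N. \<Sum>k<N. \<Sum>l<N. (?x i j * ?y k l) \<star> Eop k l (Eop i j f)) =
        (\<Sum>i<N. \<Sum>k<N. \<Sum>j<N. \<Sum>l<N. (?x i j * ?y k l) \<star> Eop k l (Eop i j f))"
      by (intro sum.cong refl sum.swap)
    also have "\<dots> = (\<Sum>k<N. \<Sum>i<N. \<Sum>l<N. \<Sum>j<N. (?x i j * ?y k l) \<star> Eop k l (Eop i j f))"
      by (subst sum.swap) (intro sum.cong refl sum.swap)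
    also have "\<dots> = (\<Sum>k<N. \<Sum>l<N. \<Sum>i<N. \<Sum>j<N. (?x i j * ?y k l) \<star> Eop k l (Eop i j f))"
      by (intro sum.cong refl sum.swap)
    finally show ?thesis
      by (simp add: xy mult.commute)
  qed
  also have "(\<Sum>i<N. \<Sum>j<N. \<Sum>k<N. \<Sum>l<N. (if j = k then (?x i j * ?y k l) \<star> Eop i l f else 0)) =
     (\<Sum>i<N. \<Sum>l<N. (\<Sum>j<N. ?x i j * ?y j l) \<star> Eop i l f)"
  proof (rule sum.cong[OF refl])
    fix i
    have "(\<Sum>j<N. \<Sum>k<N. \<Sum>l<N. (if j = k then (?x i j * ?y k l) \<star> Eop i l f else 0)) =
        (\<Sum>j<N. \<Sum>k<N. if j = k then (\<Sum>l<N. (?x i j * ?y k l) \<star> Eop i l f) else 0)"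
      by (intro sum.cong refl) auto
    also have "\<dots> = (\<Sum>j<N. \<Sum>l<N. (?x i j * ?y j l) \<star> Eop i l f)"
      by simp
    also have "\<dots> = (\<Sum>l<N. (\<Sum>j<N. ?x i j * ?y j l) \<star> Eop i l f)"
      unfolding sum_vscale by (rule sum.swap)
    finally show "(\<Sum>j<N. \<Sum>k<N. \<Sum>l<N. (if j = k then (?x i j * ?y k l) \<star> Eop i l f else 0)) =
      (\<Sum>l<N. (\<Sum>j<N. ?x i j * ?y j l) \<star> Eop i l f)" .
  qed
  also have "(\<Sum>i<N. \<Sum>j<N. \<Sum>k<N. \<Sum>l<N. (if i = l then (?s * (?x i j * ?y k l)) \<star> Eop k j f else 0)) =
     (\<Sum>k<N. \<Sum>j<N. (?s * (\<Sum>i<N. ?y k i * ?x i j)) \<star> Eop k j f)"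
  proof -
    have "(\<Sum>i<N. \<Sum>j<N. \<Sum>k<N. \<Sum>l<N. (if i = l then (?s * (?x i j * ?y k l)) \<star> Eop k j f else 0)) =
       (\<Sum>i<N. \<Sum>j<N. \<Sum>k<N. (?s * (?y k i * ?x i j)) \<star> Eop k j f)"
      by (intro sum.cong refl) (simp add: mult.commute)
    also have "\<dots> = (\<Sum>i<N. \<Sum>k<N. \<Sum>j<N. (?s * (?y k i * ?x i j)) \<star> Eop k j f)"
      by (intro sum.cong refl sum.swap)
    also have "\<dots> = (\<Sum>k<N. \<Sum>j<N. \<Sum>i<N. (?s * (?y k i * ?x i j)) \<star> Eop k j f)"
      by (subst sum.swap) (intro sum.cong refl sum.swap)
    finally show ?thesis
      by (simp add: sum_vscale sum_distrib_left)
  qed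
  finally have "mat_op x (mat_op y f) - ?s \<star> mat_op y (mat_op x f) =
      (\<Sum>i<N. \<Sum>l<N. (\<Sum>j<N. ?x i j * ?y j l) \<star> Eop i l f)
      - (\<Sum>k<N. \<Sum>j<N. (?s * (\<Sum>i<N. ?y k i * ?x i j)) \<star> Eop k j f)"
    by (rule ab_group_diff_eqI)
  also have "\<dots> = (\<Sum>i<N. \<Sum>l<N. ((\<Sum>j<N. ?x i j * ?y j l) - ?s * (\<Sum>j<N. ?y i j * ?x j l)) \<star> Eop i l f)"
    by (simp only: sum_subtractf[symmetric]) (intro sum.cong refl, simp add: fun_eq_iff left_diff_distrib)
  also have "\<dots> = mat_op (superbracket p q x y) f"
    unfolding mat_op_def superbracket_def
    by (simp only: vector_minus_component mat_scale_nth matrix_matrix_mult_def vec_lambda_beta ix_sum)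
  finally show ?thesis by simp
qed

lemma lin_word_op: "lin (word_op w)"
proof -
  have "lin (foldr mat_op xs)" for xs
    by (induction xs) (simp_all add: lin_def lin_add[OF lin_mat_op] lin_vscale[OF lin_mat_op])
  then show ?thesis by (simp add: word_op_def[abs_def])
qed

lemma lin_free_op: "lin (free_op p)"
  unfolding free_op_def by (intro lin_sumI lin_vscaleI lin_word_op)

lemma free_op_superset:
  assumes "finite A" "Poly_Mapping.keys p \<subseteq> A"
  shows "free_op p f = (\<Sum>w\<in>A. Poly_Mapping.lookup p w \<star> word_op w f)"
  unfolding free_op_def using assms
  by (intro sum.mono_neutral_left) (auto simp: in_keys_iff)

lemma free_op_add: "free_op (p + q) f = free_op p f + free_op q f"
proof -
  let ?A = "Poly_Mapping.keys p \<union> Poly_Mapping.keys q"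
  have "free_op r f = (\<Sum>w\<in>?A. Poly_Mapping.lookup r w \<star> word_op w f)"
    if "r \<in> {p, q, p + q}" for r
    using that keys_add[of p q] by (intro free_op_superset) auto
  then show ?thesis
    by (simp add: lookup_add add_vscale sum.distrib)
qed

lemma free_op_0 [simp]: "free_op 0 f = 0"
  by (simp add: free_op_def)

lemma free_op_diff: "free_op (p - q) f = free_op p f - free_op q f"
  using free_op_add[of "p - q" q f] by simp

lemma free_op_single: "free_op (Poly_Mapping.single w c) f = c \<star> word_op w f"
  by (cases "c = 0") (simp_all add: free_op_def)

lemma word_op_add: "word_op (v + w) f = word_op v (word_op w f)"
  by (simp add: word_op_def plus_freemon_def)

lemma free_op_mult: "free_op (p * q) f = free_op p (free_op q f)"
proof (induction p rule: poly_mapping_single_induct)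
  case (single v c)
  show ?case
  proof (induction q rule: poly_mapping_single_induct)
    case zero
    then show ?case by (simp only: mult_zero_right free_op_0 lin_0[OF lin_free_op])
  next
    case (single w d)
    then show ?case
      by (simp only: mult_single free_op_single word_op_add lin_vscale[OF lin_word_op] vscale_vscale)
  next
    case (add p q)
    then show ?case
      by (simp only: distrib_left free_op_add lin_add[OF lin_free_op])
  qed
qed (simp_all add: distrib_right free_op_add)

lemma free_op_gen: "free_op (fa_gen x) f = mat_op x f"
  by (simp add: fa_gen_def free_op_single word_op_def)

lemma free_op_scalar: "free_op (fa_scalar c) f = c \<star> f"
  by (simp add: fa_scalar_def free_op_single word_op_def zero_freemon_def)

lemma free_op_relations: "s \<in> ug_relations \<Longrightarrow> free_op s f = 0"
  unfolding ug_relations_def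
  by (auto simp: free_op_diff free_op_mult free_op_gen free_op_scalar mat_op_add mat_op_scale
      mat_op_superbracket)

lemma free_op_ideal: "p \<in> two_sided_ideal ug_relations \<Longrightarrow> free_op p f = 0"
  by (induction rule: two_sided_ideal.induct)
    (simp_all add: free_op_add free_op_mult free_op_relations lin_0[OF lin_free_op])

text \<open>Two representatives differ by an element of the ideal, which acts by zero; hence the
  choice made by \<open>rep_Ugl\<close> is irrelevant and \<open>act\<close> is
  multiplicative.\<close>

lemma act_abs: "act (abs_Ugl p) = free_op p"
proof
  fix f
  have "ug_cong (rep_Ugl (abs_Ugl p)) p"
    using Quotient_rep_abs[OF Quotient_Ugl] equivp_reflp[OF ug_cong_equivp] by blast
  then have "free_op (rep_Ugl (abs_Ugl p) - p) f = 0"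
    unfolding ug_cong_def by (rule free_op_ideal)
  then show "act (abs_Ugl p) f = free_op p f"
    by (simp add: act_def free_op_diff)
qed

lemma Ugl_abs_cases: obtains p where "u = abs_Ugl p"
  by (metis Quotient_abs_rep[OF Quotient_Ugl])

lemma lin_act: "lin (act u)"
  by (simp add: act_def lin_free_op)

lemma act_plus: "act (u + v) f = act u f + act v f"
  by (cases u rule: Ugl_abs_cases; cases v rule: Ugl_abs_cases)
    (simp add: plus_Ugl.abs_eq act_abs free_op_add)

lemma act_diff: "act (u - v) f = act u f - act v f"
  by (cases u rule: Ugl_abs_cases; cases v rule: Ugl_abs_cases)
    (simp add: minus_Ugl.abs_eq act_abs free_op_diff)

lemma act_mult: "act (u * v) f = act u (act v f)"
  by (cases u rule: Ugl_abs_cases; cases v rule: Ugl_abs_cases)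
    (simp add: times_Ugl.abs_eq act_abs free_op_mult)

lemma act_0 [simp]: "act 0 f = 0"
  using act_diff[of 0 0 f] by simp

lemma act_scalar [simp]: "act (ug_scalar c) f = c \<star> f"
  by (simp add: ug_scalar.abs_eq act_abs free_op_scalar)

lemma act_1 [simp]: "act 1 f = f"
  using act_scalar[of 1 f] by simp

lemma act_incl: "act (ug_incl x) f = mat_op x f"
  by (simp add: ug_incl.abs_eq act_abs free_op_gen)

lemma act_sum: "act (\<Sum>i\<in>A. u i) f = (\<Sum>i\<in>A. act (u i) f)"
  by (induction A rule: infinite_finite_induct) (simp_all add: act_plus)

lemma act_E: "i < N \<Longrightarrow> j < N \<Longrightarrow> act (E i j) f = Eop i j f"
proof -
  assume ij: "i < N" "j < N"
  have col: "(\<Sum>l<N. of_bool (l = j) \<star> Eop i l f) = (\<Sum>l<N. if l = j then Eop i j f else 0)"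
    by (intro sum.cong) auto
  have "mat_op (munit (ix i) (ix j)) f = (\<Sum>k<N. if k = i then (\<Sum>l<N. if l = j then Eop i j f else 0) else 0)"
    unfolding mat_op_def using ij by (intro sum.cong refl) (auto simp: ix_eq col)
  then show ?thesis
    using ij by (simp add: Eu_def act_incl)
qed

section \<open>The Verma ideal annihilates the vacuum\<close>

lemma mat_op_vac_n_plus: "x \<in> n_plus \<Longrightarrow> mat_op x vac = 0"
proof -
  assume x: "x \<in> n_plus"
  have "x $ ix i $ ix j \<star> Eop i j vac = 0" if "i < N" "j < N" for i j
  proof (cases "i < j")
    case False
    then have "x $ ix i $ ix j = 0"
      using x that by (simp add: n_plus_def ix_less)
    then show ?thesis by simp
  qed (simp add: Eop_upper_vac that)
  then show ?thesis by (simp add: mat_op_def)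
qed

lemma mat_op_vac_cartan: "h \<in> cartan \<Longrightarrow> mat_op h vac = wt_eval lam h \<star> vac"
proof -
  assume h: "h \<in> cartan"
  have "mat_op h vac = (\<Sum>i<N. \<Sum>j<N. if i = j then (lam $ ix j * h $ ix j $ ix j) \<star> vac else 0)"
    unfolding mat_op_def using h
    by (intro sum.cong refl) (auto simp: cartan_def ix_eq Eop_diag_vac vac_wt_eq mult.commute)
  also have "\<dots> = wt_eval lam h \<star> vac"
    by (simp add: wt_eval_def sum_vscale ix_sum)
  finally show ?thesis .
qed

lemma act_verma_ideal: "u \<in> verma_ideal lam \<Longrightarrow> act u vac = 0"
  unfolding verma_ideal_def
proof (induction rule: left_ideal.induct)
  case (step s x a)
  then have "act s vac = 0"
    by (auto simp: act_incl act_diff mat_op_vac_n_plus mat_op_vac_cartan)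
  with step show ?case
    by (simp add: act_plus act_mult lin_0[OF lin_act])
qed simp

lemma bounded_mat_op: "bounded f \<Longrightarrow> bounded (mat_op x f)"
  unfolding mat_op_def by (intro bounded_sum bounded_vscale bounded_Eop) auto

lemma bounded_act: "bounded f \<Longrightarrow> bounded (act u f)"
proof -
  assume f: "bounded f"
  have "bounded (foldr mat_op xs f)" for xs
    by (induction xs) (simp_all add: f bounded_mat_op)
  then show ?thesis
    unfolding act_def free_op_def word_op_def by (intro bounded_sum bounded_vscale)
qed

end

section \<open>Words of lowering operators\<close>

text \<open>A pair \<open>(j, k)\<close> with \<open>j < k\<close> stands for the lowering operator \<open>E k j\<close>, whose weight is minus
  the root with coordinates 1 at j and -1 at k.\<close>

definition ewt :: "(nat \<times> nat) list \<Rightarrow> nat \<Rightarrow> int" where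
  "ewt w i = (\<Sum>(j, k)\<leftarrow>w. of_bool (i = j) - of_bool (i = k))"

lemma ewt_simps [simp]:
  "ewt [] i = 0"
  "ewt (e # w) i = of_bool (i = fst e) - of_bool (i = snd e) + ewt w i"
  "ewt (v @ w) i = ewt v i + ewt w i"
  by (simp_all add: ewt_def split_beta)

definition words :: "nat \<Rightarrow> nat \<Rightarrow> nat \<Rightarrow> (nat \<times> nat) list set" where
  "words N a b = {w. (\<forall>e\<in>set w. fst e < snd e \<and> snd e < N) \<and>
     (\<forall>i. ewt w i = of_bool (i = a) - of_bool (i = b))}"

definition simple_word :: "(nat \<times> nat) list \<Rightarrow> bool" where
  "simple_word w \<longleftrightarrow> (\<forall>e\<in>set w. snd e = Suc (fst e))"

lemma ewt_min:
  "(\<And>e. e \<in> set w \<Longrightarrow> fst e < snd e \<and> j \<le> fst e) \<Longrightarrow> ewt w j = int (length (filter (\<lambda>e. fst e = j) w))"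
  by (induction w) (auto, metis order_less_le_trans less_irrefl)

text \<open>No letter ends at the smallest source, so the weight there counts the letters starting
  there. The weight is positive only at a, where it is 1: the smallest source is a and occurs
  once.\<close>

lemma words_decomp:
  assumes "w \<in> words N a b" "w \<noteq> []"
  obtains x i y where "w = x @ (a, i) # y" "a < i" "i < N" "x @ y \<in> words N i b"
    "\<And>e. e \<in> set (x @ y) \<Longrightarrow> a < fst e"
proof -
  define j where "j = Min (fst ` set w)"
  have "j \<in> fst ` set w"
    unfolding j_def using assms(2) by (intro Min_in) auto
  then obtain e where e: "e \<in> set w" "fst e = j" by auto
  have ge: "j \<le> fst e'" if "e' \<in> set w" for e'
    unfolding j_def using that by (intro Min_le) auto
  have len: "ewt w j = int (length (filter (\<lambda>e. fst e = j) w))"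
    using assms(1) ge by (intro ewt_min) (auto simp: words_def)
  have "length (filter (\<lambda>e. fst e = j) w) > 0"
    using e by (auto simp: length_greater_0_conv filter_empty_conv simp del: length_greater_0_conv)
  moreover have wt: "ewt w i = of_bool (i = a) - of_bool (i = b)" for i
    using assms(1) by (simp add: words_def)
  ultimately have j: "j = a" "length (filter (\<lambda>e. fst e = j) w) = 1"
    using len wt[of j] by (auto simp: of_bool_def split: if_splits)
  obtain x y where w: "w = x @ e # y"
    using e(1) split_list by metis
  have "filter (\<lambda>e. fst e = j) (x @ y) = []"
    using j(2) e(2) by (simp add: w)
  then have gt: "a < fst e'" if "e' \<in> set (x @ y)" for e'
    using that ge[of e'] j(1) by (auto simp: w filter_empty_conv order_less_le)
  have e_eq: "e = (a, snd e)" using e(2) j(1) by (cases e) simp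
  show ?thesis
  proof (rule that[of x "snd e" y])
    show "w = x @ (a, snd e) # y" using w e_eq by simp
    show "a < snd e" "snd e < N" using assms(1) e j by (auto simp: words_def)
    have "ewt (x @ y) i = of_bool (i = snd e) - of_bool (i = b)" for i
      using wt[of i] e(2) j(1) by (simp add: w)
    then show "x @ y \<in> words N (snd e) b"
      using assms(1) by (auto simp: words_def w)
  qed (use gt in auto)
qed

lemma words_Nil: "[] \<in> words N a b \<longleftrightarrow> a = b"
  by (auto simp: words_def of_bool_def split: if_splits)

lemma words_less: "w \<in> words N a b \<Longrightarrow> w \<noteq> [] \<Longrightarrow> a < b \<and> b < N"
proof (induction "length w" arbitrary: w a rule: less_induct)
  case less
  obtain x i y where *: "w = x @ (a, i) # y" "a < i" "i < N" "x @ y \<in> words N i b"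
    using words_decomp[OF less.prems] by metis
  show ?case
  proof (cases "x @ y = []")
    case True
    with * show ?thesis using words_Nil[of N i b] by auto
  next
    case False
    then show ?thesis using less.hyps[of "x @ y" i] * by auto
  qed
qed

lemma words_same: "words N a a = {[]}"
  using words_less[of _ N a a] words_Nil[of N a a] by blast

lemma words_ge: "w \<in> words N a b \<Longrightarrow> e \<in> set w \<Longrightarrow> a \<le> fst e"
proof -
  assume w: "w \<in> words N a b" "e \<in> set w"
  then have "w \<noteq> []" by auto
  then obtain x i y where *: "w = x @ (a, i) # y" "\<And>e. e \<in> set (x @ y) \<Longrightarrow> a < fst e"
    using words_decomp[OF w(1)] by metis
  have "e = (a, i) \<or> e \<in> set (x @ y)" using w(2) *(1) by auto
  then show "a \<le> fst e" using *(2)[of e] by auto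
qed

lemma ewt_crossings:
  "(\<And>e. e \<in> set w \<Longrightarrow> fst e < snd e) \<Longrightarrow>
     (\<Sum>i<m. ewt w i) = int (length (filter (\<lambda>e. fst e < m \<and> m \<le> snd e) w))"
proof (induction w)
  case (Cons e w)
  have "(\<Sum>i<m. of_bool (i = j)) = (of_bool (j < m) :: int)" for j
    by (simp add: of_bool_def)
  moreover have "fst e < snd e" using Cons.prems by simp
  moreover have "(\<Sum>i<m. ewt w i) = int (length (filter (\<lambda>e. fst e < m \<and> m \<le> snd e) w))"
    using Cons by simp
  ultimately show ?case
    by (cases "fst e < m"; cases "snd e < m")
      (simp_all add: sum.distrib sum_subtractf del: sum_of_bool_eq)
qed simp

text \<open>Summing the weight over the indices below m counts the letters that step over m. For m =
  M these are the odd letters, so a word of such a weight has at most one odd letter and reordering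
  it produces no signs.\<close>

lemma words_crossings:
  assumes "w \<in> words N a b"
  shows "int (length (filter (\<lambda>e. fst e < m \<and> m \<le> snd e) w)) = of_bool (a < m) - of_bool (b < m)"
proof -
  have "(\<Sum>i<m. of_bool (i = j)) = (of_bool (j < m) :: int)" for j
    by (simp add: of_bool_def)
  then have "(\<Sum>i<m. ewt w i) = of_bool (a < m) - of_bool (b < m)"
    using assms by (simp add: words_def sum_subtractf del: sum_of_bool_eq)
  then show ?thesis
    using ewt_crossings[of w m] assms by (auto simp: words_def)
qed

lemma words_append:
  "v \<in> words N a k \<Longrightarrow> w \<in> words N k b \<Longrightarrow> v @ w \<in> words N a b \<and> w @ v \<in> words N a b"
  by (auto simp: words_def)

lemma ug_scalar_move: "ug_scalar c * (u * v) = u * (ug_scalar c * v)"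
  by (metis mult.assoc ug_scalar_central)

context verma_fock
begin

section \<open>Combinations of words and their leading coefficient\<close>

definition wprod :: "(nat \<times> nat) list \<Rightarrow> ('k, 'm, 'n) Ugl" where
  "wprod w = prod_list (map (\<lambda>e. E (snd e) (fst e)) w)"

lemma wprod_simps [simp]:
  "wprod [] = 1" "wprod (e # w) = E (snd e) (fst e) * wprod w" "wprod (v @ w) = wprod v * wprod w"
  by (simp_all add: wprod_def)

text \<open>\<open>SL a b u c\<close>: u has a representation as a combination of words of weight \<open>- (a - b)\<close> in which
  the words consisting of simple roots have total coefficient c. By \<open>SL_inj\<close> below, c
  depends only on u.\<close>

inductive SL :: "nat \<Rightarrow> nat \<Rightarrow> ('k, 'm, 'n) Ugl \<Rightarrow> 'k \<Rightarrow> bool" for a b where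
  zero: "SL a b 0 0"
| step: "w \<in> words N a b \<Longrightarrow> SL a b u c \<Longrightarrow>
    SL a b (ug_scalar x * wprod w + u) (x * of_bool (simple_word w) + c)"

lemma SL_word: "w \<in> words N a b \<Longrightarrow> SL a b (wprod w) (of_bool (simple_word w))"
  using SL.step[of w a b 0 0 1] SL.zero by simp

lemma SL_add: "SL a b u c \<Longrightarrow> SL a b v d \<Longrightarrow> SL a b (u + v) (c + d)"
proof (induction rule: SL.induct)
  case (step w u c x)
  then show ?case
    using SL.step[of w a b "u + v" "c + d" x] by (simp add: add.assoc)
qed simp

lemma SL_scale: "SL a b u c \<Longrightarrow> SL a b (ug_scalar x * u) (x * c)"
proof (induction rule: SL.induct)
  case (step w u c y)
  then show ?case
    using SL.step[of w a b "ug_scalar x * u" "x * c" "x * y"]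
    by (simp add: distrib_left ug_scalar_mult mult.assoc)
qed (simp add: SL.zero)

lemma SL_sum: "(\<And>i. i \<in> A \<Longrightarrow> SL a b (u i) (c i)) \<Longrightarrow> SL a b (\<Sum>i\<in>A. u i) (\<Sum>i\<in>A. c i)"
  by (induction A rule: infinite_finite_induct) (simp_all add: SL.zero SL_add)

lemma SL_diff: "SL a b u c \<Longrightarrow> SL a b v d \<Longrightarrow> SL a b (u - v) (c - d)"
  using SL_add[of a b u c "ug_scalar (-1) * v" "-1 * d"] SL_scale[of a b v d "-1"]
  by (simp add: ug_scalar_uminus)

text \<open>The condition on concatenation is kept abstract in order to cover both orders of two
  factors of weights -(a - k) and -(k - b).\<close>

lemma SL_mult_aux:
  assumes words: "\<And>v w. v \<in> words N a b \<Longrightarrow> w \<in> words N a' b' \<Longrightarrow> v @ w \<in> words N a'' b''"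
    and "SL a b u c" "SL a' b' v d"
  shows "SL a'' b'' (u * v) (c * d)"
  using assms(2)
proof (induction rule: SL.induct)
  case (step w u c x)
  have "SL a'' b'' (wprod w * v) (of_bool (simple_word w) * d)"
    using assms(3)
  proof (induction rule: SL.induct)
    case (step w' u' c' y)
    have "SL a'' b'' (ug_scalar y * wprod (w @ w') + wprod w * u')
       (y * of_bool (simple_word (w @ w')) + of_bool (simple_word w) * c')"
      using step words \<open>w \<in> words N a b\<close> by (intro SL.step) auto
    moreover have "wprod w * (ug_scalar y * wprod w') = ug_scalar y * wprod (w @ w')"
      by (simp add: ug_scalar_move)
    ultimately show ?case
      by (simp add: distrib_left of_bool_conj simple_word_def ball_Un mult_ac)
  qed (simp add: SL.zero)
  from SL_add[OF SL_scale[OF this] step.IH, of x] show ?case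
    by (simp add: distrib_right mult.assoc)
qed (simp add: SL.zero)

lemma SL_mult:
  assumes "SL a k u c" "SL k b v d"
  shows "SL a b (u * v) (c * d)" "SL a b (v * u) (d * c)"
  using assms words_append by (blast intro: SL_mult_aux)+

lemma SL_E: "a < i \<Longrightarrow> i < N \<Longrightarrow> SL a i (E i a) (of_bool (i = Suc a))"
  using SL_word[of "[(a, i)]" a i] by (auto simp: words_def simple_word_def)

lemma SL_one: "SL a a 1 1"
  using SL_word[of "[]" a a] by (simp add: words_Nil simple_word_def)

lemma SL_same: "SL a a u c \<Longrightarrow> u = ug_scalar c"
  by (induction rule: SL.induct) (auto simp: words_same simple_word_def ug_scalar_add)

text \<open>The letter (a, i) moves to the left past letters (j, k) with a < j. The commutator is
  nonzero only for j = i, where the two letters merge into (a, k). Of the coefficients only the one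
  at a + 1 is prescribed, since a simple word can only start its path with (a, a + 1).\<close>

lemma peel_word:
  assumes "x @ (a, i) # y \<in> words N a b" "\<And>e. e \<in> set (x @ y) \<Longrightarrow> a < fst e"
  shows "\<exists>U C. (\<forall>i\<in>{a<..b}. SL i b (U i) (C i)) \<and> C (Suc a) = of_bool (simple_word (x @ (a, i) # y)) \<and>
    wprod (x @ (a, i) # y) = (\<Sum>i\<in>{a<..b}. E i a * U i)"
  using assms
proof (induction "length x" arbitrary: x i y)
  case 0
  then have w: "(a, i) # y \<in> words N a b" "x = []" by auto
  have i: "a < i" "i < N" using w by (auto simp: words_def)
  have "ewt y l = of_bool (l = i) - of_bool (l = b)" for l
  proof -
    have "ewt ((a, i) # y) l = of_bool (l = a) - of_bool (l = b)"
      using w(1) unfolding words_def by blast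
    then show ?thesis by simp
  qed
  then have y: "y \<in> words N i b" using w by (simp add: words_def)
  have ib: "i \<le> b"
    using words_less[OF y] y words_Nil[of N i b] by (cases "y = []") auto
  show ?case
  proof (rule exI[of _ "\<lambda>l. if l = i then wprod y else 0"],
      rule exI[of _ "\<lambda>l. if l = i then of_bool (simple_word y) else 0"], intro conjI ballI)
    show "SL l b (if l = i then wprod y else 0) (if l = i then of_bool (simple_word y) else 0)"
      if "l \<in> {a<..b}" for l
      using y by (simp add: SL_word SL.zero)
    show "(if Suc a = i then of_bool (simple_word y) else 0) = (of_bool (simple_word (x @ (a, i) # y)) :: 'k)"
      using w(2) by (auto simp: simple_word_def)
    show "wprod (x @ (a, i) # y) = (\<Sum>l\<in>{a<..b}. E l a * (if l = i then wprod y else 0))"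
      using w(2) i ib by (simp add: if_distrib[where f = "\<lambda>v. _ * v"] cong: if_cong)
  qed
next
  case (Suc n)
  obtain x' e where x: "x = x' @ [e]"
    using Suc.hyps(2) by (metis append_butlast_last_id length_0_conv nat.distinct(1))
  obtain j k where e: "e = (j, k)" by (cases e)
  have mem: "x' @ (j, k) # (a, i) # y \<in> words N a b"
    using Suc.prems(1) by (simp add: x e)
  have bounds: "a < i" "i < N" "j < k" "k < N" "a < j"
    using mem Suc.prems(2)[of e] by (auto simp: words_def x e)
  have swap: "x' @ (a, i) # (j, k) # y \<in> words N a b"
    using mem by (auto simp: words_def algebra_simps)
  have merge: "x' @ (a, k) # y \<in> words N a b" if "j = i"
    using mem that bounds by (auto simp: words_def algebra_simps)
  \<comment> \<open>Two odd letters would cross \<open>M\<close> twice.\<close>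
  have eps: "eps2 (k, j) (i, a) = 1"
  proof (rule ccontr)
    assume "eps2 (k, j) (i, a) \<noteq> 1"
    then have "fer (k, j)" "fer (i, a)" by (auto simp: eps2_def split: if_splits)
    then have "j < M" "M \<le> k" "a < M" "M \<le> i"
      using bounds by (auto simp: fer_def)
    then show False
      using words_crossings[OF mem, of M] by (simp add: of_bool_def split: if_splits)
  qed
  have comm: "E k j * E i a = E i a * E k j + (if j = i then E k a else 0)"
    using E_commute[of k j i a] bounds by (simp add: eps)
  have prod: "wprod (x @ (a, i) # y) = wprod (x' @ (a, i) # (j, k) # y)
      + (if j = i then wprod (x' @ (a, k) # y) else 0)"
  proof -
    have "wprod (x @ (a, i) # y) = wprod x' * ((E k j * E i a) * wprod y)"
      by (simp add: x e mult.assoc)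
    then show ?thesis
      by (simp add: comm distrib_left distrib_right mult.assoc)
  qed
  have IH: "\<exists>U C. (\<forall>i\<in>{a<..b}. SL i b (U i) (C i)) \<and> C (Suc a) = of_bool (simple_word (x' @ (a, l) # z)) \<and>
      wprod (x' @ (a, l) # z) = (\<Sum>i\<in>{a<..b}. E i a * U i)"
    if "x' @ (a, l) # z \<in> words N a b" "\<And>e. e \<in> set z \<Longrightarrow> a < fst e" for l z
    using that Suc.hyps(2) Suc.prems(2) by (intro Suc.hyps(1)) (auto simp: x)
  have gt_y: "a < fst e" if "e \<in> set y" for e
    using Suc.prems(2)[of e] that by simp
  have gt_jky: "a < fst e" if "e \<in> set ((j, k) # y)" for e
    using gt_y[of e] that bounds(5) by (cases "e = (j, k)") simp_all
  obtain U C where UC: "\<forall>i\<in>{a<..b}. SL i b (U i) (C i)"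
      "C (Suc a) = of_bool (simple_word (x' @ (a, i) # (j, k) # y))"
      "wprod (x' @ (a, i) # (j, k) # y) = (\<Sum>i\<in>{a<..b}. E i a * U i)"
    using IH[OF swap gt_jky] by blast
  have simple: "simple_word (x' @ (a, i) # (j, k) # y) \<longleftrightarrow> simple_word (x @ (a, i) # y)"
    by (auto simp: simple_word_def x e)
  show ?case
  proof (cases "j = i")
    case True
    obtain V B where VB: "\<forall>i\<in>{a<..b}. SL i b (V i) (B i)"
        "B (Suc a) = of_bool (simple_word (x' @ (a, k) # y))"
        "wprod (x' @ (a, k) # y) = (\<Sum>i\<in>{a<..b}. E i a * V i)"
      using IH[OF merge[OF True] gt_y] by blast
    \<comment> \<open>Here a < i = j < k, so the merged letter is not simple and merging does not
      affect the leading coefficient.\<close>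
    have "B (Suc a) = 0"
      using VB(2) bounds by (auto simp: simple_word_def)
    then have "C (Suc a) + B (Suc a) = of_bool (simple_word (x @ (a, i) # y))"
      using UC(2) simple by simp
    moreover have "wprod (x @ (a, i) # y) = (\<Sum>i\<in>{a<..b}. E i a * (U i + V i))"
      using UC(3) VB(3) prod True by (simp only: if_True simp_thms distrib_left sum.distrib)
    moreover have "\<forall>i\<in>{a<..b}. SL i b (U i + V i) (C i + B i)"
      using UC(1) VB(1) SL_add by blast
    ultimately show ?thesis
      by (intro exI[of _ "\<lambda>i. U i + V i"] exI[of _ "\<lambda>i. C i + B i"] conjI)
  next
    case False
    then have "wprod (x @ (a, i) # y) = (\<Sum>i\<in>{a<..b}. E i a * U i)"
      using UC(3) prod by (simp only: if_False simp_thms add_0_right)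
    moreover have "C (Suc a) = of_bool (simple_word (x @ (a, i) # y))"
      using UC(2) simple by simp
    ultimately show ?thesis
      using UC(1) by (intro exI[of _ U] exI[of _ C] conjI)
  qed
qed

lemma peel:
  assumes "SL a b u c" "a < b"
  obtains U C where "\<And>i. i \<in> {a<..b} \<Longrightarrow> SL i b (U i) (C i)" "C (Suc a) = c"
    "u = (\<Sum>i\<in>{a<..b}. E i a * U i)"
proof -
  have "\<exists>U C. (\<forall>i\<in>{a<..b}. SL i b (U i) (C i)) \<and> C (Suc a) = c \<and> u = (\<Sum>i\<in>{a<..b}. E i a * U i)"
    using assms(1)
  proof (induction rule: SL.induct)
    case zero
    show ?case
      by (rule exI[of _ "\<lambda>_. 0"], rule exI[of _ "\<lambda>_. 0"]) (simp add: SL.zero)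
  next
    case (step w u c x)
    obtain U C where UC: "\<forall>i\<in>{a<..b}. SL i b (U i) (C i)" "C (Suc a) = c"
        "u = (\<Sum>i\<in>{a<..b}. E i a * U i)"
      using step.IH by blast
    have "w \<noteq> []" using step.hyps(1) words_Nil[of N a b] assms(2) by auto
    from words_decomp[OF step.hyps(1) this] obtain x' i y where
      w: "w = x' @ (a, i) # y" "\<And>e. e \<in> set (x' @ y) \<Longrightarrow> a < fst e"
      by metis
    obtain V B where VB: "\<forall>i\<in>{a<..b}. SL i b (V i) (B i)"
        "B (Suc a) = of_bool (simple_word w)" "wprod w = (\<Sum>i\<in>{a<..b}. E i a * V i)"
      using peel_word[of x' a i y b] step.hyps(1) w by auto
    have "ug_scalar x * wprod w = (\<Sum>i\<in>{a<..b}. E i a * (ug_scalar x * V i))"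
      unfolding VB(3) sum_distrib_left by (intro sum.cong refl ug_scalar_move)
    then have "ug_scalar x * wprod w + u = (\<Sum>i\<in>{a<..b}. E i a * (ug_scalar x * V i + U i))"
      by (simp only: UC(3) distrib_left sum.distrib)
    moreover have "\<forall>i\<in>{a<..b}. SL i b (ug_scalar x * V i + U i) (x * B i + C i)"
      using UC(1) VB(1) by (blast intro: SL_add SL_scale)
    moreover have "x * B (Suc a) + C (Suc a) = x * of_bool (simple_word w) + c"
      using UC(2) VB(2) by simp
    ultimately show ?case
      by (intro exI[of _ "\<lambda>i. ug_scalar x * V i + U i"] exI[of _ "\<lambda>i. x * B i + C i"] conjI)
  qed
  then show ?thesis using that by blast
qed

section \<open>Columns, weights and faithfulness on the vacuum\<close>

lemma act_wprod_Cons: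
  "fst e < N \<Longrightarrow> snd e < N \<Longrightarrow> act (wprod (e # w)) f = Eop (snd e) (fst e) (act (wprod w) f)"
  by (simp add: act_mult act_E)

lemma col_vac_act_wprod:
  assumes "col_vac j f" "\<And>e. e \<in> set w \<Longrightarrow> fst e < snd e \<and> snd e < N \<and> j < fst e"
  shows "col_vac j (act (wprod w) f)"
  using assms(2)
proof (induction w)
  case (Cons e w)
  have "fst e < snd e" "snd e < N" "j < fst e" using Cons.prems[of e] by simp_all
  then have "j \<noteq> fst e" "j \<noteq> snd e" "fst e < N" "snd e < N" by linarith+
  then show ?case
    using Cons by (simp only: act_wprod_Cons) (intro col_vac_Eop, auto)
qed (simp add: assms(1))

lemma in_deg_act_wprod:
  assumes "in_deg \<delta> f" "\<And>e. e \<in> set w \<Longrightarrow> fst e < snd e \<and> snd e < N"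
  shows "in_deg (\<lambda>l. \<delta> l - ewt w l) (act (wprod w) f)"
  using assms(2)
proof (induction w)
  case (Cons e w)
  have "fst e < snd e" "snd e < N" using Cons.prems[of e] by simp_all
  then have e: "fst e < N" "snd e < N" by linarith+
  have "in_deg (\<lambda>l. \<delta> l - ewt w l + (if snd e = l then 1 else 0) - (if fst e = l then 1 else 0))
     (Eop (snd e) (fst e) (act (wprod w) f))"
    using Cons by (intro in_deg_Eop) auto
  also have "(\<lambda>l. \<delta> l - ewt w l + (if snd e = l then 1 else 0) - (if fst e = l then 1 else 0)) =
     (\<lambda>l. \<delta> l - ewt (e # w) l)"
    by (auto simp: fun_eq_iff)
  finally show ?case using e by (simp only: act_wprod_Cons)
qed (simp add: assms(1))

text \<open>All letters start at i or later, and a letter changes exponents only in the columns of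
  its two indices.\<close>

lemma SL_col_vac: "SL i b u c \<Longrightarrow> j < i \<Longrightarrow> col_vac j (act u vac)"
proof (induction rule: SL.induct)
  case (step w u c x)
  have "col_vac j (act (wprod w) vac)"
    using step.hyps(1) step.prems words_ge[OF step.hyps(1)]
    by (intro col_vac_act_wprod col_vac_vac) (force simp: words_def)
  then show ?case
    using step by (simp only: act_plus act_mult act_scalar) (intro col_vac_add col_vac_vscale, auto)
qed (simp add: col_vac_0)

lemma SL_in_deg: "SL a b u c \<Longrightarrow> in_deg (\<lambda>l. of_bool (l = b) - of_bool (l = a)) (act u vac)"
proof (induction rule: SL.induct)
  case (step w u c x)
  have "in_deg (\<lambda>l. 0 - ewt w l) (act (wprod w) vac)"
    using step.hyps(1) by (intro in_deg_act_wprod in_deg_vac) (auto simp: words_def)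
  also have "(\<lambda>l. 0 - ewt w l) = (\<lambda>l. of_bool (l = b) - of_bool (l = a))"
    using step.hyps(1) by (auto simp: words_def)
  finally show ?case
    using step by (simp only: act_plus act_mult act_scalar) (intro in_deg_add in_deg_vscale, auto)
qed (simp add: in_deg_def)

lemma E_diag_commute:
  assumes "j < N" "k < N" "l < N"
  shows "E j j * E k l = E k l * E j j + ug_scalar (of_bool (j = k) - of_bool (j = l)) * E k l"
  using E_commute[of j j k l] assms by (auto simp: eps2_def fer_def ug_scalar_uminus)

lemma diag_wprod:
  assumes "j < N" "\<And>e. e \<in> set w \<Longrightarrow> fst e < snd e \<and> snd e < N"
  shows "E j j * wprod w = wprod w * E j j - ug_scalar (of_int (ewt w j)) * wprod w"
  using assms(2)
proof (induction w)
  case (Cons e w)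
  have "fst e < snd e" "snd e < N" using Cons.prems[of e] by simp_all
  then have e: "fst e < N" "snd e < N" by linarith+
  let ?d = "of_bool (j = snd e) - of_bool (j = fst e) :: 'k"
  have "E j j * wprod (e # w) = (E (snd e) (fst e) * E j j + ug_scalar ?d * E (snd e) (fst e)) * wprod w"
    using E_diag_commute[OF assms(1) e(2,1)] by (simp add: mult.assoc[symmetric])
  also have "\<dots> = E (snd e) (fst e) * (E j j * wprod w) + ug_scalar ?d * wprod (e # w)"
    by (simp add: distrib_right mult.assoc)
  also have "E j j * wprod w = wprod w * E j j - ug_scalar (of_int (ewt w j)) * wprod w"
    using Cons by simp
  also have "E (snd e) (fst e) * (wprod w * E j j - ug_scalar (of_int (ewt w j)) * wprod w) =
      wprod (e # w) * E j j - ug_scalar (of_int (ewt w j)) * wprod (e # w)"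
    by (simp only: right_diff_distrib ug_scalar_move wprod_simps mult.assoc)
  also have "wprod (e # w) * E j j - ug_scalar (of_int (ewt w j)) * wprod (e # w) + ug_scalar ?d * wprod (e # w)
     = wprod (e # w) * E j j - (ug_scalar (of_int (ewt w j)) - ug_scalar ?d) * wprod (e # w)"
    by (simp only: left_diff_distrib diff_diff_eq2 diff_add_eq)
  also have "ug_scalar (of_int (ewt w j)) - ug_scalar ?d = ug_scalar (of_int (ewt (e # w) j))"
    by (simp add: ug_scalar_diff[symmetric] algebra_simps)
  finally show ?case .
qed simp

lemma SL_weight:
  assumes "j < N" "SL a b u c" "Eop j j f = \<mu> \<star> f"
  shows "Eop j j (act u f) = (\<mu> - of_bool (j = a) + of_bool (j = b)) \<star> act u f"
  using assms(2)
proof (induction rule: SL.induct)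
  case zero
  then show ?case by (simp only: act_0 lin_0[OF lin_Eop] vscale_zero)
next
  case (step w u c x)
  have ewt: "ewt w j = of_bool (j = a) - of_bool (j = b)"
    using step.hyps(1) by (simp add: words_def)
  have "Eop j j (act (wprod w) f) = act (E j j * wprod w) f"
    using assms(1) by (simp add: act_mult act_E)
  also have "\<dots> = act (wprod w) (Eop j j f) - of_int (ewt w j) \<star> act (wprod w) f"
    using step.hyps(1) assms(1)
    by (subst diag_wprod) (auto simp: words_def act_diff act_mult act_E)
  also have "\<dots> = (\<mu> - of_int (ewt w j)) \<star> act (wprod w) f"
    by (simp only: assms(3) lin_vscale[OF lin_act]) (simp add: fun_eq_iff algebra_simps)
  finally have "Eop j j (act (wprod w) f) = (\<mu> - of_bool (j = a) + of_bool (j = b)) \<star> act (wprod w) f"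
    by (simp add: ewt)
  with step.IH show ?case
    by (simp only: act_plus act_mult act_scalar lin_add[OF lin_Eop] lin_vscale[OF lin_Eop] vscale_add
        vscale_vscale mult.commute)
qed

lemma bounded_act_vac: "bounded (act u vac)"
  by (intro bounded_act bounded_vac)

lemma free_interval:
  assumes "a < b" "b < N" and f: "\<And>i. i \<in> {a<..b} \<Longrightarrow> col_vac a (f i)" "\<And>i. i \<in> {a<..b} \<Longrightarrow> bounded (f i)"
    and eq: "(\<Sum>i\<in>{a<..b}. Eop i a (f i)) = 0" and i: "i \<in> {a<..b}"
  shows "f i = 0"
proof -
  define g where "g i = (if i \<le> b then f i else 0)" for i
  have "(\<Sum>i\<in>{a<..<N}. Eop i a (g i)) = (\<Sum>i\<in>{a<..b}. Eop i a (g i))"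
    using assms(2) by (intro sum.mono_neutral_right) (auto simp: g_def lin_0[OF lin_Eop])
  also have "\<dots> = 0"
    unfolding eq[symmetric] by (intro sum.cong) (auto simp: g_def)
  finally have "(\<Sum>i\<in>{a<..<N}. Eop i a (g i)) = 0" .
  then have "g i = 0"
    using assms i by (intro Eop_lower_free[of a g i]) (auto simp: g_def f col_vac_0 bounded_0)
  with i show ?thesis by (simp add: g_def)
qed

lemma act_peeled:
  assumes "b < N"
  shows "act (\<Sum>i\<in>{a<..b}. E i a * U i) f = (\<Sum>i\<in>{a<..b}. Eop i a (act (U i) f))"
  unfolding act_sum using assms by (intro sum.cong) (auto simp: act_mult act_E)

text \<open>The substitute for PBW in the weights -(a - b). After peeling, freeness shows that each
  factor \<open>U i\<close> kills the vacuum, and the factors have shorter intervals; at a = b only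
  a scalar is left.\<close>

lemma SL_inj:
  assumes "SL a b u c" "a \<le> b" "b < N" "act u vac = 0"
  shows "u = 0 \<and> c = 0"
  using assms
proof (induction "b - a" arbitrary: a u c rule: less_induct)
  case less
  show ?case
  proof (cases "a = b")
    case True
    then have "u = ug_scalar c" using SL_same[of a u c] less.prems by simp
    with less.prems show ?thesis by (simp add: vscale_eq_0_iff vac_neq_0)
  next
    case False
    with less.prems have ab: "a < b" by simp
    obtain U C where UC: "\<And>i. i \<in> {a<..b} \<Longrightarrow> SL i b (U i) (C i)" "C (Suc a) = c"
      "u = (\<Sum>i\<in>{a<..b}. E i a * U i)"
      using peel[OF less.prems(1) ab] by metis
    have sum0: "(\<Sum>i\<in>{a<..b}. Eop i a (act (U i) vac)) = 0"
      using less.prems(4) by (simp only: UC(3) act_peeled[OF less.prems(3)])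
    have "U i = 0 \<and> C i = 0" if i: "i \<in> {a<..b}" for i
    proof (rule less.hyps)
      show "act (U i) vac = 0"
        by (rule free_interval[OF ab less.prems(3) _ _ sum0 i])
          (auto simp: bounded_act_vac intro: SL_col_vac[OF UC(1)])
    qed (use i UC(1) less.prems(3) in auto)
    then show ?thesis using UC ab by auto
  qed
qed

section \<open>Singular vectors\<close>

text \<open>For r < j < k neither k = r + 1 nor j = r can hold, so \<open>E r (Suc r)\<close>
  supercommutes with every letter that occurs.\<close>

lemma SL_raise_below:
  assumes "SL a b u c" "r < a" "Suc r < N" "Eop r (Suc r) f = 0"
  shows "Eop r (Suc r) (act u f) = 0"
  using assms(1)
proof (induction rule: SL.induct)
  case zero
  then show ?case by (simp only: act_0 lin_0[OF lin_Eop])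
next
  case (step w u c x)
  have "Eop r (Suc r) (act (wprod w) f) = 0"
    if "\<And>e. e \<in> set w \<Longrightarrow> r < fst e \<and> fst e < snd e \<and> snd e < N"
    using that
  proof (induction w)
    case Nil
    then show ?case by (simp only: wprod_simps act_1 assms(4))
  next
    case (Cons e w)
    have e: "r < fst e" "fst e < snd e" "snd e < N" using Cons.prems[of e] by simp_all
    have "Eop r (Suc r) (act (wprod w) f) = 0"
      using Cons.prems by (intro Cons.IH) simp
    moreover have "Eop r (Suc r) (Eop (snd e) (fst e) g) =
        eps2 (r, Suc r) (snd e, fst e) \<star> Eop (snd e) (fst e) (Eop r (Suc r) g)" for g
      using Eop_commute[of r "Suc r" "snd e" "fst e" g] e assms(3) by simp
    moreover have "act (wprod (e # w)) f = Eop (snd e) (fst e) (act (wprod w) f)"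
      using e by (intro act_wprod_Cons) auto
    ultimately show ?case
      by (simp only: lin_0[OF lin_Eop] vscale_zero)
  qed
  moreover have "r < fst e \<and> fst e < snd e \<and> snd e < N" if "e \<in> set w" for e
    using step.hyps(1) words_ge[OF step.hyps(1) that] that assms(2) by (auto simp: words_def)
  ultimately have "Eop r (Suc r) (act (wprod w) f) = 0" by blast
  with step.IH show ?case
    by (simp only: act_plus act_mult act_scalar lin_add[OF lin_Eop] lin_vscale[OF lin_Eop]
        vscale_zero add_0_left)
qed

text \<open>The bracket of \<open>E r (Suc r)\<close> with \<open>E (Suc r) a\<close> is
  \<open>E r a\<close>, so component r + 1 is transported to index r, while all other components are
  raised in place. Since the result is again a combination of lowering operators of column a,
  freeness applies to each index.\<close>

lemma raise_components:
  assumes U: "\<And>i. i \<in> {a<..b} \<Longrightarrow> SL i b (U i) (C i)" and "a < r" "r < b" "b < N"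
    and eq: "Eop r (Suc r) (act (\<Sum>i\<in>{a<..b}. E i a * U i) vac) = 0"
  shows "\<And>i. i \<in> {a<..b} \<Longrightarrow> i \<noteq> r \<Longrightarrow> Eop r (Suc r) (act (U i) vac) = 0"
    and "act (U (Suc r)) vac = - Eop r (Suc r) (act (U r) vac)"
proof -
  define F where "F i = act (U i) vac" for i
  define g where "g i = eps2 (r, Suc r) (i, a) \<star> Eop r (Suc r) (F i) + (if i = r then F (Suc r) else 0)" for i
  have "Eop i a (g i) = Eop r (Suc r) (Eop i a (F i)) - (if i = Suc r then Eop r a (F (Suc r)) else 0)
      + (if i = r then Eop r a (F (Suc r)) else 0)" if "i \<in> {a<..b}" for i
  proof -
    have "Eop r (Suc r) (Eop i a (F i)) = eps2 (r, Suc r) (i, a) \<star> Eop i a (Eop r (Suc r) (F i))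
        + (if i = Suc r then Eop r a (F (Suc r)) else 0)"
      using Eop_commute[of r "Suc r" i a "F i"] assms(2-4) that by (auto simp: eq_commute)
    moreover have "Eop i a (g i) = eps2 (r, Suc r) (i, a) \<star> Eop i a (Eop r (Suc r) (F i))
        + (if i = r then Eop r a (F (Suc r)) else 0)"
      by (simp add: g_def lin_add[OF lin_Eop] lin_vscale[OF lin_Eop] lin_0[OF lin_Eop])
    ultimately show ?thesis by (simp only: add_diff_cancel_right')
  qed
  then have "(\<Sum>i\<in>{a<..b}. Eop i a (g i)) = (\<Sum>i\<in>{a<..b}. Eop r (Suc r) (Eop i a (F i)))
      - (\<Sum>i\<in>{a<..b}. if i = Suc r then Eop r a (F (Suc r)) else 0)
      + (\<Sum>i\<in>{a<..b}. if i = r then Eop r a (F (Suc r)) else 0)"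
    by (simp add: sum.distrib sum_subtractf)
  also have "\<dots> = (\<Sum>i\<in>{a<..b}. Eop r (Suc r) (Eop i a (F i)))"
    using assms(2-3) by simp
  also have "\<dots> = 0"
    using eq by (simp only: act_peeled[OF assms(4)] lin_sum[OF lin_Eop] F_def)
  finally have sum0: "(\<Sum>i\<in>{a<..b}. Eop i a (g i)) = 0" .
  have col: "col_vac a (F i)" if "i \<in> {a<..b}" for i
    using SL_col_vac[OF U[OF that]] that by (simp add: F_def)
  have g0: "g i = 0" if i: "i \<in> {a<..b}" for i
  proof (rule free_interval[OF _ assms(4) _ _ sum0 i])
    show "a < b" using assms by simp
    show "col_vac a (g i)" if "i \<in> {a<..b}" for i
      unfolding g_def using assms(2,3) that
      by (intro col_vac_add col_vac_vscale col_vac_Eop) (auto simp: col_vac_0 intro: col)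
    show "bounded (g i)" if "i \<in> {a<..b}" for i
      unfolding g_def F_def using assms(2-4)
      by (intro bounded_add bounded_vscale bounded_Eop) (auto simp: bounded_0 bounded_act_vac)
  qed
  show "Eop r (Suc r) (act (U i) vac) = 0" if "i \<in> {a<..b}" "i \<noteq> r" for i
  proof -
    have "eps2 (r, Suc r) (i, a) \<star> Eop r (Suc r) (F i) = 0"
      using g0[OF that(1)] that(2) by (simp only: g_def if_False simp_thms add_0_right)
    moreover have "eps2 (r, Suc r) (i, a) \<noteq> 0" by (simp add: eps2_def)
    ultimately show ?thesis by (simp only: vscale_eq_0_iff F_def) simp
  qed
  have "eps2 (r, Suc r) (r, a) = 1"
    using assms(2) by (auto simp: eps2_def fer_def)
  then have "Eop r (Suc r) (F r) + F (Suc r) = 0"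
    using g0[of r] assms(2,3) by (simp only: g_def if_True simp_thms vscale_one) auto
  then show "act (U (Suc r)) vac = - Eop r (Suc r) (act (U r) vac)"
    by (simp only: F_def add_eq_0_iff)
qed

text \<open>The restriction to r strictly between a and b is what component a + 1 inherits: the
  operator with r = a + 1 does not annihilate it in general but produces component a + 2 from it.
  Once component a + 1 vanishes, the later ones vanish in turn.\<close>

lemma SL_unique:
  assumes "SL a b u 0" "a \<le> b" "b < N" "\<And>r. a < r \<Longrightarrow> r < b \<Longrightarrow> Eop r (Suc r) (act u vac) = 0"
  shows "act u vac = 0"
  using assms
proof (induction "b - a" arbitrary: a u rule: less_induct)
  case less
  show ?case
  proof (cases "a = b")
    case True
    then show ?thesis using SL_same[of a u 0] less.prems by simp
  next
    case False
    with less.prems have ab: "a < b" by simp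
    obtain U C where UC: "\<And>i. i \<in> {a<..b} \<Longrightarrow> SL i b (U i) (C i)" "C (Suc a) = 0"
      "u = (\<Sum>i\<in>{a<..b}. E i a * U i)"
      using peel[OF less.prems(1) ab] by metis
    have "act (U (a + Suc n)) vac = 0" if "a + Suc n \<le> b" for n
      using that
    proof (induction n)
      case 0
      have "act (U (Suc a)) vac = 0"
      proof (rule less.hyps)
        show "SL (Suc a) b (U (Suc a)) 0" using UC(1)[of "Suc a"] UC(2) ab by simp
        show "Eop r (Suc r) (act (U (Suc a)) vac) = 0" if "Suc a < r" "r < b" for r
          by (rule raise_components(1)[OF UC(1) _ that(2) less.prems(3)])
            (use that less.prems(4)[of r] UC(3) ab in auto)
      qed (use ab less.prems(3) in auto)
      then show ?case by simp
    next
      case (Suc n)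
      have "act (U (Suc (a + Suc n))) vac = - Eop (a + Suc n) (Suc (a + Suc n)) (act (U (a + Suc n)) vac)"
        by (rule raise_components(2)[OF UC(1) _ _ less.prems(3)])
          (use Suc.prems less.prems(4)[of "a + Suc n"] UC(3) in auto)
      moreover have "act (U (a + Suc n)) vac = 0"
        using Suc.prems by (intro Suc.IH) simp
      ultimately show ?case
        by (simp only: lin_0[OF lin_Eop] neg_0_equal_iff_equal add_Suc_right minus_zero)
    qed
    then have "act (U i) vac = 0" if "i \<in> {a<..b}" for i
      using that[unfolded greaterThanAtMost_iff] by (metis less_imp_Suc_add add_Suc_right)
    then show ?thesis
      by (simp only: UC(3) act_peeled[OF less.prems(3)]) (simp add: lin_0[OF lin_Eop])
  qed
qed

text \<open>Comparing the equations for \<open>E s (s+1)\<close> and for \<open>r > s\<close> shows that component i of u is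
  \<open>\<kappa> + lam\<^sub>s - lam\<^sub>s\<^sub>+\<^sub>1 + 1\<close> times component i of the singular vector \<open>U (s+1)\<close>, and that this scalar
  plays the role of \<open>\<kappa>\<close> there.\<close>

lemma odd_component_nonzero:
  assumes "s < M" "M \<le> b" "b < N"
    and "\<And>i. i \<in> {s<..b} \<Longrightarrow> SL i b (U i) (C i)" "C (Suc s) = 1" "u = (\<Sum>i\<in>{s<..b}. E i s * U i)"
    and "\<And>r. s < r \<Longrightarrow> r < b \<Longrightarrow> Eop r (Suc r) (act u vac) = 0"
    and "Suc s < M \<Longrightarrow> Eop s (Suc s) (act u vac) = - (\<kappa> \<star> act (U (Suc s)) vac)"
    and "\<And>j. s < j \<Longrightarrow> j < M \<Longrightarrow> \<kappa> + lam $ ix s - lam $ ix j + of_nat (j - s) \<noteq> 0"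
  shows "act (U M) vac \<noteq> 0"
  using assms
proof (induction "M - s" arbitrary: s u U C \<kappa> rule: less_induct)
  case less
  note prems = less.prems
  let ?s = "Suc s"
  have sb: "s < b" using prems(1,2) by simp
  show ?case
  proof (cases "?s = M")
    case True
    then show ?thesis
      \<comment> \<open>At the last even index the component at M is the one that carries the
        leading coefficient 1.\<close>
      using SL_inj[of M b "U M" "C M"] prems(4)[of M] prems(2,3,5) True sb by auto
  next
    case False
    then have sM: "?s < M" using prems(1) by simp
    define F where "F i = act (U i) vac" for i
    have sb': "?s < b" using sM prems(2) by simp
    obtain U' C' where UC': "\<And>i. i \<in> {?s<..b} \<Longrightarrow> SL i b (U' i) (C' i)" "C' (Suc ?s) = C ?s"
      "U ?s = (\<Sum>i\<in>{?s<..b}. E i ?s * U' i)"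
      using peel[of ?s b "U ?s" "C ?s"] prems(4)[of ?s] sb' by auto
    define F' where "F' i = act (U' i) vac" for i
    \<comment> \<open>The summand 1 arises because \<open>U (Suc s)\<close> lowers coordinate s + 1
      by one.\<close>
    define h where "h = lam $ ix s - lam $ ix ?s + 1"
    have SLs: "SL ?s b (U ?s) (C ?s)" using prems(4)[of ?s] sb' by simp
    have low: "Eop s ?s (F i) = 0" if "i \<in> {s<..b}" for i
      unfolding F_def using that prems(3) sb' Eop_upper_vac[of s ?s]
      by (intro SL_raise_below[OF prems(4)]) auto
    \<comment> \<open>\<open>E s (Suc s)\<close> kills the components, so only its bracket with
      \<open>E i s\<close> remains.\<close>
    have trm: "Eop s ?s (Eop i s (F i)) = (if i = ?s then Eop s s (F ?s) else 0) - Eop i ?s (F i)"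
      if "i \<in> {s<..b}" for i
    proof -
      have eps: "eps2 (s, ?s) (i, s) = 1" using sM by (simp add: eps2_def fer_def)
      have eq: "Eop s ?s (Eop i s (F i)) = eps2 (s, ?s) (i, s) \<star> Eop i s (Eop s ?s (F i))
          + (if ?s = i then Eop s s (F i) else 0) - (if s = s then eps2 (s, ?s) (i, s) \<star> Eop i ?s (F i) else 0)"
        using that prems(3) sb by (intro Eop_commute) auto
      show ?thesis
        unfolding eq eps low[OF that] lin_0[OF lin_Eop] vscale_one add_0_left by simp
    qed
    have "- (\<kappa> \<star> F ?s) = Eop s ?s (act u vac)"
      using prems(8)[OF sM] by (simp only: F_def)
    also have "\<dots> = (\<Sum>i\<in>{s<..b}. Eop s ?s (Eop i s (F i)))"
      by (simp only: prems(6) act_peeled[OF prems(3)] lin_sum[OF lin_Eop] F_def)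
    also have "\<dots> = (\<Sum>i\<in>{s<..b}. if i = ?s then Eop s s (F ?s) else 0) - (\<Sum>i\<in>{s<..b}. Eop i ?s (F i))"
      by (simp add: trm sum_subtractf)
    also have "{s<..b} = insert ?s {?s<..b}" using sb by auto
    also have "(\<Sum>i\<in>insert ?s {?s<..b}. Eop i ?s (F i)) = Eop ?s ?s (F ?s) + (\<Sum>i\<in>{?s<..b}. Eop i ?s (F i))"
      by simp
    also have "(\<Sum>i\<in>insert ?s {?s<..b}. if i = ?s then Eop s s (F ?s) else 0) = Eop s s (F ?s)"
      by simp
    also have "Eop s s (F ?s) = lam $ ix s \<star> F ?s"
      unfolding F_def using SL_weight[OF _ SLs, of s vac "lam $ ix s"] prems(3) sb sb' Eop_diag_vac[of s]
      by (simp add: vac_wt_eq)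
    also have "Eop ?s ?s (F ?s) = (lam $ ix ?s - 1) \<star> F ?s"
      unfolding F_def using SL_weight[OF _ SLs, of ?s vac "lam $ ix ?s"] prems(3) sb' Eop_diag_vac[of ?s]
      by (simp add: vac_wt_eq)
    finally have "(\<Sum>i\<in>{?s<..b}. Eop i ?s (F i)) = (h + \<kappa>) \<star> F ?s"
      unfolding h_def by (simp add: fun_eq_iff) (simp add: algebra_simps)
    also have "F ?s = (\<Sum>i\<in>{?s<..b}. Eop i ?s (F' i))"
      by (simp only: F_def F'_def UC'(3) act_peeled[OF prems(3)])
    finally have sumF: "(\<Sum>i\<in>{?s<..b}. Eop i ?s (F i - (h + \<kappa>) \<star> F' i)) = 0"
      by (simp only: lin_diff[OF lin_Eop] lin_vscale[OF lin_Eop] sum_subtractf vscale_sum diff_self)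
    have comp: "F i - (h + \<kappa>) \<star> F' i = 0" if "i \<in> {?s<..b}" for i
    proof (rule free_interval[OF sb' prems(3) _ _ sumF that])
      show "col_vac ?s (F i - (h + \<kappa>) \<star> F' i)" if "i \<in> {?s<..b}" for i
      proof -
        have "col_vac ?s (F i + (- (h + \<kappa>)) \<star> F' i)"
          unfolding F_def F'_def using that SL_col_vac[OF UC'(1)[OF that]] SL_col_vac[OF prems(4)[of i]]
          by (intro col_vac_add col_vac_vscale) auto
        moreover have "F i + (- (h + \<kappa>)) \<star> F' i = F i - (h + \<kappa>) \<star> F' i"
          by (simp add: fun_eq_iff algebra_simps)
        ultimately show ?thesis by (simp only:)
      qed
      have "bounded (F i + (- (h + \<kappa>)) \<star> F' i)" for i
        unfolding F_def F'_def by (intro bounded_add bounded_vscale bounded_act_vac)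
      moreover have "F i + (- (h + \<kappa>)) \<star> F' i = F i - (h + \<kappa>) \<star> F' i" for i
        by (simp add: fun_eq_iff algebra_simps)
      ultimately show "bounded (F i - (h + \<kappa>) \<star> F' i)" for i
        by (simp only:)
    qed
    have comp': "act (U i) vac = (h + \<kappa>) \<star> act (U' i) vac" if "i \<in> {?s<..b}" for i
      using comp[OF that] by (simp only: F_def F'_def right_minus_eq)
    have "h + \<kappa> \<noteq> 0"
      using prems(9)[of ?s] sM by (simp add: h_def algebra_simps)
    moreover have "act (U' M) vac \<noteq> 0"
    proof (rule less.hyps)
      show "M - ?s < M - s" using sM by simp
      show "C' (Suc ?s) = 1" using UC'(2) prems(5) by simp
      show "Eop r (Suc r) (act (U ?s) vac) = 0" if "?s < r" "r < b" for r
        by (rule raise_components(1)[OF prems(4) _ that(2) prems(3)])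
          (use that prems(7)[of r] prems(6) in auto)
      have "act (U (Suc ?s)) vac = - Eop ?s (Suc ?s) (act (U ?s) vac)"
        by (rule raise_components(2)[OF prems(4) _ sb' prems(3)])
          (use sb' prems(7)[of ?s] prems(6) in auto)
      then show "Eop ?s (Suc ?s) (act (U ?s) vac) = - ((h + \<kappa>) \<star> act (U' (Suc ?s)) vac)"
        using comp'[of "Suc ?s"] sb' by (simp only: greaterThanAtMost_iff) (metis Suc_leI lessI minus_minus)
      \<comment> \<open>The scalars telescope: \<open>h + \<kappa> + lam $ ix ?s\<close> equals
        \<open>\<kappa> + lam $ ix s + 1\<close>, so the condition for j keeps its value from step
        to step.\<close>
      show "h + \<kappa> + lam $ ix ?s - lam $ ix j + of_nat (j - ?s) \<noteq> 0" if "?s < j" "j < M" for j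
      proof -
        have "of_nat (j - s) = (of_nat (j - ?s) + 1 :: 'k)"
          using that by (simp add: of_nat_diff)
        then show ?thesis
          using prems(9)[of j] that by (simp add: h_def algebra_simps)
      qed
    qed (use prems(2,3) sM UC' in auto)
    ultimately show ?thesis
      using comp'[of M] sM prems(2) by (simp add: vscale_eq_0_iff)
  qed
qed

text \<open>Expanded, this is a sum over the increasing paths from s to e, in which every skipped
  index l contributes the factor \<kappa> l. With the scalars of \<open>low_op_raise\<close> it is a
  lowering operator in the style of Nagel and Moshinsky, evaluated on a weight vector.\<close>

function low_op :: "(nat \<Rightarrow> 'k) \<Rightarrow> nat \<Rightarrow> nat \<Rightarrow> ('k, 'm, 'n) Ugl" where
  "low_op \<kappa> e s =
     (if s < e then \<Sum>i\<in>{s<..e}. ug_scalar (\<Prod>l\<in>{s<..<i}. \<kappa> l) * (E i s * low_op \<kappa> e i) else 1)"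
  by pat_completeness auto
termination
  by (relation "Wellfounded.measure (\<lambda>(\<kappa>, e, s). e - s)") auto

declare low_op.simps [simp del]

lemma SL_low_op: "s \<le> e \<Longrightarrow> e < N \<Longrightarrow> SL s e (low_op \<kappa> e s) 1"
proof (induction "e - s" arbitrary: s rule: less_induct)
  case less
  show ?case
  proof (cases "s = e")
    case True
    then show ?thesis by (simp add: low_op.simps SL_one)
  next
    case False
    then have se: "s < e" using less.prems by simp
    have "SL s e (\<Sum>i\<in>{s<..e}. ug_scalar (\<Prod>l\<in>{s<..<i}. \<kappa> l) * (E i s * low_op \<kappa> e i))
       (\<Sum>i\<in>{s<..e}. (\<Prod>l\<in>{s<..<i}. \<kappa> l) * (of_bool (i = Suc s) * 1))"
    proof (intro SL_sum SL_scale SL_mult(1))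
      fix i assume "i \<in> {s<..e}"
      then have i: "s < i" "i \<le> e" by auto
      then show "SL s i (E i s) (of_bool (i = Suc s))"
        using less.prems by (intro SL_E) auto
      show "SL i e (low_op \<kappa> e i) 1"
        using i less.prems by (intro less.hyps) auto
    qed
    also have "(\<Sum>i\<in>{s<..e}. (\<Prod>l\<in>{s<..<i}. \<kappa> l) * (of_bool (i = Suc s) * 1)) =
        (\<Sum>i\<in>{s<..e}. if i = Suc s then 1 else 0)"
    proof (intro sum.cong refl)
      fix i
      have "{s<..<Suc s} = {}" by auto
      then show "(\<Prod>l\<in>{s<..<i}. \<kappa> l) * (of_bool (i = Suc s) * 1) = (if i = Suc s then 1 else 0)"
        by simp
    qed
    also have "\<dots> = 1" using se by simp
    finally show ?thesis using se by (simp add: low_op.simps[of \<kappa> e s])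
  qed
qed

text \<open>The weights of the paths are made for cancellation: for r > s the paths through r and
  those skipping r contribute opposite terms. For r = s the terms combine to a multiple of the next
  operator. The condition on the block keeps all \<open>E i s\<close> even, hence free of
  signs.\<close>

lemma low_op_raise:
  assumes w: "\<And>r. Suc r < N \<Longrightarrow> Eop r (Suc r) w = 0"
    and wt: "\<And>j. j \<le> e \<Longrightarrow> Eop j j w = \<mu> j \<star> w"
    and \<kappa>: "\<And>j. j < e \<Longrightarrow> \<kappa> j = - (\<mu> j - \<mu> e + of_nat (e - 1 - j))"
    and "s \<le> e" "e < N" and block: "e < M \<or> M \<le> s"
  shows "\<And>r. Suc r < N \<Longrightarrow> r \<noteq> s \<Longrightarrow> Eop r (Suc r) (act (low_op \<kappa> e s) w) = 0"
    and "s < e \<Longrightarrow> Eop s (Suc s) (act (low_op \<kappa> e s) w) = - (\<kappa> s \<star> act (low_op \<kappa> e (Suc s)) w)"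
proof -
  define W where "W i = act (low_op \<kappa> e i) w" for i
  define P where "P s i = (\<Prod>l\<in>{s<..<i}. \<kappa> l)" for s i
  have empty_interval: "{s<..<Suc s} = {}" for s :: nat by auto
  have We: "W e = w" by (simp add: W_def low_op.simps)
  have W_eq: "W s = (\<Sum>i\<in>{s<..e}. P s i \<star> Eop i s (W i))" if "s < e" for s
  proof -
    have "W s = (\<Sum>i\<in>{s<..e}. act (ug_scalar (P s i) * (E i s * low_op \<kappa> e i)) w)"
      using that unfolding W_def P_def by (subst low_op.simps) (simp add: act_sum)
    also have "\<dots> = (\<Sum>i\<in>{s<..e}. P s i \<star> Eop i s (W i))"
      using that assms(5) by (intro sum.cong refl) (simp add: act_mult act_E W_def)
    finally show ?thesis .
  qed
  have below: "Eop r (Suc r) (W i) = 0" if "r < i" "i \<le> e" for r i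
    unfolding W_def using that assms(5) w[of r] by (intro SL_raise_below[OF SL_low_op]) auto
  have wt_W: "Eop j j (W i) = (\<mu> j - of_bool (j = i) + of_bool (j = e)) \<star> W i" if "i \<le> e" "j \<le> e" for i j
    unfolding W_def using that assms(5) wt[of j] by (intro SL_weight[OF _ SL_low_op]) auto
  have "(\<forall>r. Suc r < N \<longrightarrow> r \<noteq> s \<longrightarrow> Eop r (Suc r) (W s) = 0) \<and>
      (s < e \<longrightarrow> Eop s (Suc s) (W s) = - (\<kappa> s \<star> W (Suc s)))"
    using assms(4) block
  proof (induction "e - s" arbitrary: s rule: less_induct)
    case less
    show ?case
    proof (cases "s = e")
      case True
      then show ?thesis using w by (simp add: We)
    next
      case False
      then have se: "s < e" using less.prems by simp
      have IH: "Eop r (Suc r) (W i) = 0" if "s < i" "i \<le> e" "Suc r < N" "r \<noteq> i" for r i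
        using less.hyps[of i] that less.prems by auto
      have IH': "Eop i (Suc i) (W i) = - (\<kappa> i \<star> W (Suc i))" if "s < i" "i < e" for i
        using less.hyps[of i] that less.prems by auto
      have raise: "Eop r (Suc r) (W s) = 0" if r: "Suc r < N" "r \<noteq> s" for r
      proof (cases "r < s")
        case True
        then show ?thesis using below less.prems(1) by simp
      next
        case False
        then have sr: "s < r" using r by simp
        have trm: "P s i \<star> Eop r (Suc r) (Eop i s (W i)) =
            (if i = r then if r < e then - ((P s r * \<kappa> r) \<star> Eop r s (W (Suc r))) else 0 else 0)
            + (if i = Suc r then P s (Suc r) \<star> Eop r s (W (Suc r)) else 0)"
          if i: "i \<in> {s<..e}" for i
        proof -
          have "Eop r (Suc r) (Eop i s (W i)) = eps2 (r, Suc r) (i, s) \<star> Eop i s (Eop r (Suc r) (W i))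
              + (if i = Suc r then Eop r s (W (Suc r)) else 0)"
            using Eop_commute[of r "Suc r" i s "W i"] i r sr assms(5) by (auto simp: eq_commute)
          moreover have "eps2 (r, Suc r) (i, s) = 1"
            using i less.prems by (auto simp: eps2_def fer_def)
          moreover have "Eop i s (Eop r (Suc r) (W i)) =
              (if i = r then if r < e then - (\<kappa> r \<star> Eop r s (W (Suc r))) else 0 else 0)"
          proof (cases "i = r")
            case True
            show ?thesis
            proof (cases "r < e")
              case True
              then show ?thesis
                using IH'[OF sr] \<open>i = r\<close>
                by (simp only: if_True simp_thms lin_uminus[OF lin_Eop] lin_vscale[OF lin_Eop])
            next
              case False
              then have "r = e" using i \<open>i = r\<close> by simp
              then show ?thesis
                using w[OF r(1)] \<open>i = r\<close> We
                by (simp only: lin_0[OF lin_Eop] less_irrefl if_False if_True simp_thms)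
            qed
          next
            case False
            then show ?thesis
              using IH[of i r] i r(1)
              by (simp only: lin_0[OF lin_Eop] if_False simp_thms greaterThanAtMost_iff)
          qed
          ultimately show ?thesis
            by (auto simp: fun_eq_iff algebra_simps)
        qed
        have "Eop r (Suc r) (W s) = (\<Sum>i\<in>{s<..e}. P s i \<star> Eop r (Suc r) (Eop i s (W i)))"
          by (simp only: W_eq[OF se] lin_sum[OF lin_Eop] lin_vscale[OF lin_Eop])
        also have "\<dots> = (\<Sum>i\<in>{s<..e}.
            (if i = r then if r < e then - ((P s r * \<kappa> r) \<star> Eop r s (W (Suc r))) else 0 else 0)
            + (if i = Suc r then P s (Suc r) \<star> Eop r s (W (Suc r)) else 0))"
          by (rule sum.cong[OF refl trm])
        also have "\<dots> = (if r < e then - ((P s r * \<kappa> r) \<star> Eop r s (W (Suc r))) else 0)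
            + (if r < e then P s (Suc r) \<star> Eop r s (W (Suc r)) else 0)"
          using sr by (simp add: sum.distrib Suc_le_eq)
        \<comment> \<open>Skipping r costs exactly the factor that raising at r produces, with the
          opposite sign.\<close>
        also have "P s (Suc r) = P s r * \<kappa> r"
        proof -
          have "{s<..<Suc r} = insert r {s<..<r}" using sr by auto
          then show ?thesis by (simp add: P_def mult.commute)
        qed
        finally show ?thesis
          by (cases "r < e") (simp_all only: if_True if_False simp_thms left_minus add_0_left)
      qed
      moreover have "Eop s (Suc s) (W s) = - (\<kappa> s \<star> W (Suc s))"
      proof -
        let ?s = "Suc s"
        have trm: "P s i \<star> Eop s ?s (Eop i s (W i)) =
            (if i = ?s then Eop s s (W ?s) else 0) - P s i \<star> Eop i ?s (W i)" if i: "i \<in> {s<..e}" for i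
        proof -
          have eps: "eps2 (s, ?s) (i, s) = 1"
            using i less.prems by (auto simp: eps2_def fer_def)
          have low: "Eop s ?s (W i) = 0"
            using below[of s i] i by simp
          have eq: "Eop s ?s (Eop i s (W i)) = eps2 (s, ?s) (i, s) \<star> Eop i s (Eop s ?s (W i))
             + (if ?s = i then Eop s s (W i) else 0) - (if s = s then eps2 (s, ?s) (i, s) \<star> Eop i ?s (W i) else 0)"
            using i se assms(5) by (intro Eop_commute) auto
          have "P s ?s = 1" by (simp add: P_def empty_interval)
          then show ?thesis
            unfolding eq eps low lin_0[OF lin_Eop] vscale_one add_0_left by (simp add: vscale_diff)
        qed
        have "Eop s ?s (W s) = (\<Sum>i\<in>{s<..e}. P s i \<star> Eop s ?s (Eop i s (W i)))"
          by (simp only: W_eq[OF se] lin_sum[OF lin_Eop] lin_vscale[OF lin_Eop])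
        also have "\<dots> = (\<Sum>i\<in>{s<..e}. (if i = ?s then Eop s s (W ?s) else 0) - P s i \<star> Eop i ?s (W i))"
          by (rule sum.cong[OF refl trm])
        also have "\<dots> = (\<Sum>i\<in>{s<..e}. if i = ?s then Eop s s (W ?s) else 0)
            - (\<Sum>i\<in>{s<..e}. P s i \<star> Eop i ?s (W i))"
          by (rule sum_subtractf)
        also have "{s<..e} = insert ?s {?s<..e}" using se by auto
        also have "(\<Sum>i\<in>insert ?s {?s<..e}. if i = ?s then Eop s s (W ?s) else 0) = Eop s s (W ?s)"
          by simp
        also have "(\<Sum>i\<in>insert ?s {?s<..e}. P s i \<star> Eop i ?s (W i)) =
            Eop ?s ?s (W ?s) + (\<Sum>i\<in>{?s<..e}. P s i \<star> Eop i ?s (W i))"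
          by (simp add: P_def empty_interval)
        also have "(\<Sum>i\<in>{?s<..e}. P s i \<star> Eop i ?s (W i)) = (if ?s < e then \<kappa> ?s else 0) \<star> W ?s"
        proof (cases "?s < e")
          case True
          have "P s i = \<kappa> ?s * P ?s i" if "i \<in> {?s<..e}" for i
          proof -
            have "{s<..<i} = insert ?s {?s<..<i}" using that by auto
            then show ?thesis by (simp add: P_def)
          qed
          then have "(\<Sum>i\<in>{?s<..e}. P s i \<star> Eop i ?s (W i)) = \<kappa> ?s \<star> (\<Sum>i\<in>{?s<..e}. P ?s i \<star> Eop i ?s (W i))"
            by (simp add: vscale_sum)
          then show ?thesis
            using True by (simp only: W_eq[OF True] if_True simp_thms)
        next
          case False
          then show ?thesis using se by simp
        qed
        also have "Eop s s (W ?s) = \<mu> s \<star> W ?s"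
          using wt_W[of ?s s] se by simp
        also have "Eop ?s ?s (W ?s) = (\<mu> ?s - 1 + of_bool (?s = e)) \<star> W ?s"
          using wt_W[of ?s ?s] se by simp
        finally have *: "Eop s ?s (W s) = \<mu> s \<star> W ?s -
            ((\<mu> ?s - 1 + of_bool (?s = e)) \<star> W ?s + (if ?s < e then \<kappa> ?s else 0) \<star> W ?s)" .
        \<comment> \<open>This recursion, started at e - 1, is the origin of the formula for
          \<kappa>. The correction at \<open>?s = e\<close> reflects that \<open>W e\<close> is w
          itself, whose coordinate e has not been changed.\<close>
        have "\<mu> s - ((\<mu> ?s - 1 + of_bool (?s = e)) + (if ?s < e then \<kappa> ?s else 0)) = - \<kappa> s"
        proof (cases "?s = e")
          case True
          then show ?thesis using \<kappa>[OF se] by auto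
        next
          case False
          then have "?s < e" using se by simp
          define k where "k = (of_nat (e - 1 - ?s) :: 'k)"
          have "of_nat (e - 1 - s) = k + 1"
            using \<open>?s < e\<close> by (simp add: k_def of_nat_diff)
          then have "\<kappa> s = - (\<mu> s - \<mu> e + (k + 1))" "\<kappa> ?s = - (\<mu> ?s - \<mu> e + k)"
            using \<kappa>[OF se] \<kappa>[OF \<open>?s < e\<close>] by (simp_all only: k_def)
          then show ?thesis using False \<open>?s < e\<close> by simp
        qed
        then have "\<mu> s \<star> W ?s - ((\<mu> ?s - 1 + of_bool (?s = e)) \<star> W ?s + (if ?s < e then \<kappa> ?s else 0) \<star> W ?s)
            = (- \<kappa> s) \<star> W ?s"
          by (simp only: add_vscale[symmetric] vscale_diff_left)
        with * show ?thesis by (simp only: vscale_uminus_left)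
      qed
      ultimately show ?thesis by blast
    qed
  qed
  then show "\<And>r. Suc r < N \<Longrightarrow> r \<noteq> s \<Longrightarrow> Eop r (Suc r) (act (low_op \<kappa> e s) w) = 0"
    and "s < e \<Longrightarrow> Eop s (Suc s) (act (low_op \<kappa> e s) w) = - (\<kappa> s \<star> act (low_op \<kappa> e (Suc s)) w)"
    unfolding W_def by blast+
qed

text \<open>The condition on \<mu> says that \<kappa> vanishes at s. Shifted by rho, it says that
  the weight of w pairs to 1 with the coroot of the root (s, e), so subtracting that root once is
  the reflection of the shifted weight.\<close>

lemma even_singular:
  assumes "\<And>r. Suc r < N \<Longrightarrow> Eop r (Suc r) w = 0" "\<And>j. j \<le> e \<Longrightarrow> Eop j j w = \<mu> j \<star> w"
    and "s < e" "e < N" "e < M \<or> M \<le> s" "\<mu> s - \<mu> e + of_nat (e - 1 - s) = 0"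
  obtains Z where "SL s e Z 1" "\<And>r. Suc r < N \<Longrightarrow> Eop r (Suc r) (act Z w) = 0"
proof
  let ?\<kappa> = "\<lambda>j. - (\<mu> j - \<mu> e + of_nat (e - 1 - j))"
  show "SL s e (low_op ?\<kappa> e s) 1" using assms by (intro SL_low_op) auto
  show "Eop r (Suc r) (act (low_op ?\<kappa> e s) w) = 0" if "Suc r < N" for r
  proof (cases "r = s")
    case True
    have "Eop s (Suc s) (act (low_op ?\<kappa> e s) w) = - (?\<kappa> s \<star> act (low_op ?\<kappa> e (Suc s)) w)"
      using assms by (intro low_op_raise(2)[where \<mu> = \<mu>]) auto
    moreover have "?\<kappa> s = 0" using assms(6) by simp
    ultimately show ?thesis
      using True by (simp only: vscale_zero minus_zero)
  next
    case False
    then show ?thesis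
      using assms that by (intro low_op_raise(1)[where \<mu> = \<mu>]) auto
  qed
qed

section \<open>Roots and weights\<close>

definition eroot :: "nat \<times> nat \<Rightarrow> ('k, 'm, 'n) wt" where
  "eroot e = axis (ix (fst e)) 1 - axis (ix (snd e)) 1"

lemma eroot_nth:
  assumes "i < N" "fst e < N" "snd e < N"
  shows "eroot e $ ix i = of_bool (i = fst e) - of_bool (i = snd e)"
  using assms by (auto simp: eroot_def axis_def ix_eq)

lemma wt_eqI: "(\<And>i. i < N \<Longrightarrow> \<mu> $ ix i = \<nu> $ ix i) \<Longrightarrow> \<mu> = \<nu>" for \<mu> \<nu> :: "('k, 'm, 'n) wt"
  using ix_surj[where 'm = 'm and 'n = 'n] N_def by (metis vec_eq_iff)

lemma eroot_inj:
  assumes "fst e < snd e" "snd e < N" "fst d < snd d" "snd d < N" "eroot e = eroot d"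
  shows "e = d"
proof -
  have eq: "(of_bool (i = fst e) - of_bool (i = snd e) :: 'k) = of_bool (i = fst d) - of_bool (i = snd d)"
    if "i < N" for i
    using eroot_nth[of i e] eroot_nth[of i d] that assms by simp
  have "of_int (of_bool (i = fst e) - of_bool (i = snd e)) =
      (of_int (of_bool (i = fst d) - of_bool (i = snd d)) :: 'k)" if "i < N" for i
    using eq[OF that] by (simp only: of_int_diff of_int_of_bool)
  then have *: "of_bool (i = fst e) - of_bool (i = snd e) = (of_bool (i = fst d) - of_bool (i = snd d) :: int)"
    if "i < N" for i
    using that by (simp only: of_int_eq_iff)
  have "fst e = fst d"
    using *[of "fst e"] assms(1,2) by (cases "fst e = fst d"; cases "fst e = snd d") simp_all
  moreover have "snd e = snd d"
    using *[of "snd e"] assms(1,2) by (cases "snd e = fst d"; cases "snd e = snd d") simp_all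
  ultimately show ?thesis by (rule prod_eqI)
qed

lemma sum_list_eroot_nth:
  assumes "i < N" "\<And>e. e \<in> set w \<Longrightarrow> fst e < snd e \<and> snd e < N"
  shows "sum_list (map eroot w) $ ix i = of_int (ewt w i)"
  using assms(2)
proof (induction w)
  case (Cons e w)
  have "fst e < snd e" "snd e < N" using Cons.prems[of e] by simp_all
  then have "fst e < N" by linarith
  then show ?case using Cons assms(1) eroot_nth[of i e] \<open>snd e < N\<close> by simp
qed simp

lemma ewt_ge:
  "(\<And>e. e \<in> set w \<Longrightarrow> fst e < snd e \<and> snd e < N) \<Longrightarrow> N \<le> i \<Longrightarrow> ewt w i = 0"
proof (induction w)
  case (Cons e w)
  have "fst e < snd e" "snd e < N" using Cons.prems(1)[of e] by simp_all
  then have "i \<noteq> fst e" "i \<noteq> snd e" using Cons.prems(2) by linarith+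
  then show ?case using Cons by simp
qed simp

text \<open>Passage between weights over the field and the integer weights of words; in
  characteristic 0 the integral coordinates can be compared as integers.\<close>

lemma words_iff_eroot:
  assumes "a < N" "b < N"
  shows "w \<in> words N a b \<longleftrightarrow>
    (\<forall>e\<in>set w. fst e < snd e \<and> snd e < N) \<and>
    sum_list (map eroot w) = axis (ix a) 1 - axis (ix b) 1"
proof (cases "\<forall>e\<in>set w. fst e < snd e \<and> snd e < N")
  case True
  have "sum_list (map eroot w) = axis (ix a) 1 - axis (ix b) 1 \<longleftrightarrow>
      (\<forall>i<N. (of_int (ewt w i) :: 'k) = of_bool (i = a) - of_bool (i = b))"
  proof
    assume *: "sum_list (map eroot w) = axis (ix a) 1 - axis (ix b) 1"
    show "\<forall>i<N. (of_int (ewt w i) :: 'k) = of_bool (i = a) - of_bool (i = b)"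
      using True sum_list_eroot_nth[of _ w] eroot_nth[of _ "(a, b)"] assms
      by (simp add: * eroot_def[of "(a, b)", simplified, symmetric])
  next
    assume *: "\<forall>i<N. (of_int (ewt w i) :: 'k) = of_bool (i = a) - of_bool (i = b)"
    have "sum_list (map eroot w) $ ix i = (axis (ix a) 1 - axis (ix b) 1 :: ('k, 'm, 'n) wt) $ ix i"
      if "i < N" for i
      using * that True assms eroot_nth[OF that, of "(a, b)"]
      by (subst sum_list_eroot_nth) (auto simp: eroot_def)
    then show "sum_list (map eroot w) = axis (ix a) 1 - axis (ix b) 1"
      by (rule wt_eqI)
  qed
  also have "\<dots> \<longleftrightarrow> (\<forall>i. ewt w i = of_bool (i = a) - of_bool (i = b))"
  proof -
    have "(of_int (ewt w i) :: 'k) = of_bool (i = a) - of_bool (i = b) \<longleftrightarrow>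
        ewt w i = of_bool (i = a) - of_bool (i = b)" for i
    proof -
      have "(of_bool (i = a) - of_bool (i = b) :: 'k) = of_int (of_bool (i = a) - of_bool (i = b))"
        by simp
      then show ?thesis by (simp only: of_int_eq_iff)
    qed
    moreover have "ewt w i = of_bool (i = a) - of_bool (i = b)" if "\<not> i < N" for i
      using ewt_ge[of w i] True that assms by auto
    ultimately show ?thesis by blast
  qed
  finally show ?thesis using True by (auto simp: words_def)
qed (auto simp: words_def)

section \<open>Positive roots as pairs of indices\<close>

lemma ix_Inl: obtains i where "i < M" "(Inl x :: 'm + 'n) = ix i"
  using Inl_ix[of x, where 'n = 'n] M_def by metis

lemma ix_Inr: obtains i where "M \<le> i" "i < N" "(Inr x :: 'm + 'n) = ix i"
  using Inr_ix[of x, where 'm = 'm] M_def N_def by metis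

lemma ix_less_M: "i < M \<Longrightarrow> \<exists>x. (ix i :: 'm + 'n) = Inl x"
  by (simp add: ix_def M_def)

lemma ix_ge_M: "M \<le> i \<Longrightarrow> \<exists>x. (ix i :: 'm + 'n) = Inr x"
  by (simp add: ix_def M_def)

lemma M_less_N: "M \<le> N"
  by (simp add: M_def N_def)

lemma even_pos_roots_eq:
  "even_pos_roots = eroot ` {e. fst e < snd e \<and> snd e < N \<and> (snd e < M \<or> M \<le> fst e)}" (is "?L = ?R")
proof (intro equalityI subsetI)
  fix \<alpha> :: "('k, 'm, 'n) wt" assume "\<alpha> \<in> ?L"
  then consider x y where "\<alpha> = eps x - eps y" "x < y" | x y where "\<alpha> = del x - del y" "x < y"
    by (auto simp: even_pos_roots_def)
  then show "\<alpha> \<in> ?R"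
  proof cases
    case (1 x y)
    obtain i j where ij: "i < M" "j < M" "(Inl x :: 'm + 'n) = ix i" "(Inl y :: 'm + 'n) = ix j"
      using ix_Inl[of x] ix_Inl[of y] by metis
    have "idx_less (Inl x :: 'm + 'n) (Inl y)" using 1 by simp
    then have "i < j" using ij M_less_N by (simp add: ix_less)
    with ij 1 M_less_N show ?thesis
      by (intro image_eqI[of _ _ "(i, j)"]) (auto simp: eroot_def eps_def)
  next
    case (2 x y)
    obtain i j where ij: "M \<le> i" "M \<le> j" "i < N" "j < N" "(Inr x :: 'm + 'n) = ix i" "(Inr y :: 'm + 'n) = ix j"
      using ix_Inr[of x] ix_Inr[of y] by metis
    have "idx_less (Inr x :: 'm + 'n) (Inr y)" using 2 by simp
    then have "i < j" using ij by (simp add: ix_less)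
    with ij 2 show ?thesis
      by (intro image_eqI[of _ _ "(i, j)"]) (auto simp: eroot_def del_def)
  qed
next
  fix \<alpha> assume "\<alpha> \<in> ?R"
  then obtain i j where ij: "i < j" "j < N" "j < M \<or> M \<le> i" "\<alpha> = eroot (i, j)" by auto
  have less: "idx_less (ix i :: 'm + 'n) (ix j)" using ij by (simp add: ix_less)
  from ij(3) show "\<alpha> \<in> ?L"
  proof
    assume "j < M"
    then obtain x y where xy: "(ix i :: 'm + 'n) = Inl x" "(ix j :: 'm + 'n) = Inl y"
      using ix_less_M[of i] ix_less_M[of j] ij by auto
    with less show ?thesis
      using ij(4) by (auto simp: even_pos_roots_def eroot_def eps_def)
  next
    assume "M \<le> i"
    then obtain x y where xy: "(ix i :: 'm + 'n) = Inr x" "(ix j :: 'm + 'n) = Inr y"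
      using ix_ge_M[of i] ix_ge_M[of j] ij by auto
    with less show ?thesis
      using ij(4) by (auto simp: even_pos_roots_def eroot_def del_def)
  qed
qed

lemma odd_pos_roots_eq: "odd_pos_roots = eroot ` {e. fst e < M \<and> M \<le> snd e \<and> snd e < N}" (is "?L = ?R")
proof (intro equalityI subsetI)
  fix \<alpha> :: "('k, 'm, 'n) wt" assume "\<alpha> \<in> ?L"
  then obtain x y where xy: "\<alpha> = eps x - del y" by (auto simp: odd_pos_roots_def)
  obtain i j where "i < M" "M \<le> j" "j < N" "(Inl x :: 'm + 'n) = ix i" "(Inr y :: 'm + 'n) = ix j"
    using ix_Inl[of x] ix_Inr[of y] by metis
  with xy show "\<alpha> \<in> ?R"
    by (intro image_eqI[of _ _ "(i, j)"]) (auto simp: eroot_def eps_def del_def)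
next
  fix \<alpha> assume "\<alpha> \<in> ?R"
  then obtain i j where ij: "i < M" "M \<le> j" "\<alpha> = eroot (i, j)" by auto
  then obtain x y where "(ix i :: 'm + 'n) = Inl x" "(ix j :: 'm + 'n) = Inr y"
    using ix_less_M[of i] ix_ge_M[of j] by blast
  then have "\<alpha> = eps x - del y" using ij(3) by (simp add: eroot_def eps_def del_def)
  then show "\<alpha> \<in> ?L" unfolding odd_pos_roots_def by blast
qed

lemma pos_roots_eq: "pos_roots = eroot ` {e. fst e < snd e \<and> snd e < N}"
proof -
  have "{e. fst e < snd e \<and> snd e < N} =
     {e. fst e < snd e \<and> snd e < N \<and> (snd e < M \<or> M \<le> fst e)} \<union> {e. fst e < M \<and> M \<le> snd e \<and> snd e < N}"
    using M_less_N by auto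
  then show ?thesis
    by (simp only: pos_roots_def even_pos_roots_eq odd_pos_roots_eq image_Un)
qed

lemma eroot_simple_iff:
  assumes "i < j" "j < N"
  shows "eroot (i, j) \<in> simple_roots \<longleftrightarrow> j = Suc i"
proof
  assume simple: "eroot (i, j) \<in> simple_roots"
  show "j = Suc i"
  proof (rule ccontr)
    assume "j \<noteq> Suc i"
    then have "Suc i < j" using assms by simp
    then have "eroot (i, Suc i) \<in> pos_roots" "eroot (Suc i, j) \<in> pos_roots"
      using assms by (auto simp: pos_roots_eq)
    moreover have "eroot (i, j) = eroot (i, Suc i) + eroot (Suc i, j)"
      by (simp add: eroot_def)
    ultimately show False
      using simple unfolding simple_roots_def by blast
  qed
next
  assume j: "j = Suc i"
  have "False" if roots: "\<beta> \<in> pos_roots" "\<gamma> \<in> pos_roots" and sum: "eroot (i, j) = \<beta> + \<gamma>" for \<beta> \<gamma>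
  proof -
    obtain d e where de: "\<beta> = eroot d" "\<gamma> = eroot e" "fst d < snd d" "snd d < N" "fst e < snd e" "snd e < N"
      using roots unfolding pos_roots_eq by blast
    \<comment> \<open>A sum of two positive roots is a word with two letters. Removing its letter
      (i, k) leaves a nonempty word from k to j, so i < k < j.\<close>
    then have w: "[d, e] \<in> words N i j"
      using sum assms by (subst words_iff_eroot) (auto simp: eroot_def)
    then obtain x k y where *: "[d, e] = x @ (i, k) # y" "i < k" "x @ y \<in> words N k j"
      using words_decomp[OF w] by blast
    have "length [d, e] = length (x @ (i, k) # y)"
      using *(1) by (rule arg_cong)
    then have "x @ y \<noteq> []" by auto
    then have "k < j" using words_less[OF *(3)] by simp
    with *(2) j show False by simp
  qed
  moreover have "eroot (i, j) \<in> pos_roots"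
    using assms by (auto simp: pos_roots_eq)
  ultimately show "eroot (i, j) \<in> simple_roots"
    unfolding simple_roots_def by blast
qed

lemma root_vec_eroot:
  assumes "i < N" "j < N" "i \<noteq> j"
  shows "root_vec (eroot (i, j)) = (munit (ix i) (ix j) :: ('k, 'm, 'n) gl)"
proof -
  have "a \<noteq> b \<and> eroot (i, j) = axis a 1 - axis b 1 \<longleftrightarrow> a = ix i \<and> b = ix j" for a b
  proof
    assume *: "a \<noteq> b \<and> eroot (i, j) = axis a 1 - axis b 1"
    then have "eroot (i, j) $ c = (axis a 1 - axis b 1) $ c" for c by simp
    from this[of a] this[of b] * show "a = ix i \<and> b = ix j"
      by (auto simp: eroot_def axis_def split: if_splits)
  qed (use assms in \<open>auto simp: eroot_def ix_eq\<close>)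
  then show ?thesis
    by (simp add: root_vec_def vec_eq_iff)
qed

lemma root_vec_minus_eroot:
  assumes "i < N" "j < N" "i \<noteq> j"
  shows "root_vec (- eroot (i, j)) = (munit (ix j) (ix i) :: ('k, 'm, 'n) gl)"
proof -
  have "- eroot (i, j) = eroot (j, i)" by (simp add: eroot_def)
  then show ?thesis using root_vec_eroot[of j i] assms by simp
qed

definition root_edge :: "('k, 'm, 'n) wt \<Rightarrow> nat \<times> nat" where
  "root_edge = inv_into {e. fst e < snd e \<and> snd e < N} eroot"

lemma root_edge:
  assumes "\<alpha> \<in> pos_roots"
  shows "fst (root_edge \<alpha>) < snd (root_edge \<alpha>)" "snd (root_edge \<alpha>) < N" "eroot (root_edge \<alpha>) = \<alpha>"
proof -
  have "\<alpha> \<in> eroot ` {e. fst e < snd e \<and> snd e < N}"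
    using assms by (simp only: pos_roots_eq)
  from inv_into_into[OF this] f_inv_into_f[OF this]
  show "fst (root_edge \<alpha>) < snd (root_edge \<alpha>)" "snd (root_edge \<alpha>) < N" "eroot (root_edge \<alpha>) = \<alpha>"
    by (simp_all add: root_edge_def)
qed

lemma map_root_edge:
  assumes "set rl \<subseteq> pos_roots"
  shows "e \<in> set (map root_edge rl) \<Longrightarrow> fst e < snd e \<and> snd e < N"
    and "map eroot (map root_edge rl) = rl"
    and "simple_word (map root_edge rl) \<longleftrightarrow> set rl \<subseteq> simple_roots"
    and "wprod (map root_edge rl) = prod_list (map (\<lambda>\<alpha>. ug_incl (root_vec (- \<alpha>))) rl)"
proof -
  show "e \<in> set (map root_edge rl) \<Longrightarrow> fst e < snd e \<and> snd e < N"
    using assms root_edge by auto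
  show "map eroot (map root_edge rl) = rl"
    using assms root_edge by (induction rl) auto
  have *: "snd (root_edge \<alpha>) = Suc (fst (root_edge \<alpha>)) \<longleftrightarrow> \<alpha> \<in> simple_roots" if "\<alpha> \<in> set rl" for \<alpha>
    using eroot_simple_iff[of "fst (root_edge \<alpha>)" "snd (root_edge \<alpha>)"] root_edge[of \<alpha>] that assms
    by auto
  then show "simple_word (map root_edge rl) \<longleftrightarrow> set rl \<subseteq> simple_roots"
    by (auto simp: simple_word_def)
  have "E (snd (root_edge \<alpha>)) (fst (root_edge \<alpha>)) = ug_incl (root_vec (- \<alpha>))" if "\<alpha> \<in> set rl" for \<alpha>
    using root_vec_minus_eroot[of "fst (root_edge \<alpha>)" "snd (root_edge \<alpha>)"] root_edge[of \<alpha>] that assms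
    by (auto simp: Eu_def)
  then show "wprod (map root_edge rl) = prod_list (map (\<lambda>\<alpha>. ug_incl (root_vec (- \<alpha>))) rl)"
    unfolding wprod_def map_map by (intro arg_cong[where f = prod_list] map_cong) auto
qed

section \<open>The partition into simple roots\<close>

lemma simple_words_unique: "w \<in> words N a b \<Longrightarrow> simple_word w \<Longrightarrow> mset w = mset (map (\<lambda>j. (j, Suc j)) [a..<b])"
proof (induction "length w" arbitrary: w a rule: less_induct)
  case less
  show ?case
  proof (cases "w = []")
    case True
    then show ?thesis using less.prems words_Nil by auto
  next
    case False
    obtain x i y where *: "w = x @ (a, i) # y" "x @ y \<in> words N i b"
      using words_decomp[OF less.prems(1) False] by metis
    have i: "i = Suc a" using less.prems(2) *(1) by (auto simp: simple_word_def)
    have "mset (x @ y) = mset (map (\<lambda>j. (j, Suc j)) [i..<b])"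
      using less.prems(2) * by (intro less.hyps) (auto simp: simple_word_def)
    moreover have "a < b" using words_less[OF less.prems(1) False] by simp
    ultimately show ?thesis
      using * i by (simp add: upt_conv_Cons[of a b])
  qed
qed

lemma simple_word_exists:
  assumes "a \<le> b" "b < N"
  shows "map (\<lambda>j. (j, Suc j)) [a..<b] \<in> words N a b"
  using assms
proof (induction "b - a" arbitrary: a)
  case (Suc n)
  then have "map (\<lambda>j. (j, Suc j)) [Suc a..<b] \<in> words N (Suc a) b" by auto
  moreover have "[(a, Suc a)] \<in> words N a (Suc a)" using Suc by (auto simp: words_def)
  ultimately have "[(a, Suc a)] @ map (\<lambda>j. (j, Suc j)) [Suc a..<b] \<in> words N a b"
    using words_append by blast
  then show ?case using Suc by (simp add: upt_conv_Cons[of a b])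
qed (simp add: words_Nil)

text \<open>By this uniqueness the normalization of a Shapovalov element, a condition on one
  summand, becomes the statement that the total coefficient of the simple words is 1.\<close>

lemma simple_partition_unique:
  assumes "a \<le> b" "b < N"
  shows "\<exists>\<pi>\<^sub>0. {\<pi> \<in> root_partitions (axis (ix a) 1 - axis (ix b) 1 :: ('k, 'm, 'n) wt). set_mset \<pi> \<subseteq> simple_roots} = {\<pi>\<^sub>0}"
proof
  let ?\<gamma> = "axis (ix a) 1 - axis (ix b) 1 :: ('k, 'm, 'n) wt"
  let ?w = "map (\<lambda>j. (j, Suc j)) [a..<b]"
  let ?\<pi> = "mset (map eroot ?w)"
  have w: "?w \<in> words N a b" by (rule simple_word_exists[OF assms])
  have "sum_list (map eroot ?w) = ?\<gamma>"
    using words_iff_eroot[of a b ?w] w assms by simp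
  then have sum: "\<Sum>\<^sub># ?\<pi> = ?\<gamma>" by (simp only: sum_mset_sum_list)
  have edges: "fst e < snd e \<and> snd e < N \<and> snd e = Suc (fst e)" if "e \<in> set ?w" for e
    using that assms by auto
  have "eroot e \<in> pos_roots \<and> eroot e \<in> simple_roots" if "e \<in> set ?w" for e
    using edges[OF that] eroot_simple_iff[of "fst e" "snd e", unfolded prod.collapse] by (auto simp: pos_roots_eq)
  then have "set (map eroot ?w) \<subseteq> pos_roots" "set (map eroot ?w) \<subseteq> simple_roots"
    by (simp_all only: set_map) blast+
  then have mem: "?\<pi> \<in> root_partitions ?\<gamma>" "set_mset ?\<pi> \<subseteq> simple_roots"
    using sum by (simp_all only: root_partitions_def mem_Collect_eq set_mset_mset simp_thms)
  have "\<pi> = ?\<pi>" if \<pi>: "\<pi> \<in> root_partitions ?\<gamma>" "set_mset \<pi> \<subseteq> simple_roots" for \<pi>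
  proof -
    obtain rl where rl: "mset rl = \<pi>" using ex_mset by blast
    have sub: "set rl \<subseteq> pos_roots" "sum_list rl = ?\<gamma>" "set rl \<subseteq> simple_roots"
      using \<pi> rl by (auto simp: root_partitions_def sum_mset_sum_list[symmetric])
    let ?v = "map root_edge rl"
    have "?v \<in> words N a b"
      using map_root_edge(1,2)[OF sub(1)] sub(2) assms by (subst words_iff_eroot) (auto simp del: map_map)
    then have "mset ?v = mset ?w"
      using map_root_edge(3)[OF sub(1)] sub(3) by (intro simple_words_unique) auto
    then have "image_mset eroot (mset ?v) = ?\<pi>" by (simp only: mset_map)
    then show ?thesis
      using map_root_edge(2)[OF sub(1)] rl by (metis mset_map)
  qed
  with mem show "{\<pi> \<in> root_partitions ?\<gamma>. set_mset \<pi> \<subseteq> simple_roots} = {?\<pi>}"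
    by blast
qed

end

section \<open>Shapovalov elements modulo the ideal of the Verma module\<close>

lemma left_ideal_base: "s \<in> S \<Longrightarrow> s \<in> left_ideal S"
  using left_ideal.step[of s S 0 1, OF _ left_ideal.zero] by simp

lemma left_ideal_uminus: "x \<in> left_ideal S \<Longrightarrow> - x \<in> left_ideal S"
  using left_ideal_mult[of x S "- 1"] by simp

lemma left_ideal_diff: "x \<in> left_ideal S \<Longrightarrow> y \<in> left_ideal S \<Longrightarrow> x - y \<in> left_ideal S"
  using left_ideal_add[OF _ left_ideal_uminus] by (metis diff_conv_add_uminus)

lemma left_ideal_sum: "(\<And>i. i \<in> A \<Longrightarrow> x i \<in> left_ideal S) \<Longrightarrow> (\<Sum>i\<in>A. x i) \<in> left_ideal S"
  by (induction A rule: infinite_finite_induct) (auto intro: left_ideal.zero left_ideal_add)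

lemma left_ideal_mono: "x \<in> left_ideal S \<Longrightarrow> S \<subseteq> T \<Longrightarrow> x \<in> left_ideal T"
  by (induction rule: left_ideal.induct) (auto intro: left_ideal.intros)

lemma coset_eq:
  assumes "u - v \<in> verma_ideal \<mu>"
  shows "u +o verma_ideal \<mu> = v +o verma_ideal \<mu>"
proof -
  have sub: "u +o verma_ideal \<mu> \<subseteq> v +o verma_ideal \<mu>" if "u - v \<in> verma_ideal \<mu>" for u v
  proof
    fix x assume "x \<in> u +o verma_ideal \<mu>"
    then obtain y where y: "y \<in> verma_ideal \<mu>" "x = u + y" by (auto simp: elt_set_plus_def)
    have "(u - v) + y \<in> verma_ideal \<mu>"
      using y that unfolding verma_ideal_def by (intro left_ideal_add)
    moreover have "x = v + ((u - v) + y)" using y by simp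
    ultimately show "x \<in> v +o verma_ideal \<mu>" unfolding elt_set_plus_def by blast
  qed
  have "v - u \<in> verma_ideal \<mu>"
    using left_ideal_uminus assms unfolding verma_ideal_def by fastforce
  then show ?thesis using sub assms by blast
qed

lemma in_coset: "u \<in> u +o verma_ideal \<mu>"
  using left_ideal.zero by (force simp: elt_set_plus_def verma_ideal_def)

lemma verma_act_vec: "verma_act \<mu> u (verma_vec \<mu>) = u +o verma_ideal \<mu>"
  by (simp add: verma_vec_def verma_act_coset)

lemma verma_submodule_coset:
  assumes "X \<in> verma_submodule \<mu> ((\<lambda>a. verma_act \<mu> (\<theta> a) (verma_vec \<mu>)) ` A)"
  shows "\<exists>y\<in>left_ideal (\<theta> ` A). X = y +o verma_ideal \<mu>"
  using assms
proof (induction rule: verma_submodule.induct)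
  case zero
  show ?case using left_ideal.zero by (force simp: set_zero_plus)
next
  case (step x Y u)
  then obtain a y where a: "a \<in> A" "x = \<theta> a +o verma_ideal \<mu>"
    and y: "y \<in> left_ideal (\<theta> ` A)" "Y = y +o verma_ideal \<mu>"
    by (auto simp: verma_act_vec)
  have "verma_act \<mu> u x + Y = (u * \<theta> a + y) +o verma_ideal \<mu>"
    by (simp only: a y verma_act_coset verma_plus_coset)
  moreover have "u * \<theta> a + y \<in> left_ideal (\<theta> ` A)"
    using a y by (intro left_ideal.step) auto
  ultimately show ?case by blast
qed

lemma in_verma_submodule:
  assumes "a \<in> A" "\<theta>' - u * \<theta> a \<in> verma_ideal \<mu>"
  shows "verma_act \<mu> \<theta>' (verma_vec \<mu>) \<in> verma_submodule \<mu> ((\<lambda>a. verma_act \<mu> (\<theta> a) (verma_vec \<mu>)) ` A)"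
proof -
  have "verma_act \<mu> u (verma_act \<mu> (\<theta> a) (verma_vec \<mu>)) + verma_ideal \<mu> \<in>
      verma_submodule \<mu> ((\<lambda>a. verma_act \<mu> (\<theta> a) (verma_vec \<mu>)) ` A)"
    using assms(1) by (intro verma_submodule.step verma_submodule.zero) auto
  also have "verma_act \<mu> u (verma_act \<mu> (\<theta> a) (verma_vec \<mu>)) + verma_ideal \<mu> = (u * \<theta> a) +o verma_ideal \<mu>"
    using verma_plus_coset[of "u * \<theta> a" \<mu> 0]
    by (simp only: verma_act_vec verma_act_coset set_zero_plus add_0_right)
  also have "\<dots> = verma_act \<mu> \<theta>' (verma_vec \<mu>)"
    by (simp only: verma_act_vec coset_eq[OF assms(2)])
  finally show ?thesis .
qed

lemma prod_list_power_count:
  "prod_list (map (\<lambda>\<alpha>. f \<alpha> ^ count \<pi> \<alpha>) rs) =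
    prod_list (map f (concat (map (\<lambda>\<alpha>. replicate (count \<pi> \<alpha>) \<alpha>) rs)))"
  for f :: "'a \<Rightarrow> 'b::monoid_mult"
  by (induction rs) (simp_all add: prod_list_replicate)

lemma mset_concat_replicate:
  assumes "distinct rs" "set_mset \<pi> \<subseteq> set rs"
  shows "mset (concat (map (\<lambda>\<alpha>. replicate (count \<pi> \<alpha>) \<alpha>) rs)) = \<pi>"
proof -
  have "count (mset (concat (map (\<lambda>\<alpha>. replicate (count \<pi> \<alpha>) \<alpha>) rs))) x = (if x \<in> set rs then count \<pi> x else 0)" for x
    using assms(1) by (induction rs) auto
  then show ?thesis
    using assms(2) by (intro multiset_eqI) (auto simp: not_in_iff)
qed

context verma_fock
begin

text \<open>The elements congruent to a scalar form a subalgebra: the ideal is a left ideal and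
  scalars are central, which is enough for products.\<close>

lemma cartan_mod_ideal:
  assumes "x \<in> U_sub cartan"
  shows "\<exists>c. x - ug_scalar c \<in> verma_ideal lam"
proof -
  let ?A = "{x. \<exists>c. x - ug_scalar c \<in> verma_ideal lam}"
  have "is_subalgebra ?A"
    unfolding is_subalgebra_def
  proof (intro conjI subsetI ballI)
    fix x assume "x \<in> range (ug_scalar :: 'k \<Rightarrow> ('k, 'm, 'n) Ugl)"
    then obtain c where "x = ug_scalar c" by blast
    then have "x - ug_scalar c \<in> verma_ideal lam"
      by (simp add: verma_ideal_def left_ideal.zero)
    then show "x \<in> ?A" by blast
  next
    fix x y assume "x \<in> ?A" "y \<in> ?A"
    then obtain c d where c: "x - ug_scalar c \<in> verma_ideal lam" and d: "y - ug_scalar d \<in> verma_ideal lam"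
      by blast
    have "(x - ug_scalar c) + (y - ug_scalar d) \<in> verma_ideal lam"
      using c d unfolding verma_ideal_def by (rule left_ideal_add)
    moreover have "(x - ug_scalar c) + (y - ug_scalar d) = (x + y) - ug_scalar (c + d)"
      by (simp add: ug_scalar_add)
    ultimately show "x + y \<in> ?A" by auto
    have "x * (y - ug_scalar d) + ug_scalar d * (x - ug_scalar c) \<in> verma_ideal lam"
      using c d unfolding verma_ideal_def by (intro left_ideal_add left_ideal_mult)
    moreover have "x * (y - ug_scalar d) + ug_scalar d * (x - ug_scalar c) = x * y - ug_scalar (c * d)"
      by (simp add: right_diff_distrib ug_scalar_mult ug_scalar_central[of d])
    ultimately show "x * y \<in> ?A" by auto
  qed
  moreover have "ug_incl ` cartan \<subseteq> ?A"
    unfolding verma_ideal_def by (auto intro!: left_ideal_base)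
  ultimately have "U_sub cartan \<subseteq> ?A"
    unfolding U_sub_def by (intro hull_minimal)
  with assms show ?thesis by blast
qed

lemma e_minus_word:
  assumes rs: "distinct rs" "set rs = pos_roots" and ab: "a < N" "b < N"
    and \<pi>: "\<pi> \<in> root_partitions (axis (ix a) 1 - axis (ix b) 1)"
  shows "SL a b (e_minus rs \<pi>) (of_bool (set_mset \<pi> \<subseteq> simple_roots))"
proof -
  let ?l = "concat (map (\<lambda>\<alpha>. replicate (count \<pi> \<alpha>) \<alpha>) rs)"
  have mset: "mset ?l = \<pi>"
    using rs \<pi> by (intro mset_concat_replicate) (auto simp: root_partitions_def)
  have set: "set ?l = set_mset \<pi>" by (metis mset set_mset_mset)
  have sub: "set ?l \<subseteq> pos_roots" using \<pi> by (auto simp only: set root_partitions_def mem_Collect_eq)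
  have "sum_list ?l = axis (ix a) 1 - axis (ix b) 1"
    using \<pi> by (simp only: root_partitions_def mem_Collect_eq sum_mset_sum_list[symmetric] mset)
  then have "map root_edge ?l \<in> words N a b"
    using map_root_edge(1,2)[OF sub] by (simp only: words_iff_eroot[OF ab] simp_thms) blast
  from SL_word[OF this] show ?thesis
    by (simp only: map_root_edge(3,4)[OF sub] set e_minus_def prod_list_power_count)
qed

text \<open>The factors \<open>H\<close> stand on the right, next to the highest weight vector, and
  may therefore be replaced by scalars; the one of the partition into simple roots is 1 from the
  start.\<close>

lemma shapovalov_mod_ideal:
  assumes rs: "distinct rs" "set rs = pos_roots" and ab: "a \<le> b" "b < N"
    and \<theta>: "shapovalov rs (axis (ix a) 1 - axis (ix b) 1) \<theta>"
  shows "\<exists>u. SL a b u 1 \<and> \<theta> - u \<in> verma_ideal lam"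
proof -
  let ?\<gamma> = "axis (ix a) 1 - axis (ix b) 1 :: ('k, 'm, 'n) wt"
  obtain H where H: "\<And>\<pi>. \<pi> \<in> root_partitions ?\<gamma> \<Longrightarrow> H \<pi> \<in> U_sub cartan"
      "\<And>\<pi>. \<pi> \<in> root_partitions ?\<gamma> \<Longrightarrow> set_mset \<pi> \<subseteq> simple_roots \<Longrightarrow> H \<pi> = 1"
      "\<theta> = (\<Sum>\<pi>\<in>root_partitions ?\<gamma>. e_minus rs \<pi> * H \<pi>)"
    using \<theta> unfolding shapovalov_def by blast
  have "\<exists>c. H \<pi> - ug_scalar c \<in> verma_ideal lam \<and> (set_mset \<pi> \<subseteq> simple_roots \<longrightarrow> c = 1)"
    if "\<pi> \<in> root_partitions ?\<gamma>" for \<pi>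
  proof (cases "set_mset \<pi> \<subseteq> simple_roots")
    case True
    then show ?thesis
      using H(2)[OF that] left_ideal.zero by (intro exI[of _ 1]) (simp add: verma_ideal_def)
  next
    case False
    then show ?thesis using cartan_mod_ideal[OF H(1)[OF that]] by blast
  qed
  then obtain c where c: "\<And>\<pi>. \<pi> \<in> root_partitions ?\<gamma> \<Longrightarrow> H \<pi> - ug_scalar (c \<pi>) \<in> verma_ideal lam"
      "\<And>\<pi>. \<pi> \<in> root_partitions ?\<gamma> \<Longrightarrow> set_mset \<pi> \<subseteq> simple_roots \<Longrightarrow> c \<pi> = 1"
    by metis
  define u where "u = (\<Sum>\<pi>\<in>root_partitions ?\<gamma>. ug_scalar (c \<pi>) * e_minus rs \<pi>)"
  have "\<theta> - u = (\<Sum>\<pi>\<in>root_partitions ?\<gamma>. e_minus rs \<pi> * (H \<pi> - ug_scalar (c \<pi>)))"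
    by (simp only: H(3) u_def sum_subtractf[symmetric] right_diff_distrib ug_scalar_central)
  also have "\<dots> \<in> verma_ideal lam"
    using c(1) unfolding verma_ideal_def by (intro left_ideal_sum left_ideal_mult)
  finally have "\<theta> - u \<in> verma_ideal lam" .
  moreover have "SL a b u (\<Sum>\<pi>\<in>root_partitions ?\<gamma>. c \<pi> * of_bool (set_mset \<pi> \<subseteq> simple_roots))"
    unfolding u_def using ab by (intro SL_sum SL_scale e_minus_word[OF rs]) auto
  moreover have "(\<Sum>\<pi>\<in>root_partitions ?\<gamma>. c \<pi> * of_bool (set_mset \<pi> \<subseteq> simple_roots)) = 1"
  proof -
    obtain \<pi>\<^sub>0 where \<pi>\<^sub>0: "{\<pi> \<in> root_partitions ?\<gamma>. set_mset \<pi> \<subseteq> simple_roots} = {\<pi>\<^sub>0}"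
      using simple_partition_unique[OF ab] by blast
    have "(\<Sum>\<pi>\<in>root_partitions ?\<gamma>. c \<pi> * of_bool (set_mset \<pi> \<subseteq> simple_roots)) =
        (\<Sum>\<pi>\<in>{\<pi> \<in> root_partitions ?\<gamma>. set_mset \<pi> \<subseteq> simple_roots}. 1)"
      by (rule sum.mono_neutral_cong_right) (auto simp: finite_root_partitions c(2))
    then show ?thesis by (simp add: \<pi>\<^sub>0)
  qed
  ultimately show ?thesis by metis
qed

text \<open>On the highest weight vector the factor formed from \<open>h_of\<close> and rho acts by
  the value of the form at \<open>lam + rho\<close> and the root, which is zero.\<close>

lemma shapovalov_singular:
  assumes "shapovalov rs (axis (ix a) 1 - axis (ix b) 1) \<theta>" "a < N" "b < N"
    and "wt_form (lam + rho) (axis (ix a) 1 - axis (ix b) 1) = 0"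
    and ij: "i < j" "j < N"
  shows "Eop i j (act \<theta> vac) = 0"
proof -
  let ?\<gamma> = "axis (ix a) 1 - axis (ix b) 1 :: ('k, 'm, 'n) wt"
  have "eroot (i, j) \<in> pos_roots" using ij by (auto simp: pos_roots_eq)
  then obtain u w where uw: "w \<in> left_ideal (ug_incl ` n_plus)"
      "ug_incl (root_vec (eroot (i, j))) * \<theta> =
        u * (ug_incl (h_of ?\<gamma>) + ug_scalar (wt_eval rho (h_of ?\<gamma>))) + w"
    using assms(1) unfolding shapovalov_def by blast
  have "w \<in> verma_ideal lam"
    using left_ideal_mono[OF uw(1)] unfolding verma_ideal_def by blast
  moreover have "ug_incl (h_of ?\<gamma>) - ug_scalar (wt_eval lam (h_of ?\<gamma>)) \<in> verma_ideal lam"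
    unfolding verma_ideal_def using h_of_in_cartan by (intro left_ideal_base) blast
  moreover have "wt_eval lam (h_of ?\<gamma>) + wt_eval rho (h_of ?\<gamma>) = 0"
    using assms(4) by (simp only: wt_eval_h_of[symmetric]) (simp add: wt_eval_def distrib_right sum.distrib)
  then have "ug_incl (h_of ?\<gamma>) + ug_scalar (wt_eval rho (h_of ?\<gamma>)) =
      ug_incl (h_of ?\<gamma>) - ug_scalar (wt_eval lam (h_of ?\<gamma>))"
    by (simp add: add_eq_0_iff ug_scalar_uminus)
  ultimately have "ug_incl (root_vec (eroot (i, j))) * \<theta> \<in> verma_ideal lam"
    unfolding uw(2) verma_ideal_def by (simp only:) (intro left_ideal_add left_ideal_mult)
  then have "act (ug_incl (root_vec (eroot (i, j))) * \<theta>) vac = 0"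
    by (rule act_verma_ideal)
  moreover have "ug_incl (root_vec (eroot (i, j))) = E i j"
    using ij by (simp add: root_vec_eroot Eu_def)
  ultimately show ?thesis using ij by (simp add: act_mult act_E)
qed

section \<open>Differences of the coordinates of rho\<close>

abbreviation even_total :: "('k, 'm, 'n) wt" where "even_total \<equiv> \<Sum>\<alpha>\<in>even_pos_roots. \<alpha>"
abbreviation odd_total :: "('k, 'm, 'n) wt" where "odd_total \<equiv> \<Sum>\<alpha>\<in>odd_pos_roots. \<alpha>"

lemma even_root_sum:
  assumes "i < N"
  shows "even_total $ ix i =
    (if i < M then of_nat (M - 1 - i) - of_nat i else of_nat (N - 1 - i) - of_nat (i - M))"
proof -
  let ?A = "{e. fst e < snd e \<and> snd e < N \<and> (snd e < M \<or> M \<le> fst e)}"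
  have fin: "finite ?A"
    by (rule finite_subset[of _ "{..<N} \<times> {..<N}"]) auto
  have inj: "inj_on eroot ?A"
    by (rule inj_onI, rule eroot_inj) auto
  have "even_total = (\<Sum>e\<in>?A. eroot e)"
    by (simp only: even_pos_roots_eq sum.reindex[OF inj] comp_def)
  then have "even_total $ ix i = (\<Sum>e\<in>?A. eroot e $ ix i)"
    by simp
  also have "\<dots> = (\<Sum>e\<in>?A. of_bool (i = fst e)) - (\<Sum>e\<in>?A. of_bool (i = snd e))"
    unfolding sum_subtractf[symmetric] using assms by (intro sum.cong refl eroot_nth) auto
  also have "(\<Sum>e\<in>?A. of_bool (i = fst e)) = (of_nat (card (?A \<inter> {e. i = fst e})) :: 'k)"
    using fin by simp
  also have "(\<Sum>e\<in>?A. of_bool (i = snd e)) = (of_nat (card (?A \<inter> {e. i = snd e})) :: 'k)"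
    using fin by simp
  also have "?A \<inter> {e. i = fst e} = Pair i ` {i<..<if i < M then M else N}"
    using M_less_N by (auto split: if_splits)
  also have "?A \<inter> {e. i = snd e} = (\<lambda>j. (j, i)) ` {(if i < M then 0 else M)..<i}"
    using assms by (auto split: if_splits)
  finally show ?thesis
    by (simp add: card_image inj_on_def)
qed

lemma odd_root_sum:
  assumes "i < N"
  shows "odd_total $ ix i = (if i < M then of_nat (N - M) else - of_nat M)"
proof -
  let ?A = "{..<M} \<times> {M..<N}"
  have eq: "{e. fst e < M \<and> M \<le> snd e \<and> snd e < N} = ?A" by auto
  have inj: "inj_on eroot ?A"
    by (rule inj_onI, rule eroot_inj) auto
  have "odd_total = (\<Sum>e\<in>?A. eroot e)"
    by (simp only: odd_pos_roots_eq eq sum.reindex[OF inj] comp_def)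
  then have "odd_total $ ix i = (\<Sum>e\<in>?A. eroot e $ ix i)"
    by simp
  also have "\<dots> = (\<Sum>e\<in>?A. of_bool (i = fst e)) - (\<Sum>e\<in>?A. of_bool (i = snd e))"
    unfolding sum_subtractf[symmetric] using assms by (intro sum.cong refl eroot_nth) auto
  also have "(\<Sum>e\<in>?A. of_bool (i = fst e)) = (of_nat (card (?A \<inter> {e. i = fst e})) :: 'k)"
    by simp
  also have "(\<Sum>e\<in>?A. of_bool (i = snd e)) = (of_nat (card (?A \<inter> {e. i = snd e})) :: 'k)"
    by simp
  also have "?A \<inter> {e. i = fst e} = (if i < M then Pair i ` {M..<N} else {})"
    by auto
  also have "?A \<inter> {e. i = snd e} = (if i < M then {} else (\<lambda>j. (j, i)) ` {..<M})"
    using assms by auto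
  finally show ?thesis
    by (simp add: card_image inj_on_def)
qed

text \<open>The sum of the odd roots is constant on each block and cancels; in the even sum the
  count of letters starting at an index drops and that of letters ending there grows by one per
  step.\<close>

lemma rho_diff:
  assumes "s \<le> e" "e < N" "e < M \<or> M \<le> s"
  shows "(rho :: ('k, 'm, 'n) wt) $ ix s - (rho :: ('k, 'm, 'n) wt) $ ix e = of_nat (e - s)"
proof -
  have rho: "(rho :: ('k, 'm, 'n) wt) $ ix i =
      (1 / 2) * even_total $ ix i
      - (1 / 2) * odd_total $ ix i" for i
    by (simp add: rho_def)
  have half: "(1 / 2) * (p - a) - (1 / 2) * d - ((1 / 2) * (q - b) - (1 / 2) * d) = b - a"
    if "p + a = q + b" for p q a b d :: 'k
  proof -
    have "(1 / 2) * (p - a) - (1 / 2) * d - ((1 / 2) * (q - b) - (1 / 2) * d) =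
        (1 / 2) * ((p + a) - (q + b)) + (b - a)"
      by (simp add: field_simps)
    then show ?thesis using that by simp
  qed
  have "s < N" using assms by simp
  show ?thesis
  proof (cases "e < M")
    case True
    then have "s < M" using assms(1) by simp
    have "(of_nat (M - 1 - s) + of_nat s :: 'k) = of_nat (M - 1 - e) + of_nat e"
      unfolding of_nat_add[symmetric] using True assms(1) by (intro arg_cong[where f = of_nat]) simp
    then show ?thesis
      unfolding rho even_root_sum[OF assms(2)] odd_root_sum[OF assms(2)]
        even_root_sum[OF \<open>s < N\<close>] odd_root_sum[OF \<open>s < N\<close>]
      using True \<open>s < M\<close> assms(1) by (simp only: if_True half of_nat_diff)
  next
    case False
    then have "M \<le> s" using assms(3) by simp
    then have s: "\<not> s < M" by simp
    have "(of_nat (N - 1 - s) + of_nat (s - M) :: 'k) = of_nat (N - 1 - e) + of_nat (e - M)"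
      unfolding of_nat_add[symmetric] using \<open>M \<le> s\<close> assms(1,2)
      by (intro arg_cong[where f = of_nat]) simp
    moreover have "of_nat (e - M) - of_nat (s - M) = (of_nat (e - s) :: 'k)"
      using \<open>M \<le> s\<close> assms(1) by (simp add: of_nat_diff)
    ultimately show ?thesis
      unfolding rho even_root_sum[OF assms(2)] odd_root_sum[OF assms(2)]
        even_root_sum[OF \<open>s < N\<close>] odd_root_sum[OF \<open>s < N\<close>]
      using False s by (simp only: if_False half)
  qed
qed

section \<open>Submodules generated by singular vectors\<close>

text \<open>Only even indices i occur in a peelable vector, in contrast to the general decomposition
  \<open>peel\<close>.\<close>

definition peelable :: "nat \<Rightarrow> (state \<Rightarrow> 'k) \<Rightarrow> bool" where
  "peelable a v \<longleftrightarrow> (\<exists>f. (\<forall>i\<in>{a<..<M}. col_vac a (f i) \<and> bounded (f i)) \<and> v = (\<Sum>i\<in>{a<..<M}. Eop i a (f i)))"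

lemma peelable_0: "peelable a 0"
  unfolding peelable_def
  by (rule exI[of _ "\<lambda>_. 0"]) (simp add: col_vac_0 bounded_0 lin_0[OF lin_Eop])

lemma peelable_add:
  assumes "peelable a v" "peelable a w"
  shows "peelable a (v + w)"
proof -
  obtain f where
    f: "\<forall>i\<in>{a<..<M}. col_vac a (f i) \<and> bounded (f i)" "v = (\<Sum>i\<in>{a<..<M}. Eop i a (f i))"
    using assms(1) unfolding peelable_def by blast
  obtain g where
    g: "\<forall>i\<in>{a<..<M}. col_vac a (g i) \<and> bounded (g i)" "w = (\<Sum>i\<in>{a<..<M}. Eop i a (g i))"
    using assms(2) unfolding peelable_def by blast
  have "v + w = (\<Sum>i\<in>{a<..<M}. Eop i a (f i + g i))"
    by (simp only: f(2) g(2) lin_add[OF lin_Eop] sum.distrib)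
  moreover have "\<forall>i\<in>{a<..<M}. col_vac a (f i + g i) \<and> bounded (f i + g i)"
    using f(1) g(1) by (blast intro: col_vac_add bounded_add)
  ultimately show ?thesis
    unfolding peelable_def by (intro exI[of _ "\<lambda>i. f i + g i"] conjI)
qed

lemma peelable_vscale:
  assumes "peelable a v"
  shows "peelable a (c \<star> v)"
proof -
  obtain f where
    f: "\<forall>i\<in>{a<..<M}. col_vac a (f i) \<and> bounded (f i)" "v = (\<Sum>i\<in>{a<..<M}. Eop i a (f i))"
    using assms unfolding peelable_def by blast
  have "c \<star> v = (\<Sum>i\<in>{a<..<M}. Eop i a (c \<star> f i))"
    by (simp only: f(2) lin_vscale[OF lin_Eop] vscale_sum)
  moreover have "\<forall>i\<in>{a<..<M}. col_vac a (c \<star> f i) \<and> bounded (c \<star> f i)"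
    using f(1) by (blast intro: col_vac_vscale bounded_vscale)
  ultimately show ?thesis
    unfolding peelable_def by (intro exI[of _ "\<lambda>i. c \<star> f i"] conjI)
qed

text \<open>The letter (a, i) moves left as in \<open>peel_word\<close>. Since no letter of x is
  odd, a merged letter (a, k) still ends at an even index.\<close>

lemma peelable_word:
  assumes "\<And>e. e \<in> set x \<union> set y \<Longrightarrow> a < fst e \<and> fst e < snd e \<and> snd e < N"
    and "\<And>e. e \<in> set x \<Longrightarrow> fst e < M \<Longrightarrow> snd e < M"
    and "a < i" "i < M" "col_vac a w" "bounded w"
  shows "peelable a (act (wprod (x @ (a, i) # y)) w)"
  using assms(1-4)
proof (induction "length x" arbitrary: x i y)
  case 0
  then have x: "x = []" by simp
  have y: "a < fst e \<and> fst e < snd e \<and> snd e < N" if "e \<in> set y" for e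
    using 0(2)[of e] that by simp
  have "a < N" "i < N" using 0 M_less_N by auto
  let ?g = "act (wprod y) w"
  have "act (wprod (x @ (a, i) # y)) w = Eop i a ?g"
    using \<open>a < N\<close> \<open>i < N\<close> by (simp add: x act_mult act_E)
  also have "\<dots> = (\<Sum>l\<in>{a<..<M}. if l = i then Eop l a ?g else 0)"
    using 0 by simp
  also have "\<dots> = (\<Sum>l\<in>{a<..<M}. Eop l a (if l = i then ?g else 0))"
    by (intro sum.cong refl) (simp add: lin_0[OF lin_Eop])
  finally have "act (wprod (x @ (a, i) # y)) w = (\<Sum>l\<in>{a<..<M}. Eop l a (if l = i then ?g else 0))" .
  moreover have "col_vac a ?g" "bounded ?g"
    using y assms(5,6) by (auto intro!: col_vac_act_wprod bounded_act)
  ultimately show ?case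
    unfolding peelable_def
    by (intro exI[of _ "\<lambda>l. if l = i then ?g else 0"]) (simp add: col_vac_0 bounded_0)
next
  case (Suc n)
  obtain x' e where x: "x = x' @ [e]"
    using Suc.hyps(2) by (metis append_butlast_last_id length_0_conv nat.distinct(1))
  obtain j k where e: "e = (j, k)" by (cases e)
  have bounds: "a < j" "j < k" "k < N" using Suc.prems(1)[of e] by (simp_all add: x e)
  have "a < N" "i < N" using Suc.prems M_less_N by auto
  have y: "a < fst e \<and> fst e < snd e \<and> snd e < N" if "e \<in> set x' \<union> set y" for e
    using Suc.prems(1)[of e] that by (auto simp: x)
  have y': "a < fst e' \<and> fst e' < snd e' \<and> snd e' < N" if "e' \<in> set x' \<union> set ((j, k) # y)" for e'
    using Suc.prems(1)[of e'] that by (auto simp: x e)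
  have noncross: "snd e < M" if "e \<in> set x'" "fst e < M" for e
    using Suc.prems(2)[of e] that by (auto simp: x)
  have "eps2 (k, j) (i, a) = 1" using Suc.prems by (auto simp: eps2_def fer_def)
  then have comm: "E k j * E i a = E i a * E k j + (if j = i then E k a else 0)"
    using E_commute[of k j i a] bounds \<open>a < N\<close> \<open>i < N\<close> by simp
  have "wprod (x @ (a, i) # y) = wprod x' * ((E k j * E i a) * wprod y)"
    by (simp add: x e mult.assoc)
  then have prod: "wprod (x @ (a, i) # y) = wprod (x' @ (a, i) # (j, k) # y)
      + (if j = i then wprod (x' @ (a, k) # y) else 0)"
    by (simp add: comm distrib_left distrib_right mult.assoc)
  have 1: "peelable a (act (wprod (x' @ (a, i) # (j, k) # y)) w)"
    using Suc.hyps(2) Suc.prems(3,4) y' noncross by (intro Suc.hyps(1)) (auto simp: x)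
  have 2: "peelable a (act (wprod (x' @ (a, k) # y)) w)" if "j = i"
  proof (rule Suc.hyps(1))
    show "k < M" using Suc.prems(2)[of e] Suc.prems(4) that by (simp add: x e)
  qed (use Suc.hyps(2) y noncross bounds in \<open>auto simp: x\<close>)
  show ?case
  proof (cases "j = i")
    case True
    then show ?thesis
      using peelable_add[OF 1 2[OF True]] by (simp only: prod act_plus if_True simp_thms)
  next
    case False
    then show ?thesis
      using 1 by (simp only: prod add_0_right if_False simp_thms)
  qed
qed

section \<open>The submodule of a singular vector is spanned by lowering words\<close>

inductive lower_span :: "(state \<Rightarrow> 'k) \<Rightarrow> (state \<Rightarrow> 'k) \<Rightarrow> bool" for w where
  zero: "lower_span w 0"
| step: "(\<And>e. e \<in> set x \<Longrightarrow> fst e < snd e \<and> snd e < N) \<Longrightarrow> lower_span w f \<Longrightarrow>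
    lower_span w (c \<star> act (wprod x) w + f)"

lemma lower_span_word:
  "(\<And>e. e \<in> set x \<Longrightarrow> fst e < snd e \<and> snd e < N) \<Longrightarrow> lower_span w (act (wprod x) w)"
  using lower_span.step[of x w 0 1, OF _ lower_span.zero] by (simp only: vscale_one add_0_right)

lemma lower_span_add: "lower_span w f \<Longrightarrow> lower_span w g \<Longrightarrow> lower_span w (f + g)"
proof (induction rule: lower_span.induct)
  case (step x f c)
  have "lower_span w (c \<star> act (wprod x) w + (f + g))"
    by (rule lower_span.step[OF step.hyps(1) step.IH[OF step.prems]])
  then show ?case by (simp only: add.assoc)
qed (simp only: add_0_left)

lemma lower_span_vscale: "lower_span w f \<Longrightarrow> lower_span w (c \<star> f)"
proof (induction rule: lower_span.induct)
  case (step x f d)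
  have "lower_span w ((c * d) \<star> act (wprod x) w + c \<star> f)"
    by (rule lower_span.step[OF step.hyps(1) step.IH])
  then show ?case by (simp only: vscale_add vscale_vscale)
qed (simp only: vscale_zero lower_span.zero)

lemma lower_span_sum: "(\<And>i. i \<in> A \<Longrightarrow> lower_span w (f i)) \<Longrightarrow> lower_span w (\<Sum>i\<in>A. f i)"
proof (induction A rule: infinite_finite_induct)
  case (insert x A)
  then have "lower_span w (f x + sum f A)" by (intro lower_span_add) auto
  then show ?case by (simp only: sum.insert[OF insert(1,2)])
qed (simp_all only: sum.infinite sum.empty lower_span.zero simp_thms)

context
  fixes w :: "state \<Rightarrow> 'k" and \<mu> :: "nat \<Rightarrow> 'k"
  assumes sing: "\<And>i j. i < j \<Longrightarrow> j < N \<Longrightarrow> Eop i j w = 0"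
    and wt: "\<And>j. j < N \<Longrightarrow> Eop j j w = \<mu> j \<star> w"
begin

lemma lower_span_Eop_lower:
  assumes "lower_span w f" "j < i" "i < N"
  shows "lower_span w (Eop i j f)"
  using assms(1)
proof (induction rule: lower_span.induct)
  case zero
  then show ?case by (simp only: lin_0[OF lin_Eop] lower_span.zero)
next
  case (step x f c)
  have "act (wprod ((j, i) # x)) w = Eop i j (act (wprod x) w)"
    using assms by (simp add: act_mult act_E)
  moreover have "lower_span w (c \<star> act (wprod ((j, i) # x)) w + Eop i j f)"
    using step assms by (intro lower_span.step) auto
  ultimately show ?case
    by (simp only: lin_add[OF lin_Eop] lin_vscale[OF lin_Eop])
qed

text \<open>The operator is moved past the first letter; the commutators are again matrix units,
  possibly diagonal or raising, applied to a shorter word. Hence the induction is over all i and j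
  at once.\<close>

lemma lower_span_Eop_word:
  assumes "\<And>e. e \<in> set x \<Longrightarrow> fst e < snd e \<and> snd e < N" "i < N" "j < N"
  shows "lower_span w (Eop i j (act (wprod x) w))"
  using assms
proof (induction x arbitrary: i j)
  case Nil
  have w: "lower_span w w" using lower_span_word[of "[]" w] by simp
  consider "i < j" | "i = j" | "j < i" by linarith
  then show ?case
  proof cases
    case 1
    then show ?thesis using sing Nil by (simp only: wprod_simps act_1 lower_span.zero)
  next
    case 2
    then show ?thesis using wt Nil w lower_span_vscale by (simp only: wprod_simps act_1)
  next
    case 3
    then show ?thesis using w Nil lower_span_Eop_lower by (simp only: wprod_simps act_1)
  qed
next
  case (Cons e x)
  obtain l k where e: "e = (l, k)" by (cases e)
  have bounds: "l < k" "k < N" "l < N" using Cons.prems(1)[of e] by (simp_all add: e)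
  have x: "fst e < snd e \<and> snd e < N" if "e \<in> set x" for e using Cons.prems(1)[of e] that by simp
  let ?g = "act (wprod x) w"
  have IH: "lower_span w (Eop i j ?g)" if "i < N" "j < N" for i j
    using Cons.IH[OF x that] by blast
  have eq: "act (wprod (e # x)) w = Eop k l ?g"
    using bounds by (simp add: e act_mult act_E)
  have "Eop i j (Eop k l ?g) = eps2 (i, j) (k, l) \<star> Eop k l (Eop i j ?g)
     + (if j = k then Eop i l ?g else 0) + (if i = l then (- eps2 (i, j) (k, l)) \<star> Eop k j ?g else 0)"
    using Eop_commute[of i j k l ?g] Cons.prems bounds by (simp add: vscale_uminus_left)
  moreover have cond: "lower_span w (if P then f else 0)" if "lower_span w f" for P f
    using that lower_span.zero by simp
  have "lower_span w (eps2 (i, j) (k, l) \<star> Eop k l (Eop i j ?g)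
     + (if j = k then Eop i l ?g else 0) + (if i = l then (- eps2 (i, j) (k, l)) \<star> Eop k j ?g else 0))"
    by (intro lower_span_add cond lower_span_vscale lower_span_Eop_lower IH bounds Cons.prems(2,3))
  ultimately show ?case
    by (simp only: eq)
qed

lemma lower_span_Eop:
  assumes "lower_span w f" "i < N" "j < N"
  shows "lower_span w (Eop i j f)"
  using assms(1)
proof (induction rule: lower_span.induct)
  case zero
  then show ?case by (simp only: lin_0[OF lin_Eop] lower_span.zero)
next
  case (step x f c)
  then have "lower_span w (c \<star> Eop i j (act (wprod x) w) + Eop i j f)"
    using lower_span_Eop_word assms by (intro lower_span_add lower_span_vscale) blast+
  then show ?case by (simp only: lin_add[OF lin_Eop] lin_vscale[OF lin_Eop])
qed

text \<open>This is U(g) w = U(n-) w for a singular weight vector, obtained from closure under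
  matrix units instead of a triangular decomposition; the words need not be ordered.\<close>

lemma lower_span_act: "lower_span w (act u w)"
proof -
  have w: "lower_span w w" using lower_span_word[of "[]" w] by simp
  have "lower_span w (mat_op x f)" if "lower_span w f" for x f
    unfolding mat_op_def using that
    by (intro lower_span_sum lower_span_vscale lower_span_Eop) auto
  then have "lower_span w (foldr mat_op xs w)" for xs
    by (induction xs) (simp_all add: w)
  then show ?thesis
    unfolding act_def free_op_def word_op_def by (intro lower_span_sum lower_span_vscale)
qed

end

section \<open>Independence and minimality of odd roots\<close>

lemma wt_form_eroot:
  assumes "a < M" "M \<le> b"
  shows "wt_form \<nu> (eroot (a, b)) = \<nu> $ ix a + \<nu> $ ix b"
proof -
  obtain x y where xy: "(ix a :: 'm + 'n) = Inl x" "(ix b :: 'm + 'n) = Inr y"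
    using ix_less_M[OF assms(1)] ix_ge_M[OF assms(2)] by blast
  have "(\<Sum>i\<in>UNIV. \<nu> $ Inl i * eroot (a, b) $ Inl i) = (\<Sum>i\<in>UNIV. if i = x then \<nu> $ Inl x else 0)"
    by (intro sum.cong) (auto simp: eroot_def xy axis_def)
  moreover have "(\<Sum>j\<in>UNIV. \<nu> $ Inr j * eroot (a, b) $ Inr j) = (\<Sum>j\<in>UNIV. if j = y then - \<nu> $ Inr y else 0)"
    by (intro sum.cong) (auto simp: eroot_def xy axis_def)
  ultimately show ?thesis by (simp add: wt_form_def xy)
qed

text \<open>The coordinates are added because the form is negative on the odd coordinates, where the
  root has coordinate -1.\<close>

definition in_B :: "nat \<Rightarrow> nat \<Rightarrow> bool" where
  "in_B a b \<longleftrightarrow> a < M \<and> M \<le> b \<and> b < N \<and> (lam + rho) $ ix a + (lam + rho) $ ix b = 0"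

lemma B_set_eq: "B_set lam = {eroot (a, b) | a b. in_B a b}"
proof (intro equalityI subsetI)
  fix \<alpha> assume "\<alpha> \<in> B_set lam"
  then obtain a b where "a < M" "M \<le> b" "b < N" "\<alpha> = eroot (a, b)" "wt_form (lam + rho) \<alpha> = 0"
    unfolding B_set_def odd_pos_roots_eq by auto
  then show "\<alpha> \<in> {eroot (a, b) | a b. in_B a b}"
    using wt_form_eroot[of a b "lam + rho"] unfolding in_B_def by auto
next
  fix \<alpha> assume "\<alpha> \<in> {eroot (a, b) | a b. in_B a b}"
  then obtain a b where ab: "in_B a b" "\<alpha> = eroot (a, b)" by blast
  then have "\<alpha> \<in> odd_pos_roots"
    unfolding odd_pos_roots_eq in_B_def by auto
  then show "\<alpha> \<in> B_set lam"
    using ab wt_form_eroot[of a b "lam + rho"] unfolding B_set_def in_B_def by auto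
qed

lemma root_le_less:
  assumes "root_le \<gamma>' \<gamma>" "\<gamma> - \<gamma>' = eroot (i, j)" "i < N" "j < N" "i \<noteq> j"
  shows "i < j"
proof -
  obtain \<pi> where \<pi>: "set_mset \<pi> \<subseteq> even_pos_roots" "\<Sum>\<^sub># \<pi> = eroot (i, j)"
    using assms(1,2) unfolding root_le_def by metis
  obtain rl where rl: "mset rl = \<pi>" using ex_mset by blast
  have sub: "set rl \<subseteq> pos_roots"
    using \<pi>(1) rl by (auto simp: pos_roots_def)
  have "sum_list rl = eroot (i, j)"
    using \<pi>(2) by (simp only: sum_mset_sum_list[symmetric] rl)
  then have w: "map root_edge rl \<in> words N i j"
    using map_root_edge(1,2)[OF sub] assms(3,4) by (subst words_iff_eroot) (auto simp: eroot_def simp del: map_map)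
  then have "map root_edge rl \<noteq> []"
    using words_Nil[of N i j] assms(5) by auto
  with w show ?thesis using words_less by blast
qed

text \<open>The form of two odd roots is nonzero only if they share exactly one index. Their
  difference is then an even root up to sign, and the order decides the sign.\<close>

lemma root_down_iff:
  assumes "a < M" "M \<le> b" "b < N" "c < M" "M \<le> d" "d < N"
  shows "root_down (eroot (c, d)) (eroot (a, b)) \<longleftrightarrow> (c = a \<and> d < b) \<or> (d = b \<and> a < c)"
proof -
  have N: "a < N" "c < N" using assms M_less_N by auto
  have form: "wt_form (eroot (a, b)) (eroot (c, d)) = of_bool (a = c) - of_bool (b = d)"
    using assms N by (auto simp: wt_form_eroot eroot_nth)
  have le: "root_le (eroot (c, d)) (eroot (a, b))"
    if "eroot (a, b) - eroot (c, d) = eroot e" "fst e < snd e" "snd e < N" "snd e < M \<or> M \<le> fst e" for e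
    unfolding root_le_def even_pos_roots_eq using that by (intro exI[of _ "{#eroot e#}"]) auto
  show ?thesis
  proof (cases "c = a")
    case True
    then have diff: "eroot (a, b) - eroot (c, d) = eroot (d, b)" by (simp add: eroot_def)
    show ?thesis
      unfolding root_down_def form using True le[OF diff] root_le_less[OF _ diff] assms by auto
  next
    case False
    show ?thesis
    proof (cases "d = b")
      case True
      then have diff: "eroot (a, b) - eroot (c, d) = eroot (a, c)" by (simp add: eroot_def)
      show ?thesis
        unfolding root_down_def form using True False le[OF diff] root_le_less[OF _ diff] assms N by auto
    next
      case d: False
      then show ?thesis using False by (simp add: root_down_def form)
    qed
  qed
qed

lemma weight_minimal_iff:
  assumes "in_B a b"
  shows "weight_minimal lam (eroot (a, b)) \<longleftrightarrow>
    (\<forall>c d. in_B c d \<longrightarrow> \<not> (c = a \<and> d < b \<or> d = b \<and> a < c))"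
proof -
  have B: "a < M" "M \<le> b" "b < N" using assms by (auto simp: in_B_def)
  have down: "root_down (eroot (c, d)) (eroot (a, b)) \<longleftrightarrow> c = a \<and> d < b \<or> d = b \<and> a < c" if "in_B c d" for c d
    using that B by (intro root_down_iff) (auto simp: in_B_def)
  have eq: "eroot (c, d) = eroot (a, b) \<longleftrightarrow> c = a \<and> d = b" if "in_B c d" for c d
    using eroot_inj[of "(c, d)" "(a, b)"] that B by (auto simp: in_B_def)
  have "eroot (a, b) \<in> B_set lam" using assms unfolding B_set_eq by blast
  then have "weight_minimal lam (eroot (a, b)) \<longleftrightarrow>
      (\<forall>c d. in_B c d \<longrightarrow> root_down (eroot (c, d)) (eroot (a, b)) \<longrightarrow> eroot (c, d) = eroot (a, b))"
    unfolding weight_minimal_def B_set_eq by blast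
  also have "\<dots> \<longleftrightarrow> (\<forall>c d. in_B c d \<longrightarrow> \<not> (c = a \<and> d < b \<or> d = b \<and> a < c))"
    using down eq by auto
  finally show ?thesis .
qed

section \<open>The two implications for given Shapovalov elements\<close>

context
  fixes rs :: "('k, 'm, 'n) wt list" and \<theta> :: "('k, 'm, 'n) wt \<Rightarrow> ('k, 'm, 'n) Ugl"
  assumes rs: "distinct rs" "set rs = pos_roots"
    and shap: "\<And>\<beta>. \<beta> \<in> odd_pos_roots \<Longrightarrow> shapovalov rs \<beta> (\<theta> \<beta>)"
begin

lemma theta_properties:
  assumes "in_B a b"
  obtains u where "SL a b u 1" "\<theta> (eroot (a, b)) - u \<in> verma_ideal lam"
    "act (\<theta> (eroot (a, b))) vac = act u vac"
    "\<And>i j. i < j \<Longrightarrow> j < N \<Longrightarrow> Eop i j (act u vac) = 0"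
    "\<And>j. j < N \<Longrightarrow> Eop j j (act u vac) = (lam $ ix j - of_bool (j = a) + of_bool (j = b)) \<star> act u vac"
proof -
  have B: "a < M" "M \<le> b" "b < N" "a < N" "a \<le> b"
    using assms M_less_N by (auto simp: in_B_def)
  have eq: "axis (ix a) 1 - axis (ix b) 1 = eroot (a, b)" by (simp add: eroot_def)
  have odd: "eroot (a, b) \<in> odd_pos_roots" using B unfolding odd_pos_roots_eq by auto
  have form: "wt_form (lam + rho) (eroot (a, b)) = 0"
    using assms B by (simp add: wt_form_eroot in_B_def)
  obtain u where u: "SL a b u 1" "\<theta> (eroot (a, b)) - u \<in> verma_ideal lam"
    using shapovalov_mod_ideal[OF rs B(5,3), unfolded eq, OF shap[OF odd]] by blast
  have act: "act (\<theta> (eroot (a, b))) vac = act u vac"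
    using act_verma_ideal[OF u(2)] by (simp only: act_diff right_minus_eq)
  show ?thesis
  proof (rule that[OF u act])
    show "Eop i j (act u vac) = 0" if "i < j" "j < N" for i j
      using shapovalov_singular[OF _ B(4,3), unfolded eq, OF shap[OF odd] form that] by (simp only: act)
    show "Eop j j (act u vac) = (lam $ ix j - of_bool (j = a) + of_bool (j = b)) \<star> act u vac" if "j < N" for j
      using Eop_diag_vac[OF that] by (intro SL_weight[OF that u(1)]) (simp only: vac_wt_eq)
  qed
qed

lemma dependent:
  assumes ab: "in_B a b" and cd: "in_B c d" and less: "c = a \<and> d < b \<or> d = b \<and> a < c"
  shows "\<exists>Z. \<theta> (eroot (a, b)) - Z * \<theta> (eroot (c, d)) \<in> verma_ideal lam"
proof -
  have B: "a < M" "M \<le> b" "b < N" "c < M" "M \<le> d" "d < N" "a \<le> b"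
    using ab cd by (auto simp: in_B_def)
  obtain u where u: "SL a b u 1" "\<theta> (eroot (a, b)) - u \<in> verma_ideal lam"
    "act (\<theta> (eroot (a, b))) vac = act u vac"
    "\<And>i j. i < j \<Longrightarrow> j < N \<Longrightarrow> Eop i j (act u vac) = 0"
    "\<And>j. j < N \<Longrightarrow> Eop j j (act u vac) = (lam $ ix j - of_bool (j = a) + of_bool (j = b)) \<star> act u vac"
    by (rule theta_properties[OF ab]) (rule that)
  obtain v where v: "SL c d v 1" "\<theta> (eroot (c, d)) - v \<in> verma_ideal lam"
    "act (\<theta> (eroot (c, d))) vac = act v vac"
    "\<And>i j. i < j \<Longrightarrow> j < N \<Longrightarrow> Eop i j (act v vac) = 0"
    "\<And>j. j < N \<Longrightarrow> Eop j j (act v vac) = (lam $ ix j - of_bool (j = c) + of_bool (j = d)) \<star> act v vac"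
    by (rule theta_properties[OF cd]) (rule that)
  define \<mu> where "\<mu> j = lam $ ix j - of_bool (j = c) + of_bool (j = d)" for j
  have raise: "Eop r (Suc r) (act v vac) = 0" if "Suc r < N" for r
    using that by (intro v(4)) simp_all
  have wt: "Eop j j (act v vac) = \<mu> j \<star> act v vac" if "j < N" for j
    unfolding \<mu>_def using that by (rule v(5))
  have "\<exists>Z. SL a b (Z * v) 1 \<and> (\<forall>r. Suc r < N \<longrightarrow> Eop r (Suc r) (act Z (act v vac)) = 0)"
    using less
  proof
    assume *: "c = a \<and> d < b"
    have "lam $ ix d - lam $ ix b + of_nat (b - d) = 0"
    proof -
      have "(lam + rho) $ ix d = (lam + rho) $ ix b"
        using ab cd * unfolding in_B_def by (metis add_left_cancel)
      then have "lam $ ix d - lam $ ix b + ((rho :: ('k, 'm, 'n) wt) $ ix d - (rho :: ('k, 'm, 'n) wt) $ ix b) = 0"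
        by (simp add: algebra_simps)
      then show ?thesis using rho_diff[of d b] * B by simp
    qed
    moreover have "of_nat (b - d) = (of_nat (b - 1 - d) + 1 :: 'k)"
      using * by (simp add: of_nat_diff)
    \<comment> \<open>The coordinate d of \<mu> exceeds that of lam by one, which accounts for
      \<open>b - 1 - d\<close> in place of \<open>b - d\<close>.\<close>
    ultimately have eq: "\<mu> d - \<mu> b + of_nat (b - 1 - d) = 0"
      using * B by (simp add: \<mu>_def algebra_simps)
    have "d < b" "b < M \<or> M \<le> d" using * B by simp_all
    have wt_le: "Eop j j (act v vac) = \<mu> j \<star> act v vac" if "j \<le> b" for j
      using that B by (intro wt) simp
    obtain Z where Z: "SL d b Z 1" "\<And>r. Suc r < N \<Longrightarrow> Eop r (Suc r) (act Z (act v vac)) = 0"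
      by (rule even_singular[OF raise wt_le \<open>d < b\<close> B(3) \<open>b < M \<or> M \<le> d\<close> eq]) (assumption, assumption, rule that)
    have "SL a b (Z * v) (1 * 1)" using SL_mult(2)[of a d v 1 b Z 1] v(1) Z(1) * by simp
    with Z show ?thesis by auto
  next
    assume *: "d = b \<and> a < c"
    have "lam $ ix a - lam $ ix c + of_nat (c - a) = 0"
    proof -
      have "(lam + rho) $ ix a = (lam + rho) $ ix c"
        using ab cd * unfolding in_B_def by (metis add_right_cancel)
      then have "lam $ ix a - lam $ ix c + ((rho :: ('k, 'm, 'n) wt) $ ix a - (rho :: ('k, 'm, 'n) wt) $ ix c) = 0"
        by (simp add: algebra_simps)
      then show ?thesis using rho_diff[of a c] * B M_less_N by simp
    qed
    moreover have "of_nat (c - a) = (of_nat (c - 1 - a) + 1 :: 'k)"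
      using * by (simp add: of_nat_diff)
    ultimately have eq: "\<mu> a - \<mu> c + of_nat (c - 1 - a) = 0"
      using * B by (simp add: \<mu>_def algebra_simps)
    have "c < N" "a < c" "c < M \<or> M \<le> a" using * B M_less_N by simp_all
    have wt_le: "Eop j j (act v vac) = \<mu> j \<star> act v vac" if "j \<le> c" for j
      using that \<open>c < N\<close> by (intro wt) simp
    obtain Z where Z: "SL a c Z 1" "\<And>r. Suc r < N \<Longrightarrow> Eop r (Suc r) (act Z (act v vac)) = 0"
      by (rule even_singular[OF raise wt_le \<open>a < c\<close> \<open>c < N\<close> \<open>c < M \<or> M \<le> a\<close> eq]) (assumption, assumption, rule that)
    have "SL a b (Z * v) (1 * 1)" using SL_mult(1)[of a c Z 1 b v 1] v(1) Z(1) * by simp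
    with Z show ?thesis by auto
  qed
  then obtain Z where Z: "SL a b (Z * v) 1" "\<And>r. Suc r < N \<Longrightarrow> Eop r (Suc r) (act Z (act v vac)) = 0"
    by blast
  \<comment> \<open>Both elements have leading coefficient 1, so \<open>SL_unique\<close> applies to
    the difference.\<close>
  have SL0: "SL a b (u - Z * v) 0" using SL_diff[OF u(1) Z(1)] by simp
  have "act (u - Z * v) vac = 0"
  proof (rule SL_unique[OF SL0 B(7,3)])
    show "Eop r (Suc r) (act (u - Z * v) vac) = 0" if "a < r" "r < b" for r
    proof -
      have "Suc r < N" using that B by simp
      then show ?thesis
        using u(4)[of r "Suc r"] Z(2)[of r]
        by (simp only: act_diff act_mult lin_diff[OF lin_Eop] lessI simp_thms diff_self)
    qed
  qed
  \<comment> \<open>The equality of vectors becomes one in the enveloping algebra, and so a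
    congruence modulo the Verma ideal.\<close>
  then have "u - Z * v = 0" using SL_inj[OF SL0 B(7,3)] by blast
  then have "\<theta> (eroot (a, b)) - Z * \<theta> (eroot (c, d)) =
      (\<theta> (eroot (a, b)) - u) - Z * (\<theta> (eroot (c, d)) - v)"
    by (simp add: algebra_simps)
  also have "\<dots> \<in> verma_ideal lam"
    using u(2) v(2) unfolding verma_ideal_def by (rule left_ideal_diff[OF _ left_ideal_mult])
  finally show ?thesis by blast
qed

lemma peelable_deg_part:
  assumes cd: "in_B c d" and "a < M" "M \<le> b" "b < N"
    and not: "\<not> (c = a \<and> d \<le> b)"
  shows "peelable a (deg_part (\<lambda>l. of_bool (l = b) - of_bool (l = a)) (act (x * \<theta> (eroot (c, d))) vac))"
proof -
  have B: "c < M" "M \<le> d" "d < N" "c < N" "a < N" using cd assms M_less_N by (auto simp: in_B_def)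
  obtain v where v: "SL c d v 1" "\<theta> (eroot (c, d)) - v \<in> verma_ideal lam"
    "act (\<theta> (eroot (c, d))) vac = act v vac"
    "\<And>i j. i < j \<Longrightarrow> j < N \<Longrightarrow> Eop i j (act v vac) = 0"
    "\<And>j. j < N \<Longrightarrow> Eop j j (act v vac) = (lam $ ix j - of_bool (j = c) + of_bool (j = d)) \<star> act v vac"
    by (rule theta_properties[OF cd]) (rule that)
  define w where "w = act v vac"
  let ?\<delta> = "\<lambda>l. of_bool (l = b) - of_bool (l = a) :: int"
  have deg: "in_deg (\<lambda>l. of_bool (l = d) - of_bool (l = c)) w"
    unfolding w_def by (rule SL_in_deg[OF v(1)])
  have word: "peelable a (deg_part ?\<delta> (act (wprod z) w))"
    if z: "\<And>e. e \<in> set z \<Longrightarrow> fst e < snd e \<and> snd e < N" for z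
  proof -
    have deg': "in_deg (\<lambda>l. of_bool (l = d) - of_bool (l = c) - ewt z l) (act (wprod z) w)"
      by (rule in_deg_act_wprod[OF deg z])
    show ?thesis
    \<comment> \<open>The weight of the singular vector is accounted for by a fictitious letter (c,
      d), so that the facts on words of weight -(a - b) bear on z. In any other weight the
      projection is zero.\<close>
    proof (cases "\<forall>l<N. ewt ((c, d) # z) l = of_bool (l = a) - of_bool (l = b)")
      case False
      then obtain l where "l < N" "ewt ((c, d) # z) l \<noteq> of_bool (l = a) - of_bool (l = b)" by blast
      then have "deg_part ?\<delta> (act (wprod z) w) = 0"
        by (intro deg_part_in_other_deg[OF deg']) auto
      then show ?thesis by (simp only: peelable_0)
    next
      case True
      have cdz: "fst e < snd e \<and> snd e < N" if "e \<in> set ((c, d) # z)" for e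
        using that z[of e] B by (cases "e = (c, d)") auto
      have "ewt ((c, d) # z) l = of_bool (l = a) - of_bool (l = b)" for l
        using True ewt_ge[of "(c, d) # z" l, OF cdz] assms(4) B(5) by (cases "l < N") auto
      then have W: "(c, d) # z \<in> words N a b"
        using cdz by (simp only: words_def) blast
      have "c \<noteq> a"
      proof
        assume "c = a"
        then have "ewt z l = of_bool (l = d) - of_bool (l = b)" for l
        proof -
          have "ewt ((c, d) # z) l = of_bool (l = a) - of_bool (l = b)"
            using W unfolding words_def by blast
          then show ?thesis using \<open>c = a\<close> by simp
        qed
        then have "z \<in> words N d b" using z by (simp add: words_def)
        then have "d \<le> b" using words_less[of z N d b] words_Nil[of N d b] by (cases "z = []") auto
        with \<open>c = a\<close> not show False by simp
      qed
      then have "a < c" using words_ge[OF W, of "(c, d)"] by simp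
      obtain p i y where p: "(c, d) # z = p @ (a, i) # y" "a < i" "\<And>e. e \<in> set (p @ y) \<Longrightarrow> a < fst e"
        using words_decomp[OF W] by blast
      then obtain p' where p': "p = (c, d) # p'" "z = p' @ (a, i) # y"
        using \<open>c \<noteq> a\<close> by (cases p) auto
      \<comment> \<open>The fictitious letter is already the only odd one, so the letter of z with
        source a must end at an even index.\<close>
      have cross: "\<not> (fst e < M \<and> M \<le> snd e)" if "e \<in> set z" for e
      proof
        assume "fst e < M \<and> M \<le> snd e"
        then have "filter (\<lambda>e. fst e < M \<and> M \<le> snd e) z \<noteq> []"
          using that by (auto simp: filter_empty_conv)
        then show False
          using words_crossings[OF W, of M] B assms(2,3)
          by (auto simp: of_bool_def split: if_splits)
      qed
      have "i < M" using cross[of "(a, i)"] p' assms(2) by auto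
      have "peelable a (act (wprod (p' @ (a, i) # y)) w)"
      proof (rule peelable_word)
        show "a < fst e \<and> fst e < snd e \<and> snd e < N" if "e \<in> set p' \<union> set y" for e
          using p(3)[of e] z[of e] that by (auto simp: p')
        show "snd e < M" if "e \<in> set p'" "fst e < M" for e
          using cross[of e] that by (auto simp: p')
        show "col_vac a w" unfolding w_def by (rule SL_col_vac[OF v(1) \<open>a < c\<close>])
        show "bounded w" unfolding w_def by (rule bounded_act_vac)
      qed fact+
      moreover have "in_deg ?\<delta> (act (wprod z) w)"
      proof -
        have "of_bool (l = d) - of_bool (l = c) - ewt z l = ?\<delta> l" for l
        proof -
          have "ewt ((c, d) # z) l = of_bool (l = a) - of_bool (l = b)"
            using W unfolding words_def by blast
          then show ?thesis by simp
        qed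
        with deg' show ?thesis by (simp only:)
      qed
      ultimately show ?thesis
        by (simp only: deg_part_in_deg p')
    qed
  qed
  have "lower_span w (act x w)"
    unfolding w_def by (rule lower_span_act[OF v(4,5)])
  then have "peelable a (deg_part ?\<delta> (act x w))"
  proof (induction rule: lower_span.induct)
    case zero
    then show ?case by (simp only: lin_0[OF lin_deg_part] peelable_0)
  next
    case (step z f c)
    have "peelable a (c \<star> deg_part ?\<delta> (act (wprod z) w) + deg_part ?\<delta> f)"
      by (intro peelable_add peelable_vscale word step.IH step.hyps(1))
    then show ?case by (simp only: lin_add[OF lin_deg_part] lin_vscale[OF lin_deg_part])
  qed
  then show ?thesis by (simp only: act_mult v(3) w_def)
qed

lemma independent:
  assumes ab: "in_B a b" and minimal: "\<And>c d. in_B c d \<Longrightarrow> \<not> (c = a \<and> d < b \<or> d = b \<and> a < c)"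
    and y: "y \<in> left_ideal (\<theta> ` (B_set lam - {eroot (a, b)}))"
  shows "\<theta> (eroot (a, b)) - y \<notin> verma_ideal lam"
proof
  assume "\<theta> (eroot (a, b)) - y \<in> verma_ideal lam"
  then have eq: "act (\<theta> (eroot (a, b))) vac = act y vac"
    using act_verma_ideal by (metis act_diff right_minus_eq)
  have B: "a < M" "M \<le> b" "b < N" "a < b" using ab by (auto simp: in_B_def)
  obtain u where u: "SL a b u 1" "\<theta> (eroot (a, b)) - u \<in> verma_ideal lam"
    "act (\<theta> (eroot (a, b))) vac = act u vac"
    "\<And>i j. i < j \<Longrightarrow> j < N \<Longrightarrow> Eop i j (act u vac) = 0"
    "\<And>j. j < N \<Longrightarrow> Eop j j (act u vac) = (lam $ ix j - of_bool (j = a) + of_bool (j = b)) \<star> act u vac"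
    by (rule theta_properties[OF ab]) (rule that)
  let ?\<delta> = "\<lambda>l. of_bool (l = b) - of_bool (l = a) :: int"
  have "peelable a (deg_part ?\<delta> (act y vac))"
    using y
  proof (induction rule: left_ideal.induct)
    case zero
    show ?case by (simp only: act_0 lin_0[OF lin_deg_part] peelable_0)
  next
    case (step s y x)
    then obtain c d where cd: "in_B c d" "s = \<theta> (eroot (c, d))" "eroot (c, d) \<noteq> eroot (a, b)"
      unfolding B_set_eq by blast
    then have "\<not> (c = a \<and> d \<le> b)" using minimal[OF cd(1)] by (auto simp: order_le_less)
    then have "peelable a (deg_part ?\<delta> (act (x * s) vac))"
      unfolding cd(2) by (rule peelable_deg_part[OF cd(1) B(1-3)])
    from peelable_add[OF this step.IH] show ?case
      by (simp only: act_plus lin_add[OF lin_deg_part])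
  qed
  then have "peelable a (act u vac)"
    using eq u(3) deg_part_in_deg[OF SL_in_deg[OF u(1)]] by (simp only:)
  then obtain f where f: "\<And>i. i \<in> {a<..<M} \<Longrightarrow> col_vac a (f i) \<and> bounded (f i)"
      "act u vac = (\<Sum>i\<in>{a<..<M}. Eop i a (f i))"
    unfolding peelable_def by blast
  obtain U C where UC: "\<And>i. i \<in> {a<..b} \<Longrightarrow> SL i b (U i) (C i)" "C (Suc a) = 1"
      "u = (\<Sum>i\<in>{a<..b}. E i a * U i)"
    using peel[OF u(1) B(4)] by metis
  \<comment> \<open>Two decompositions of one vector over column a are compared; the one coming from
    the other roots has no component at M.\<close>
  define g where "g i = act (U i) vac + (- 1) \<star> (if i < M then f i else 0)" for i
  have "(\<Sum>i\<in>{a<..b}. Eop i a (g i)) = (\<Sum>i\<in>{a<..b}. Eop i a (act (U i) vac))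
      + (- 1) \<star> (\<Sum>i\<in>{a<..b}. Eop i a (if i < M then f i else 0))"
    unfolding g_def lin_add[OF lin_Eop] lin_vscale[OF lin_Eop] sum.distrib vscale_sum ..
  also have "(\<Sum>i\<in>{a<..b}. Eop i a (act (U i) vac)) = act u vac"
    by (simp only: UC(3) act_peeled[OF B(3)])
  also have "(\<Sum>i\<in>{a<..b}. Eop i a (if i < M then f i else 0)) = (\<Sum>i\<in>{a<..<M}. Eop i a (f i))"
    using B by (intro sum.mono_neutral_cong_right) (auto simp: lin_0[OF lin_Eop])
  also have "act u vac + (- 1) \<star> (\<Sum>i\<in>{a<..<M}. Eop i a (f i)) = 0"
    by (simp only: f(2)[symmetric] vscale_minus_one right_minus)
  finally have sum0: "(\<Sum>i\<in>{a<..b}. Eop i a (g i)) = 0" .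
  have "g M = 0"
  proof (rule free_interval[OF B(4,3) _ _ sum0])
    show "col_vac a (g i)" if "i \<in> {a<..b}" for i
      unfolding g_def using that f(1)[of i] SL_col_vac[OF UC(1)[OF that], of a]
      by (intro col_vac_add col_vac_vscale) (auto simp: col_vac_0)
    show "bounded (g i)" if "i \<in> {a<..b}" for i
      unfolding g_def using that f(1)[of i]
      by (intro bounded_add bounded_vscale bounded_act_vac) (auto simp: bounded_0)
  qed (use B in auto)
  then have "act (U M) vac = 0"
    by (simp only: g_def less_irrefl if_False vscale_zero add_0_right)
  moreover have "act (U M) vac \<noteq> 0"
  \<comment> \<open>The scalar starts at 0 because the vector is annihilated by the raising operator
    at a as well.\<close>
  proof (rule odd_component_nonzero[OF B(1-3) UC, of 0])
    show "Eop r (Suc r) (act u vac) = 0" if "a < r" "r < b" for r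
      using u(4)[of r "Suc r"] that B by simp
    show "Eop a (Suc a) (act u vac) = - (0 \<star> act (U (Suc a)) vac)" if "Suc a < M"
      using u(4)[of a "Suc a"] that B by (simp only: vscale_zero minus_zero)
    show "0 + lam $ ix a - lam $ ix j + of_nat (j - a) \<noteq> 0" if j: "a < j" "j < M" for j
    proof
      assume "0 + lam $ ix a - lam $ ix j + of_nat (j - a) = 0"
      then have "lam $ ix a - lam $ ix j + ((rho :: ('k, 'm, 'n) wt) $ ix a - (rho :: ('k, 'm, 'n) wt) $ ix j) = 0"
        using rho_diff[of a j] j M_less_N by simp
      then have "(lam + rho) $ ix a = (lam + rho) $ ix j"
        by (simp add: algebra_simps)
      \<comment> \<open>A vanishing factor would put the root (j, b) with j > a into B, which is the
        second way for minimality to fail. The first way was excluded when the other roots were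
        shown to have peelable parts.\<close>
      then have "in_B j b" using ab j by (simp add: in_B_def)
      then show False using minimal j(1) by blast
    qed
  qed
  ultimately show False by blast
qed

lemma independent_iff_minimal:
  assumes "\<gamma> \<in> B_set lam"
  shows "independent_at \<theta> lam \<gamma> \<longleftrightarrow> weight_minimal lam \<gamma>"
proof -
  obtain a b where ab: "in_B a b" "\<gamma> = eroot (a, b)"
    using assms unfolding B_set_eq by blast
  show ?thesis
  proof
    assume indep: "independent_at \<theta> lam \<gamma>"
    show "weight_minimal lam \<gamma>"
      unfolding ab(2) weight_minimal_iff[OF ab(1)]
    proof (intro allI impI notI)
      fix c d assume cd: "in_B c d" "c = a \<and> d < b \<or> d = b \<and> a < c"
      obtain Z where Z: "\<theta> \<gamma> - Z * \<theta> (eroot (c, d)) \<in> verma_ideal lam"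
        using dependent[OF ab(1) cd] unfolding ab(2) by blast
      have "eroot (c, d) \<noteq> eroot (a, b)"
        using eroot_inj[of "(c, d)" "(a, b)"] cd ab(1) by (auto simp: in_B_def)
      then have "eroot (c, d) \<in> B_set lam - {\<gamma>}"
        using cd(1) ab(2) unfolding B_set_eq by blast
      from in_verma_submodule[where \<theta> = \<theta>, OF this Z] show False
        using indep unfolding independent_at_def by blast
    qed
  next
    assume "weight_minimal lam \<gamma>"
    then have minimal: "\<not> (c = a \<and> d < b \<or> d = b \<and> a < c)" if "in_B c d" for c d
      using that unfolding ab(2) weight_minimal_iff[OF ab(1)] by blast
    have False if mem: "verma_act lam (\<theta> \<gamma>) (verma_vec lam) \<in>
       verma_submodule lam ((\<lambda>\<gamma>'. verma_act lam (\<theta> \<gamma>') (verma_vec lam)) ` (B_set lam - {\<gamma>}))"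
    proof -
      obtain y where y: "y \<in> left_ideal (\<theta> ` (B_set lam - {\<gamma>}))"
          "\<theta> \<gamma> +o verma_ideal lam = y +o verma_ideal lam"
        using verma_submodule_coset[OF mem] by (auto simp only: verma_act_vec)
      then have "\<theta> \<gamma> \<in> y +o verma_ideal lam"
        using in_coset by blast
      then have "\<theta> \<gamma> - y \<in> verma_ideal lam"
        by (auto simp: elt_set_plus_def)
      then show False
        using independent[OF ab(1) minimal] y(1) unfolding ab(2) by blast
    qed
    then show "independent_at \<theta> lam \<gamma>"
      using assms unfolding independent_at_def by blast
  qed
qed

end

end

theorem theorem9p3:
  fixes lam \<gamma> :: "('k::{alg_closed_field,field_char_0}, 'm::{finite,linorder}, 'n::{finite,linorder}) wt"
    and rs :: "('k, 'm, 'n) wt list"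
    and \<theta> :: "('k, 'm, 'n) wt \<Rightarrow> ('k, 'm, 'n) Ugl"
  assumes "distinct rs" and "set rs = pos_roots"
    and "\<And>\<beta>. \<beta> \<in> odd_pos_roots \<Longrightarrow> shapovalov rs \<beta> (\<theta> \<beta>)"
    and "\<gamma> \<in> B_set lam"
  shows "independent_at \<theta> lam \<gamma> \<longleftrightarrow> weight_minimal lam \<gamma>"
proof -
  interpret verma_fock lam "CARD('m)" "CARD('m) + CARD('n)"
    by standard simp_all
  show ?thesis
    using assms by (rule independent_iff_minimal)
qed

end
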